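(* Let $k$ be a field of characteristic different from $2$ with separable closure $\bar k$, and let $f\in k(x)$ be a rational function of degree $2$, with critical points $p_0,q_0\in\mathbb{P}^1(\bar k)$, whose postcritical orbit $P=\bigcup_{n\ge1}f^n(\{p_0,q_0\})\subset\mathbb{P}^1(\bar k)$ is infinite. Let $G^{\rm geom}\subset G^{\rm arith}\subset W=\mathrm{Aut}(T)$ be the geometric and arithmetic iterated monodromy groups of $f$. (a) If $f^{r+1}(p_0)\neq f^{r+1}(q_0)$ for all $r\ge1$, then $G^{\rm geom}=G^{\rm arith}=W$. (b) Otherwise let $r\ge1$ be minimal with $f^{r+1}(p_0)=f^{r+1}(q_0)$. Then there exists $w\in W$ such that $G^{\rm geom}=wG(r)w^{-1}$.
   Context: Tree: $T$ is the regular rooted binary tree whose vertices are the finite words over $\{0,1\}$ (root = empty word; the children of $t$ are $t0,t1$). $W=\mathrm{Aut}(T)$ is the profinite group of automorphisms of $T$ fixing the root. Identifying the subtrees below the vertices $0$ and $1$ with $T$ gives $W=(W\times W)\rtimes\langle\sigma\rangle$, where $(u,v)$ acts by $u$ on the first and by $v$ on the second subtree, and $\sigma$ is the involution interchanging the two subtrees, so $\sigma(u,v)=(v,u)\sigma$. The group $G(r)$: for an integer $r\ge1$, define elements $a_i$ ($i\ge1$) and $b_j$ ($1\le j\le r$) of $W$ as the unique elements satisfying the recursion relations $a_1=\sigma$; $a_{r+1}=(a_r,b_r)$; $a_i=(a_{i-1},1)$ for all $i>1$ with $i\ne r+1$; $b_1=(b_r,b_r^{-1})\sigma$; $b_j=(b_rb_{j-1}b_r^{-1},1)$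 for all $1<j\le r$. (Such relations determine unique elements of $W$, level by level.) $G(r)$ is the closure in $W$ of the subgroup generated by all $a_i$ and $b_j$. Iterated monodromy groups: let $K=k(t)$ be the rational function field (function field of $\mathbb{P}^1_k$) and $K^{\rm sep}$ a separable closure of $K$ containing $\bar k$. The set $\coprod_{n\ge0}\{x\in\mathbb{P}^1(K^{\rm sep}) : f^n(x)=t\}$, with an edge from each $x$ at level $n\geq 1$ to $f(x)$ at level $n-1$, is a regular rooted binary tree, which is identified with $T$ by a fixed choice of isomorphism. $\mathrm{Gal}(K^{\rm sep}/K)$ acts on it. $G^{\rm arith}\subset W$ is the image of $\mathrm{Gal}(K^{\rm sep}/K)$ and $G^{\rm geom}\subset W$ is the image of $\mathrm{Gal}(K^{\rm sep}/\bar k(t))$. (Equivalently, these are the images of $\pi_1^{\rm \acute et}(\mathbb{P}^1_k\setminus P)$ and $\pi_1^{\rm \acute et}(\mathbb{P}^1_{\bar k}\setminus P)$ under the monodromy representation of the tower $\cdots\to\mathbb{P}^1_k\to\mathbb{P}^1_k\to\mathbb{P}^1_k$ with all maps $f$.) *)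

theory Defs
  imports
    "HOL-Computational_Algebra.Computational_Algebra"
    "HOL-Algebra.Generated_Groups"
    "HOL-Analysis.Function_Topology"
begin

section \<open>The automorphism group of the regular rooted binary tree\<close>

text \<open>Vertices are words over \<open>{False, True}\<close>, the letters \<open>False\<close> and \<open>True\<close> standing for \<open>0\<close>
  and \<open>1\<close>. A new letter is appended on the right, so the subtree below the vertex \<open>0\<close> consists of
  the words whose head is \<open>False\<close>.\<close>

type_synonym vertex = "bool list"

definition tree_child :: "vertex \<Rightarrow> vertex \<Rightarrow> bool" where
  "tree_child u v \<longleftrightarrow> (\<exists>x. v = u @ [x])"

definition tree_auts :: "(vertex \<Rightarrow> vertex) set" where
  "tree_auts = {g. bij g \<and> g [] = [] \<and> (\<forall>u v. tree_child u v \<longleftrightarrow> tree_child (g u) (g v))}"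

definition W :: "(vertex \<Rightarrow> vertex) monoid" where
  "W = \<lparr>carrier = tree_auts, mult = (\<circ>), one = id\<rparr>"

text \<open>The topology of pointwise convergence for the discrete topology on the vertices; as automorphisms
  preserve the (finite) levels, this is the profinite topology.\<close>

definition W_topology :: "(vertex \<Rightarrow> vertex) topology" where
  "W_topology = subtopology (product_topology (\<lambda>_. discrete_topology UNIV) UNIV) (carrier W)"

definition tree_pair :: "(vertex \<Rightarrow> vertex) \<Rightarrow> (vertex \<Rightarrow> vertex) \<Rightarrow> vertex \<Rightarrow> vertex" where
  "tree_pair u v w = (case w of [] \<Rightarrow> [] | x # s \<Rightarrow> x # (if x then v s else u s))"

definition tree_swap :: "vertex \<Rightarrow> vertex" where
  "tree_swap w = (case w of [] \<Rightarrow> [] | x # s \<Rightarrow> (\<not> x) # s)"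

definition level_agree :: "nat \<Rightarrow> (vertex \<Rightarrow> vertex) \<Rightarrow> (vertex \<Rightarrow> vertex) \<Rightarrow> bool" where
  "level_agree n g h \<longleftrightarrow> (\<forall>w. length w \<le> n \<longrightarrow> g w = h w)"

lemma tree_aut_length: "g \<in> tree_auts \<Longrightarrow> length (g w) = length w"
proof (induction w rule: rev_induct)
  case Nil
  then show ?case by (simp add: tree_auts_def)
next
  case (snoc x w)
  have "tree_child (g w) (g (w @ [x]))"
    using snoc.prems by (auto simp: tree_auts_def tree_child_def)
  then show ?case using snoc by (auto simp: tree_child_def)
qed

lemma tree_autsI:
  assumes "bij g" "g [] = []" "\<And>u x. \<exists>y. g (u @ [x]) = g u @ [y]"
  shows "g \<in> tree_auts"
proof -
  have child: "tree_child (g u) (g v)" if "tree_child u v" for u v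
    using that assms(3) by (auto simp: tree_child_def)
  have len: "length (g w) = length w" for w
  proof (induction w rule: rev_induct)
    case (snoc x w)
    then show ?case using assms(3)[of w x] by auto
  qed (simp add: assms(2))
  have "tree_child u v" if *: "tree_child (g u) (g v)" for u v
  proof -
    obtain y where y: "g v = g u @ [y]" using * by (auto simp: tree_child_def)
    then have "length v = Suc (length u)" using len[of v] len[of u] by simp
    then obtain v' x where v: "v = v' @ [x]" by (cases v rule: rev_cases) auto
    obtain z where "g v = g v' @ [z]" using assms(3)[of v' x] v by auto
    with y have "g v' = g u" by simp
    then have "v' = u" using assms(1) by (simp add: bij_is_inj inj_eq)
    then show ?thesis using v by (auto simp: tree_child_def)
  qed
  then show ?thesis using assms child unfolding tree_auts_def by blast
qed

lemma tree_aut_inv: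
  assumes "g \<in> tree_auts" shows "inv_into UNIV g \<in> tree_auts"
proof -
  have b: "bij g" using assms by (simp add: tree_auts_def)
  have gi: "g (inv_into UNIV g x) = x" for x by (simp add: b bij_is_surj surj_f_inv_f)
  have "inv_into UNIV g [] = []"
    using b assms by (metis (mono_tags, lifting) bij_is_inj inv_f_f mem_Collect_eq tree_auts_def)
  moreover have "tree_child u v \<longleftrightarrow> tree_child (inv_into UNIV g u) (inv_into UNIV g v)" for u v
  proof -
    have "tree_child (inv_into UNIV g u) (inv_into UNIV g v) \<longleftrightarrow>
      tree_child (g (inv_into UNIV g u)) (g (inv_into UNIV g v))"
      using assms unfolding tree_auts_def by blast
    then show ?thesis by (simp add: gi)
  qed
  ultimately show ?thesis using b unfolding tree_auts_def by (blast intro: bij_imp_bij_inv)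
qed

lemma tree_aut_comp:
  assumes "g \<in> tree_auts" "h \<in> tree_auts" shows "g \<circ> h \<in> tree_auts"
proof -
  have "tree_child u v \<longleftrightarrow> tree_child (g (h u)) (g (h v))" for u v
    using assms unfolding tree_auts_def by blast
  moreover have "bij (g \<circ> h)" using assms by (intro bij_comp) (auto simp only: tree_auts_def)
  moreover have "g (h []) = []" using assms unfolding tree_auts_def by simp
  ultimately show ?thesis unfolding tree_auts_def comp_apply mem_Collect_eq by blast
qed

lemma tree_aut_id: "id \<in> tree_auts"
  unfolding tree_auts_def by simp

lemma group_W: "group W"
proof (rule groupI)
  fix g assume "g \<in> carrier W"
  then have g: "g \<in> tree_auts" by (simp add: W_def)
  then have "inv_into UNIV g \<circ> g = id" by (simp add: tree_auts_def bij_is_inj)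
  then show "\<exists>h\<in>carrier W. h \<otimes>\<^bsub>W\<^esub> g = \<one>\<^bsub>W\<^esub>"
    using tree_aut_inv[OF g] by (auto simp: W_def)
qed (simp_all add: W_def tree_aut_comp tree_aut_id comp_assoc)

lemma W_simps [simp]:
  "carrier W = tree_auts" "g \<otimes>\<^bsub>W\<^esub> h = g \<circ> h" "\<one>\<^bsub>W\<^esub> = id"
  by (simp_all add: W_def)

lemma W_inv:
  assumes "g \<in> tree_auts" shows "inv\<^bsub>W\<^esub> g = inv_into UNIV g"
proof (rule group.inv_equality[OF group_W])
  show "inv_into UNIV g \<otimes>\<^bsub>W\<^esub> g = \<one>\<^bsub>W\<^esub>"
    using assms by (simp add: tree_auts_def bij_is_inj)
qed (use assms tree_aut_inv in auto)

lemma tree_pair_aut: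
  assumes u: "u \<in> tree_auts" and v: "v \<in> tree_auts"
  shows "tree_pair u v \<in> tree_auts"
proof (rule tree_autsI)
  have bu: "bij u" and bv: "bij v" using u v by (auto simp: tree_auts_def)
  have "tree_pair u v \<circ> tree_pair (inv_into UNIV u) (inv_into UNIV v) = id"
    using bu bv by (auto simp: fun_eq_iff tree_pair_def bij_is_surj surj_f_inv_f split: list.split)
  moreover have "tree_pair (inv_into UNIV u) (inv_into UNIV v) \<circ> tree_pair u v = id"
    using bu bv by (auto simp: fun_eq_iff tree_pair_def bij_is_inj split: list.split)
  ultimately show "bij (tree_pair u v)" by (rule o_bij[rotated])
  show "tree_pair u v [] = []" by (simp add: tree_pair_def)
  have *: "\<exists>y. g (s @ [x]) = g s @ [y]" if "g \<in> tree_auts" for g s x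
    using that by (auto simp: tree_auts_def tree_child_def)
  have nil: "u [] = []" "v [] = []" using u v by (auto simp: tree_auts_def)
  fix w x show "\<exists>y. tree_pair u v (w @ [x]) = tree_pair u v w @ [y]"
    using *[OF u] *[OF v] nil by (cases w) (auto simp: tree_pair_def)
qed

lemma tree_swap_aut: "tree_swap \<in> tree_auts"
proof (rule tree_autsI)
  have "tree_swap \<circ> tree_swap = id"
    by (auto simp: fun_eq_iff tree_swap_def split: list.split)
  then show "bij tree_swap" by (metis o_bij)
  show "tree_swap [] = []" by (simp add: tree_swap_def)
  fix w x show "\<exists>y. tree_swap (w @ [x]) = tree_swap w @ [y]"
    by (cases w) (auto simp: tree_swap_def)
qed

lemma tree_swap_pair: "tree_swap \<circ> tree_pair u v = tree_pair v u \<circ> tree_swap"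
  by (auto simp: fun_eq_iff tree_swap_def tree_pair_def split: list.split)

lemma closure_of_W_topology:
  assumes "S \<subseteq> carrier W"
  shows "W_topology closure_of S = {g \<in> carrier W. \<forall>n. \<exists>h\<in>S. level_agree n g h}"
proof (intro equalityI subsetI)
  let ?P = "product_topology (\<lambda>_::vertex. discrete_topology (UNIV :: vertex set)) UNIV"
  fix g assume g: "g \<in> W_topology closure_of S"
  then have gW: "g \<in> carrier W" by (auto simp: in_closure_of W_topology_def)
  have "\<exists>h\<in>S. level_agree n g h" for n
  proof -
    define U where "U = Pi\<^sub>E UNIV (\<lambda>w. if length w \<le> n then {g w} else UNIV)"
    have "finite {w::vertex. length w \<le> n}"
      using finite_lists_length_le[of "UNIV :: bool set" n] by simp
    then have "finite {w. (if length w \<le> n then {g w} else UNIV) \<noteq> UNIV}"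
      by (rule rev_finite_subset) auto
    then have "openin ?P U"
      unfolding U_def by (intro product_topology_basis) simp_all
    then have "openin W_topology (U \<inter> carrier W)"
      unfolding W_topology_def by (auto simp: openin_subtopology)
    moreover have "g \<in> U \<inter> carrier W" using gW by (auto simp: U_def)
    ultimately obtain h where "h \<in> S" "h \<in> U" using g unfolding in_closure_of by blast
    moreover have "h w = g w" if "length w \<le> n" for w
    proof -
      have "h w \<in> (if length w \<le> n then {g w} else UNIV)"
        using \<open>h \<in> U\<close> unfolding U_def by (rule PiE_mem) simp
      then show ?thesis using that by simp
    qed
    ultimately show ?thesis by (intro bexI[of _ h]) (simp_all add: level_agree_def)
  qed
  with gW show "g \<in> {g \<in> carrier W. \<forall>n. \<exists>h\<in>S. level_agree n g h}" by blast
next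
  let ?P = "product_topology (\<lambda>_::vertex. discrete_topology (UNIV :: vertex set)) UNIV"
  fix g assume g: "g \<in> {g \<in> carrier W. \<forall>n. \<exists>h\<in>S. level_agree n g h}"
  have "\<exists>h. h \<in> S \<and> h \<in> T" if gT: "g \<in> T" and T: "openin W_topology T" for T
  proof -
    obtain U where U: "openin ?P U" "T = U \<inter> carrier W"
      using T by (auto simp: W_topology_def openin_subtopology)
    then obtain V where V: "finite {i. V i \<noteq> UNIV}" "g \<in> Pi\<^sub>E UNIV V" "Pi\<^sub>E UNIV V \<subseteq> U"
      using gT unfolding openin_product_topology_alt by force
    define n where "n = Max (insert 0 (length ` {i. V i \<noteq> UNIV}))"
    have n: "length i \<le> n" if "V i \<noteq> UNIV" for i
      unfolding n_def using V(1) that by (intro Max_ge) auto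
    obtain h where h: "h \<in> S" "level_agree n g h" using g by blast
    have "h i \<in> V i" for i
    proof (cases "V i = UNIV")
      case False
      then have "h i = g i" using n h(2) by (simp add: level_agree_def)
      then show ?thesis using V(2) by (simp add: PiE_iff)
    qed simp
    then show ?thesis using V(3) h(1) U(2) assms by blast
  qed
  then show "g \<in> W_topology closure_of S"
    using g by (auto simp: in_closure_of W_topology_def)
qed


section \<open>The group G(r)\<close>

definition gen_relations :: "nat \<Rightarrow> (nat \<Rightarrow> vertex \<Rightarrow> vertex) \<Rightarrow> (nat \<Rightarrow> vertex \<Rightarrow> vertex) \<Rightarrow> bool" where
  "gen_relations r a b \<longleftrightarrow>
     (\<forall>i\<ge>1. a i \<in> carrier W) \<and> (\<forall>j\<in>{1..r}. b j \<in> carrier W) \<and>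
     a 1 = tree_swap \<and>
     a (r + 1) = tree_pair (a r) (b r) \<and>
     (\<forall>i>1. i \<noteq> r + 1 \<longrightarrow> a i = tree_pair (a (i - 1)) \<one>\<^bsub>W\<^esub>) \<and>
     b 1 = tree_pair (b r) (inv\<^bsub>W\<^esub> (b r)) \<otimes>\<^bsub>W\<^esub> tree_swap \<and>
     (\<forall>j. 1 < j \<and> j \<le> r \<longrightarrow>
        b j = tree_pair (b r \<otimes>\<^bsub>W\<^esub> b (j - 1) \<otimes>\<^bsub>W\<^esub> inv\<^bsub>W\<^esub> (b r)) \<one>\<^bsub>W\<^esub>)"

text \<open>For \<open>r \<ge> 1\<close> the choice made here is determined at all relevant indices, by the lemmas
  \<open>gen_relations_exist\<close> and \<open>gen_relations_unique\<close>.\<close>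

definition gen_elems :: "nat \<Rightarrow> (nat \<Rightarrow> vertex \<Rightarrow> vertex) \<times> (nat \<Rightarrow> vertex \<Rightarrow> vertex)" where
  "gen_elems r = (SOME (a, b). gen_relations r a b)"

definition gen_a :: "nat \<Rightarrow> nat \<Rightarrow> vertex \<Rightarrow> vertex" where "gen_a r = fst (gen_elems r)"
definition gen_b :: "nat \<Rightarrow> nat \<Rightarrow> vertex \<Rightarrow> vertex" where "gen_b r = snd (gen_elems r)"

definition G :: "nat \<Rightarrow> (vertex \<Rightarrow> vertex) set" where
  "G r = W_topology closure_of (generate W (gen_a r ` {1..} \<union> gen_b r ` {1..r}))"

lemma level_agree_comp:
  "level_agree n g g' \<Longrightarrow> level_agree n h h' \<Longrightarrow> h \<in> tree_auts \<Longrightarrow>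
   level_agree n (g \<circ> h) (g' \<circ> h')"
  by (simp add: level_agree_def) (metis tree_aut_length)

lemma level_agree_inv:
  assumes "level_agree n g h" "g \<in> tree_auts" "h \<in> tree_auts"
  shows "level_agree n (inv_into UNIV g) (inv_into UNIV h)"
  unfolding level_agree_def
proof (intro allI impI)
  fix w :: vertex assume w: "length w \<le> n"
  have bg: "bij g" and bh: "bij h" using assms by (auto simp: tree_auts_def)
  have "h (inv_into UNIV g w) = g (inv_into UNIV g w)"
    using assms(1) w tree_aut_length[OF tree_aut_inv[OF assms(2)]] by (simp add: level_agree_def)
  also have "\<dots> = w" using bg by (simp add: bij_is_surj surj_f_inv_f)
  finally show "inv_into UNIV g w = inv_into UNIV h w" using bh by (metis bij_inv_eq_iff)
qed

lemma level_agree_pair: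
  "level_agree n u u' \<Longrightarrow> level_agree n v v' \<Longrightarrow>
   level_agree (Suc n) (tree_pair u v) (tree_pair u' v')"
  by (auto simp: level_agree_def tree_pair_def split: list.split)

definition gen_step :: "nat \<Rightarrow> (nat \<Rightarrow> vertex \<Rightarrow> vertex) \<Rightarrow> (nat \<Rightarrow> vertex \<Rightarrow> vertex) \<Rightarrow>
    (nat \<Rightarrow> vertex \<Rightarrow> vertex) \<times> (nat \<Rightarrow> vertex \<Rightarrow> vertex)" where
  "gen_step r a b =
     ((\<lambda>i. if i = 1 then tree_swap
           else if i = r + 1 then tree_pair (a r) (b r) else tree_pair (a (i - 1)) id),
      (\<lambda>j. if j = 1 then tree_pair (b r) (inv_into UNIV (b r)) \<circ> tree_swap
           else tree_pair (b r \<circ> b (j - 1) \<circ> inv_into UNIV (b r)) id))"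

definition gens_agree :: "nat \<Rightarrow> nat \<Rightarrow> (nat \<Rightarrow> vertex \<Rightarrow> vertex) \<Rightarrow> (nat \<Rightarrow> vertex \<Rightarrow> vertex) \<Rightarrow>
    (nat \<Rightarrow> vertex \<Rightarrow> vertex) \<Rightarrow> (nat \<Rightarrow> vertex \<Rightarrow> vertex) \<Rightarrow> bool" where
  "gens_agree r n a b a' b' \<longleftrightarrow>
     (\<forall>i\<ge>1. level_agree n (a i) (a' i)) \<and> (\<forall>j\<in>{1..r}. level_agree n (b j) (b' j))"

definition gens_auts :: "nat \<Rightarrow> (nat \<Rightarrow> vertex \<Rightarrow> vertex) \<Rightarrow> (nat \<Rightarrow> vertex \<Rightarrow> vertex) \<Rightarrow> bool" where
  "gens_auts r a b \<longleftrightarrow> (\<forall>i\<ge>1. a i \<in> tree_auts) \<and> (\<forall>j\<in>{1..r}. b j \<in> tree_auts)"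

lemma gens_autsD:
  assumes "gens_auts r a b"
  shows "1 \<le> i \<Longrightarrow> a i \<in> tree_auts" "1 \<le> j \<Longrightarrow> j \<le> r \<Longrightarrow> b j \<in> tree_auts"
  using assms by (auto simp: gens_auts_def)

lemma gens_agreeD:
  assumes "gens_agree r n a b a' b'"
  shows "1 \<le> i \<Longrightarrow> level_agree n (a i) (a' i)"
    "1 \<le> j \<Longrightarrow> j \<le> r \<Longrightarrow> level_agree n (b j) (b' j)"
  using assms by (auto simp: gens_agree_def)

lemma gen_step_auts:
  assumes au: "gens_auts r a b" and r: "r \<ge> 1"
  shows "gens_auts r (fst (gen_step r a b)) (snd (gen_step r a b))"
proof -
  have ar: "a r \<in> tree_auts" and br: "b r \<in> tree_auts" using gens_autsD(1)[OF au r] gens_autsD(2)[OF au r le_refl] by simp_all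
  have "fst (gen_step r a b) i \<in> tree_auts" if "1 \<le> i" for i
  proof (cases "i = 1 \<or> i = r + 1")
    case True
    then show ?thesis using tree_swap_aut tree_pair_aut[OF ar br] by (auto simp: gen_step_def)
  next
    case False
    then have "a (i - 1) \<in> tree_auts" using that by (intro gens_autsD[OF au]) auto
    then show ?thesis using False by (simp add: gen_step_def tree_pair_aut tree_aut_id)
  qed
  moreover have "snd (gen_step r a b) j \<in> tree_auts" if "1 \<le> j" "j \<le> r" for j
  proof (cases "j = 1")
    case True
    then show ?thesis
      using br by (simp add: gen_step_def tree_pair_aut tree_aut_comp tree_aut_inv tree_swap_aut)
  next
    case False
    then have "b (j - 1) \<in> tree_auts" using that by (intro gens_autsD[OF au]) simp_all
    then show ?thesis
      using br False by (simp add: gen_step_def tree_pair_aut tree_aut_comp tree_aut_inv tree_aut_id)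
  qed
  ultimately show ?thesis by (simp add: gens_auts_def)
qed

lemma gen_step_agree:
  assumes ag: "gens_agree r n a b a' b'"
    and au: "gens_auts r a b" and au': "gens_auts r a' b'" and r: "r \<ge> 1"
  shows "gens_agree r (Suc n) (fst (gen_step r a b)) (snd (gen_step r a b))
           (fst (gen_step r a' b')) (snd (gen_step r a' b'))"
proof -
  have refl: "level_agree m g g" for m g by (simp add: level_agree_def)
  have br: "b r \<in> tree_auts" "b' r \<in> tree_auts"
    using gens_autsD(2)[OF au r le_refl] gens_autsD(2)[OF au' r le_refl] .
  have aar: "level_agree n (a r) (a' r)" and abr: "level_agree n (b r) (b' r)"
    using gens_agreeD(1)[OF ag r] gens_agreeD(2)[OF ag r le_refl] .
  have inv: "level_agree n (inv_into UNIV (b r)) (inv_into UNIV (b' r))"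
    by (rule level_agree_inv[OF abr br])
  have "level_agree (Suc n) (fst (gen_step r a b) i) (fst (gen_step r a' b') i)" if "1 \<le> i" for i
  proof (cases "i = 1 \<or> i = r + 1")
    case True
    then show ?thesis using level_agree_pair[OF aar abr] r refl by (auto simp: gen_step_def)
  next
    case False
    then have "level_agree n (a (i - 1)) (a' (i - 1))"
      using that by (intro gens_agreeD[OF ag]) auto
    then show ?thesis using False by (simp add: gen_step_def level_agree_pair refl)
  qed
  moreover
  have "level_agree (Suc n) (snd (gen_step r a b) j) (snd (gen_step r a' b') j)"
    if "1 \<le> j" "j \<le> r" for j
  proof (cases "j = 1")
    case True
    then show ?thesis
      using level_agree_comp[OF level_agree_pair[OF abr inv] refl tree_swap_aut]
      by (simp add: gen_step_def)
  next
    case False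
    then have "b (j - 1) \<in> tree_auts" "level_agree n (b (j - 1)) (b' (j - 1))"
      using that gens_autsD[OF au] gens_agreeD[OF ag] by simp_all
    then have "level_agree n (b r \<circ> b (j - 1) \<circ> inv_into UNIV (b r))
        (b' r \<circ> b' (j - 1) \<circ> inv_into UNIV (b' r))"
      using abr inv br by (simp add: level_agree_comp tree_aut_inv)
    then show ?thesis using False by (simp add: gen_step_def level_agree_pair refl)
  qed
  ultimately show ?thesis by (simp add: gens_agree_def)
qed

lemma gen_relations_iff:
  assumes r: "r \<ge> 1"
  shows "gen_relations r a b \<longleftrightarrow> gens_auts r a b \<and>
    (\<forall>i\<ge>1. a i = fst (gen_step r a b) i) \<and> (\<forall>j\<in>{1..r}. b j = snd (gen_step r a b) j)"
proof (cases "gens_auts r a b")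
  case True
  then have inv: "inv\<^bsub>W\<^esub> (b r) = inv_into UNIV (b r)"
    by (intro W_inv gens_autsD(2)[OF _ r le_refl])
  have A: "(\<forall>i\<ge>1. a i = fst (gen_step r a b) i) \<longleftrightarrow>
      a 1 = tree_swap \<and> a (r + 1) = tree_pair (a r) (b r) \<and>
      (\<forall>i>1. i \<noteq> r + 1 \<longrightarrow> a i = tree_pair (a (i - 1)) id)" (is "?L \<longleftrightarrow> ?R")
  proof
    assume ?L
    then show ?R using r by (auto simp: gen_step_def)
  next
    assume ?R
    then show ?L using r by (simp add: gen_step_def)
  qed
  have B: "(\<forall>j\<in>{1..r}. b j = snd (gen_step r a b) j) \<longleftrightarrow>
      b 1 = tree_pair (b r) (inv_into UNIV (b r)) \<circ> tree_swap \<and>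
      (\<forall>j. 1 < j \<and> j \<le> r \<longrightarrow> b j = tree_pair (b r \<circ> b (j - 1) \<circ> inv_into UNIV (b r)) id)"
    (is "?L \<longleftrightarrow> ?R")
  proof
    assume L: ?L
    have "b j = tree_pair (b r \<circ> b (j - 1) \<circ> inv_into UNIV (b r)) id" if "1 < j" "j \<le> r" for j
      using bspec[OF L, of j] that by (simp add: gen_step_def)
    moreover have "b 1 = tree_pair (b r) (inv_into UNIV (b r)) \<circ> tree_swap"
      using bspec[OF L, of 1] r by (simp add: gen_step_def)
    ultimately show ?R by blast
  next
    assume R: ?R
    show ?L
    proof
      fix j assume j: "j \<in> {1..r}"
      show "b j = snd (gen_step r a b) j"
      proof (cases "j = 1")
        case True
        then show ?thesis using conjunct1[OF R] by (simp add: gen_step_def)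
      next
        case False
        then show ?thesis using conjunct2[OF R, rule_format, of j] j by (simp add: gen_step_def)
      qed
    qed
  qed
  show ?thesis
    using True unfolding A B unfolding gen_relations_def inv gens_auts_def W_simps by blast
next
  case False
  then show ?thesis by (auto simp: gen_relations_def gens_auts_def)
qed

lemma gens_agree_0:
  assumes "gens_auts r a b" "gens_auts r a' b'"
  shows "gens_agree r 0 a b a' b'"
proof -
  have "level_agree 0 g h" if "g \<in> tree_auts" "h \<in> tree_auts" for g h
    using that by (simp add: level_agree_def tree_auts_def)
  then show ?thesis using assms by (simp add: gens_agree_def gens_auts_def)
qed

lemma gens_agree_all:
  assumes "\<And>n. gens_agree r n a b a' b'"
  shows "(\<forall>i\<ge>1. a i = a' i) \<and> (\<forall>j\<in>{1..r}. b j = b' j)"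
proof (intro conjI allI impI ballI ext)
  fix i :: nat and w :: vertex assume "1 \<le> i"
  then show "a i w = a' i w"
    using assms[of "length w"] by (simp add: gens_agree_def level_agree_def)
next
  fix j and w :: vertex assume "j \<in> {1..r}"
  then show "b j w = b' j w"
    using assms[of "length w"] by (simp add: gens_agree_def level_agree_def)
qed

lemma gens_agree_cong:
  assumes "\<forall>i\<ge>1. a i = c i" "\<forall>j\<in>{1..r}. b j = d j" "\<forall>i\<ge>1. a' i = c' i" "\<forall>j\<in>{1..r}. b' j = d' j"
  shows "gens_agree r n a b a' b' \<longleftrightarrow> gens_agree r n c d c' d'"
  using assms by (simp add: gens_agree_def)

theorem gen_relations_unique:
  assumes "r \<ge> 1" "gen_relations r a b" "gen_relations r a' b'"
  shows "(\<forall>i\<ge>1. a i = a' i) \<and> (\<forall>j\<in>{1..r}. b j = b' j)"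
proof (rule gens_agree_all)
  have A: "gens_auts r a b" "gens_auts r a' b'" using assms gen_relations_iff by blast+
  fix n show "gens_agree r n a b a' b'"
  proof (induction n)
    case 0
    show ?case by (rule gens_agree_0[OF A])
  next
    case (Suc n)
    then have "gens_agree r (Suc n) (fst (gen_step r a b)) (snd (gen_step r a b))
           (fst (gen_step r a' b')) (snd (gen_step r a' b'))"
      using A assms(1) by (intro gen_step_agree)
    moreover have "\<forall>i\<ge>1. a i = fst (gen_step r a b) i" "\<forall>j\<in>{1..r}. b j = snd (gen_step r a b) j"
      "\<forall>i\<ge>1. a' i = fst (gen_step r a' b') i" "\<forall>j\<in>{1..r}. b' j = snd (gen_step r a' b') j"
      using assms(2,3) gen_relations_iff[OF assms(1)] by blast+
    ultimately show ?case using gens_agree_cong by blast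
  qed
qed

theorem gen_relations_exist:
  assumes "r \<ge> 1" shows "\<exists>a b. gen_relations r a b"
proof -
  define X where "X = (\<lambda>n. ((\<lambda>(a, b). gen_step r a b) ^^ n) (\<lambda>_. id, \<lambda>_. id))"
  have X_Suc: "X (Suc n) = gen_step r (fst (X n)) (snd (X n))" for n
    by (simp add: X_def case_prod_beta)
  have X_auts: "gens_auts r (fst (X n)) (snd (X n))" for n
  proof (induction n)
    case 0 show ?case using tree_aut_id by (simp add: X_def gens_auts_def id_def)
  next
    case (Suc n) show ?case unfolding X_Suc by (rule gen_step_auts[OF Suc assms])
  qed
  have X_agree: "gens_agree r n (fst (X n)) (snd (X n)) (fst (X (n + k))) (snd (X (n + k)))" for n k
  proof (induction n)
    case 0
    show ?case by (rule gens_agree_0[OF X_auts X_auts])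
  next
    case (Suc n)
    show ?case
      unfolding X_Suc add_Suc by (rule gen_step_agree[OF Suc X_auts X_auts assms])
  qed
  define a where "a = (\<lambda>i w. fst (X (length w)) i w)"
  define b where "b = (\<lambda>j w. snd (X (length w)) j w)"
  have lim: "gens_agree r n a b (fst (X n)) (snd (X n))" for n
    unfolding gens_agree_def level_agree_def
  proof (intro conjI allI impI ballI)
    fix i w assume "(1::nat) \<le> i" "length (w::vertex) \<le> n"
    then show "a i w = fst (X n) i w"
      using X_agree[of "length w" "n - length w"] by (simp add: a_def gens_agree_def level_agree_def)
  next
    fix j w assume "j \<in> {1..r}" "length (w::vertex) \<le> n"
    then show "b j w = snd (X n) j w"
      using X_agree[of "length w" "n - length w"] by (simp add: b_def gens_agree_def level_agree_def)
  qed
  have aut: "g \<in> tree_auts" if lvl: "\<And>n. \<exists>h\<in>tree_auts. level_agree n g h" for g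
  proof (rule tree_autsI)
    have len: "length (g w) = length w" for w
      using lvl[of "length w"] tree_aut_length by (force simp: level_agree_def)
    show "bij g"
    proof (rule bijI)
      show "inj g"
      proof (rule injI)
        fix u v :: vertex assume eq: "g u = g v"
        then have l: "length u = length v" using len by metis
        obtain h where h: "h \<in> tree_auts" "level_agree (length u) g h"
          using lvl by blast
        then have "h u = h v" using eq l by (simp add: level_agree_def)
        then show "u = v" using h(1) by (simp add: tree_auts_def bij_is_inj inj_eq)
      qed
      show "surj g"
      proof (rule surjI)
        fix v :: vertex
        obtain h where h: "h \<in> tree_auts" "level_agree (length v) g h"
          using lvl by blast
        have "\<exists>u. g u = v"
        proof
          show "g (inv_into UNIV h v) = v"
            using h tree_aut_length[OF tree_aut_inv[OF h(1)], of v]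
            by (simp add: level_agree_def tree_auts_def bij_is_surj surj_f_inv_f)
        qed
        then show "g (SOME u. g u = v) = v" by (rule someI_ex)
      qed
    qed
    show "g [] = []" using len by (metis length_0_conv list.size(3))
    fix u :: vertex and x
    obtain h where h: "h \<in> tree_auts" "level_agree (Suc (length u)) g h"
          using lvl by blast
    then have "tree_child (h u) (h (u @ [x]))" by (auto simp: tree_auts_def tree_child_def)
    then show "\<exists>y. g (u @ [x]) = g u @ [y]" using h(2) by (auto simp: tree_child_def level_agree_def)
  qed
  have auts: "gens_auts r a b"
    unfolding gens_auts_def
  proof (intro conjI allI impI ballI)
    fix i :: nat assume "1 \<le> i"
    then show "a i \<in> tree_auts" using gens_autsD(1)[OF X_auts] gens_agreeD(1)[OF lim] by (intro aut) blast
  next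
    fix j assume "j \<in> {1..r}"
    then have "1 \<le> j" "j \<le> r" by auto
    then show "b j \<in> tree_auts" using gens_autsD(2)[OF X_auts] gens_agreeD(2)[OF lim] by (intro aut) blast
  qed
  have "gens_agree r n (fst (gen_step r a b)) (snd (gen_step r a b)) a b" for n
  proof -
    have "gens_agree r (Suc n) (fst (gen_step r a b)) (snd (gen_step r a b))
       (fst (X (Suc n))) (snd (X (Suc n)))"
      unfolding X_Suc by (rule gen_step_agree[OF lim auts X_auts assms])
    then show ?thesis
      using lim[of "Suc n"] by (simp add: gens_agree_def level_agree_def)
  qed
  from gens_agree_all[OF this] have "gen_relations r a b"
    using auts assms by (simp add: gen_relations_iff)
  then show ?thesis by blast
qed

corollary gen_relations_gen:
  assumes "r \<ge> 1" shows "gen_relations r (gen_a r) (gen_b r)"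
proof -
  obtain a b where "gen_relations r a b" using gen_relations_exist[OF assms] by blast
  then have "case (a, b) of (a, b) \<Rightarrow> gen_relations r a b" by simp
  then have "case gen_elems r of (a, b) \<Rightarrow> gen_relations r a b" unfolding gen_elems_def by (rule someI)
  then show ?thesis by (simp add: gen_a_def gen_b_def case_prod_beta)
qed


section \<open>Rational maps of the projective line\<close>

datatype 'a proj_line = Fin 'a | Infty

definition proj_points :: "'a set \<Rightarrow> 'a proj_line set" where
  "proj_points S = insert Infty (Fin ` S)"

definition lowest_terms :: "'k::field poly fract \<Rightarrow> 'k poly \<times> 'k poly" where
  "lowest_terms f = (THE (A, B). f = Fract A B \<and> coprime A B \<and> lead_coeff B = 1)"

lemma coprime_poly_bezout:
  fixes A B :: "'k::field poly"
  assumes "coprime A B" shows "\<exists>u v. u * A + v * B = 1"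
proof -
  have "\<exists>u v d. u * A + v * B = d \<and> d dvd A \<and> d dvd B" for A B :: "'k poly"
  proof (induction "if B = 0 then 0 else Suc (degree B)" arbitrary: A B rule: less_induct)
    case less
    show ?case
    proof (cases "B = 0")
      case True
      then show ?thesis by (intro exI[of _ 1] exI[of _ 0] exI[of _ A]) simp
    next
      case False
      then have "(if A mod B = 0 then 0 else Suc (degree (A mod B)))
          < (if B = 0 then 0 else Suc (degree B))"
        using degree_mod_less[of B A] by auto
      from less[OF this] obtain u v d
        where d: "u * B + v * (A mod B) = d" "d dvd B" "d dvd A mod B" by blast
      have "v * A + (u - v * (A div B)) * B = u * B + v * (A - A div B * B)"
        by (simp add: algebra_simps)
      also have "\<dots> = d" using d(1) by (simp add: minus_div_mult_eq_mod)
      finally show ?thesis using d(2,3) by (metis dvd_mod_iff)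
    qed
  qed
  then obtain u v d where d: "u * A + v * B = d" "d dvd A" "d dvd B" by blast
  then have "is_unit d" using assms by (simp add: coprime_def)
  then obtain e where e: "1 = d * e" by (rule dvdE)
  have "(e * u) * A + (e * v) * B = e * (u * A + v * B)" by (simp add: distrib_left mult.assoc)
  also have "\<dots> = 1" unfolding d(1) e by (rule mult.commute)
  finally show ?thesis by blast
qed

theorem lowest_terms_ex1:
  fixes f :: "'k::field poly fract"
  shows "\<exists>!(A, B). f = Fract A B \<and> coprime A B \<and> lead_coeff B = 1"
proof -
  have ex: "\<exists>A B. f = Fract A B \<and> coprime A B \<and> lead_coeff B = 1"
  proof -
    obtain A0 B0 where 0: "f = Fract A0 B0" "B0 \<noteq> 0" by (cases f) auto
    define P where "P = (\<lambda>d. \<exists>A B. f = Fract A B \<and> B \<noteq> 0 \<and> degree B = d)"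
    have "P (degree B0)" using 0 by (auto simp: P_def)
    then have "P (LEAST d. P d)" by (rule LeastI)
    then obtain A B where AB: "f = Fract A B" "B \<noteq> 0" "degree B = (LEAST d. P d)"
      unfolding P_def by blast
    have "coprime A B"
    proof (rule coprimeI)
      fix C assume "C dvd A" "C dvd B"
      then obtain A' B' where C: "A = C * A'" "B = C * B'" by (elim dvdE)
      then have nz: "C \<noteq> 0" "B' \<noteq> 0" using AB(2) by auto
      then have "f = Fract A' B'" using AB(1) C by (simp add: mult_fract_cancel)
      then have "P (degree B')" using nz by (auto simp: P_def)
      then have "degree B \<le> degree B'" using AB(3) by (simp add: Least_le)
      then have "degree C = 0" using C nz by (simp add: degree_mult_eq)
      then show "is_unit C" using nz by (simp add: is_unit_iff_degree)
    qed
    define c where "c = inverse (lead_coeff B)"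
    have c: "c \<noteq> 0" "c * lead_coeff B = 1" using AB(2) by (auto simp: c_def)
    have "f = Fract (smult c A) (smult c B)"
      using mult_fract_cancel[of "[:c:]" A B] AB c by simp
    moreover have "coprime (smult c A) (smult c B)"
      using \<open>coprime A B\<close> c by (simp add: coprime_def dvd_smult_iff)
    ultimately show ?thesis using c by (metis lead_coeff_smult)
  qed
  have dvd: "B dvd B'" if "Fract A B = Fract A' B'" "coprime A B" "B \<noteq> 0" "B' \<noteq> 0"
    for A B A' B' :: "'k poly"
  proof -
    have eq: "A * B' = A' * B" using that by (simp add: eq_fract)
    obtain u v where uv: "u * A + v * B = 1" using coprime_poly_bezout \<open>coprime A B\<close> by blast
    have "B' = (u * A + v * B) * B'" by (simp add: uv)
    also have "\<dots> = u * (A * B') + v * B * B'" by (simp add: algebra_simps)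
    also have "\<dots> = B * (u * A' + v * B')" by (simp add: eq algebra_simps)
    finally show ?thesis by (metis dvd_triv_left)
  qed
  have un: "A = A' \<and> B = B'"
    if *: "f = Fract A B" "coprime A B" "lead_coeff B = 1"
          "f = Fract A' B'" "coprime A' B'" "lead_coeff B' = 1" for A B A' B'
  proof -
    have nz: "B \<noteq> 0" "B' \<noteq> 0" using * by auto
    have "B dvd B'" "B' dvd B" using dvd * nz by metis+
    then obtain C where C: "B' = B * C" "degree B = degree B'"
      using nz by (metis dvdE dvd_imp_degree_le le_antisym)
    then have "degree C = 0" using nz by (simp add: degree_mult_eq)
    then obtain c where "C = [:c:]" by (rule degree_eq_zeroE)
    then have "B = B'" using C * by simp
    moreover have "A * B' = A' * B" using * nz by (metis eq_fract(1))
    ultimately show ?thesis using nz by simp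
  qed
  obtain A B where AB: "f = Fract A B" "coprime A B" "lead_coeff B = 1" using ex by blast
  show ?thesis
  proof (rule ex1I[of _ "(A, B)"])
    fix p assume "case p of (A, B) \<Rightarrow> f = Fract A B \<and> coprime A B \<and> lead_coeff B = 1"
    then show "p = (A, B)" using un[OF _ _ _ AB, of "fst p" "snd p"]
      by (simp add: case_prod_beta prod_eq_iff)
  qed (use AB in simp)
qed

definition rat_degree :: "'k::field poly fract \<Rightarrow> nat" where
  "rat_degree f = (case lowest_terms f of (A, B) \<Rightarrow> max (degree A) (degree B))"

text \<open>A rational map is given by coprime polynomials \<open>A\<close>, \<open>B\<close>. With \<open>d\<close> the maximum of their degrees
  it is \<open>[X : Y] \<mapsto> [A\<^sup>h : B\<^sup>h]\<close> for the degree-\<open>d\<close> homogenisations, so at \<open>\<infinity> = [1 : 0]\<close> the values of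
  \<open>A\<^sup>h\<close>, \<open>B\<^sup>h\<close> are the coefficients of degree \<open>d\<close>.\<close>

definition quotient_point :: "'a::field \<Rightarrow> 'a \<Rightarrow> 'a proj_line" where
  "quotient_point c d = (if d = 0 then Infty else Fin (c / d))"

fun rat_map :: "'a::field poly \<times> 'a poly \<Rightarrow> 'a proj_line \<Rightarrow> 'a proj_line" where
  "rat_map (A, B) (Fin x) = quotient_point (poly A x) (poly B x)"
| "rat_map (A, B) Infty =
     (let d = max (degree A) (degree B) in quotient_point (coeff A d) (coeff B d))"

text \<open>The ramification index at \<open>p\<close> is the multiplicity of \<open>p\<close> in the fibre through \<open>p\<close>: if the value at
  \<open>p\<close> is \<open>[c : d]\<close>, this fibre is the zero divisor of the form \<open>d A\<^sup>h - c B\<^sup>h\<close>.\<close>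

fun ramification_index :: "'a::field poly \<times> 'a poly \<Rightarrow> 'a proj_line \<Rightarrow> nat" where
  "ramification_index (A, B) (Fin x) =
     Polynomial.order x (smult (poly B x) A - smult (poly A x) B)"
| "ramification_index (A, B) Infty =
     (let d = max (degree A) (degree B) in d - degree (smult (coeff B d) A - smult (coeff A d) B))"

definition critical_points :: "'a::field poly \<times> 'a poly \<Rightarrow> 'a proj_line set" where
  "critical_points F = {p. ramification_index F p \<ge> 2}"

definition base_change ::
    "('k::field \<Rightarrow> 'l::field) \<Rightarrow> 'k poly fract \<Rightarrow> 'l poly \<times> 'l poly" where
  "base_change h f = map_prod (map_poly h) (map_poly h) (lowest_terms f)"


section \<open>Separable closures and Galois groups\<close>

definition field_hom :: "('k::field \<Rightarrow> 'l::field) \<Rightarrow> bool" where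
  "field_hom h \<longleftrightarrow> h 1 = 1 \<and> (\<forall>x y. h (x + y) = h x + h y) \<and> (\<forall>x y. h (x * y) = h x * h y)"

definition separable_poly :: "'a::field poly \<Rightarrow> bool" where
  "separable_poly p \<longleftrightarrow> coprime p (pderiv p)"

definition separable_over :: "('k::field \<Rightarrow> 'l::field) \<Rightarrow> 'l \<Rightarrow> bool" where
  "separable_over h x \<longleftrightarrow> (\<exists>p. separable_poly p \<and> poly (map_poly h p) x = 0)"

definition is_separable_closure :: "('k::field \<Rightarrow> 'l::field) \<Rightarrow> bool" where
  "is_separable_closure h \<longleftrightarrow> field_hom h \<and> (\<forall>x. separable_over h x) \<and>
     (\<forall>p :: 'l poly. separable_poly p \<and> degree p > 0 \<longrightarrow> (\<exists>x. poly p x = 0))"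

definition galois_group :: "'l::field set \<Rightarrow> ('l \<Rightarrow> 'l) set" where
  "galois_group F = {s. bij s \<and> field_hom s \<and> (\<forall>x\<in>F. s x = x)}"

definition simple_ext :: "'l::field set \<Rightarrow> 'l \<Rightarrow> 'l set" where
  "simple_ext F x =
     {poly p x / poly q x | p q. range (coeff p) \<subseteq> F \<and> range (coeff q) \<subseteq> F}"


section \<open>Iterated monodromy groups\<close>

text \<open>Throughout, \<open>\<iota> :: 'k poly fract \<Rightarrow> 'l\<close> embeds \<open>K = k(t)\<close> into a separable closure \<open>'l\<close> of \<open>K\<close>.\<close>

definition const_emb :: "('k::field poly fract \<Rightarrow> 'l::field) \<Rightarrow> 'k \<Rightarrow> 'l" where
  "const_emb \<iota> c = \<iota> (Fract [:c:] 1)"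

definition t_elem :: "('k::field poly fract \<Rightarrow> 'l::field) \<Rightarrow> 'l" where
  "t_elem \<iota> = \<iota> (Fract [:0, 1:] 1)"

text \<open>The separable closure of \<open>k\<close> inside that of \<open>K\<close>.\<close>

definition const_closure :: "('k::field poly fract \<Rightarrow> 'l::field) \<Rightarrow> 'l set" where
  "const_closure \<iota> = {x. separable_over (const_emb \<iota>) x}"

definition preimage_vertices :: "('p \<Rightarrow> 'p) \<Rightarrow> 'p \<Rightarrow> (nat \<times> 'p) set" where
  "preimage_vertices F t = {(n, x). (F ^^ n) x = t}"

definition preimage_child :: "('p \<Rightarrow> 'p) \<Rightarrow> nat \<times> 'p \<Rightarrow> nat \<times> 'p \<Rightarrow> bool" where
  "preimage_child F u v \<longleftrightarrow> fst v = Suc (fst u) \<and> F (snd v) = snd u"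

definition tree_identification :: "('p \<Rightarrow> 'p) \<Rightarrow> 'p \<Rightarrow> (vertex \<Rightarrow> nat \<times> 'p) \<Rightarrow> bool" where
  "tree_identification F t \<phi> \<longleftrightarrow>
     bij_betw \<phi> UNIV (preimage_vertices F t) \<and> \<phi> [] = (0, t) \<and>
     (\<forall>u v. tree_child u v \<longleftrightarrow> preimage_child F (\<phi> u) (\<phi> v))"

definition monodromy :: "(vertex \<Rightarrow> nat \<times> 'l proj_line) \<Rightarrow> ('l \<Rightarrow> 'l) \<Rightarrow> vertex \<Rightarrow> vertex" where
  "monodromy \<phi> s = inv_into UNIV \<phi> \<circ> map_prod id (map_proj_line s) \<circ> \<phi>"

definition G_arith ::
    "('k::field poly fract \<Rightarrow> 'l::field) \<Rightarrow> (vertex \<Rightarrow> nat \<times> 'l proj_line) \<Rightarrow> (vertex \<Rightarrow> vertex) set" where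
  "G_arith \<iota> \<phi> = monodromy \<phi> ` galois_group (range \<iota>)"

definition G_geom ::
    "('k::field poly fract \<Rightarrow> 'l::field) \<Rightarrow> (vertex \<Rightarrow> nat \<times> 'l proj_line) \<Rightarrow> (vertex \<Rightarrow> vertex) set" where
  "G_geom \<iota> \<phi> = monodromy \<phi> ` galois_group (simple_ext (const_closure \<iota>) (t_elem \<iota>))"

end

theory Submission
  imports Defs
begin

text \<open>In both cases the group is determined by its local conditions. Let \<open>x\<close> be a vertex and let \<open>D x\<close> be the
  discriminant of the quadratic equation for its two children; geometrically it vanishes at the two critical
  values \<open>p\<^sub>1\<close>, \<open>q\<^sub>1\<close>. Choosing square roots of all \<open>D x\<close> amounts to ordering the children of all vertices, and
  an automorphism swaps the children of \<open>x\<close> iff it changes the sign of the square root.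

  If \<open>p\<close> and \<open>q\<close> collide after \<open>r + 1\<close> steps, the product of the \<open>D y\<close> over the \<open>2\<^sup>r\<close> vertices \<open>y\<close> that lie
  \<open>r\<close> levels above \<open>x\<close> is the square of a rational function of \<open>x\<close>. Ordering the children compatibly, every element
  of the geometric monodromy group has an even number of swaps in each such block. The group of all tree
  automorphisms with even blocks is \<open>G(r)\<close>.

  Conversely, the point \<open>f\<^sup>n(p\<^sub>1)\<close> of the \<open>t\<close>-line is not a branch point for the first \<open>n\<close> levels, because the
  postcritical orbit is infinite. Embedding the field of the first \<open>n\<close> levels into Laurent series at this point
  yields an inertia element that is trivial up to level \<open>n\<close> and swaps at level \<open>n\<close> exactly the vertices
  reducing to \<open>p\<^sub>1\<close> or \<open>q\<^sub>1\<close>: one vertex if \<open>f\<^sup>n(p\<^sub>1) \<noteq> f\<^sup>n(q\<^sub>1)\<close>, otherwise two vertices of the same block. The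
  conjugates of these elements generate a dense subgroup of \<open>W\<close>, respectively of the group with even blocks.\<close>

section \<open>Portraits of tree automorphisms\<close>

text \<open>One density criterion serves twice: for the group generated by the recursive generators
  it identifies \<open>G r\<close>, for a conjugate of \<open>G_geom\<close> it yields the theorem.
  So generators are never matched with inertia elements. The conjugating element comes from the
  signs \<open>\<eta>\<close>: in the given labelling the block signs of the monodromy are only a
  coboundary \<open>\<eta> v * \<eta> (h v)\<close>, and an automorphism with block signs
  \<open>\<eta>\<close> removes it. Only quadratic extensions occur, so square roots are the only
  roots to be found. Laurent series over the separable closure of K itself therefore suffice as
  local field. The inertia elements are geometric because they fix the domain of the embedding,
  which contains all algebraic constants. In the parity argument the norm of the discriminant is a
  square only up to a constant; this constant lies in a field of degree at most two over k, and its
  square roots are separable since the characteristic is not 2.\<close>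

definition swaps :: "(vertex \<Rightarrow> vertex) \<Rightarrow> vertex \<Rightarrow> bool" where
  "swaps g v \<longleftrightarrow> last (g (v @ [False]))"

lemma tree_aut_Nil: "g \<in> tree_auts \<Longrightarrow> g [] = []"
  by (simp add: tree_auts_def)

lemma tree_aut_inj: "g \<in> tree_auts \<Longrightarrow> g v = g w \<longleftrightarrow> v = w"
  by (simp add: tree_auts_def bij_is_inj inj_eq)

lemma tree_aut_inv_cancel:
  assumes "g \<in> tree_auts"
  shows "inv_into UNIV g (g v) = v" "g (inv_into UNIV g v) = v"
    "inv_into UNIV g \<circ> g = id" "g \<circ> inv_into UNIV g = id"
  using assms by (auto simp: tree_auts_def bij_is_inj bij_is_surj surj_f_inv_f fun_eq_iff)

lemma tree_aut_snoc:
  assumes g: "g \<in> tree_auts" shows "g (v @ [c]) = g v @ [c \<noteq> swaps g v]"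
proof -
  have ex: "\<exists>y. g (v @ [x]) = g v @ [y]" for x
    using g by (auto simp: tree_auts_def tree_child_def)
  obtain y0 where y0: "g (v @ [False]) = g v @ [y0]" using ex by blast
  obtain y1 where y1: "g (v @ [True]) = g v @ [y1]" using ex by blast
  have "g (v @ [False]) \<noteq> g (v @ [True])" using tree_aut_inj[OF g] by simp
  then have "y0 \<noteq> y1" using y0 y1 by auto
  then show ?thesis using y0 y1 by (cases c) (auto simp: swaps_def)
qed

text \<open>The labels form a cocycle: \<open>h\<close> acts first, so the label of \<open>g\<close>
  is read at \<open>h v\<close>.\<close>

lemma swaps_comp:
  assumes g: "g \<in> tree_auts" and h: "h \<in> tree_auts"
  shows "swaps (g \<circ> h) v \<longleftrightarrow> (swaps h v \<noteq> swaps g (h v))"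
  using tree_aut_snoc[OF tree_aut_comp[OF g h], of v False]
    tree_aut_snoc[OF h, of v False] tree_aut_snoc[OF g, of "h v" "swaps h v"] by auto

lemma swaps_id [simp]: "\<not> swaps id v"
  by (simp add: swaps_def)

lemma tree_aut_take:
  assumes g: "g \<in> tree_auts" shows "take (length v) (g (v @ u)) = g v"
proof (induction u rule: rev_induct)
  case Nil
  then show ?case using tree_aut_length[OF g] by simp
next
  case (snoc x u)
  have "g (v @ u @ [x]) = g (v @ u) @ [x \<noteq> swaps g (v @ u)]"
    using tree_aut_snoc[OF g, of "v @ u" x] by simp
  then show ?case using snoc tree_aut_length[OF g, of "v @ u"] by simp
qed

lemma tree_aut_take_le:
  assumes g: "g \<in> tree_auts" "i \<le> length v" shows "take i (g v) = g (take i v)"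
  using tree_aut_take[OF g(1), of "take i v" "drop i v"] g(2) by simp

lemma tree_aut_nth:
  assumes g: "g \<in> tree_auts" "i < length v"
  shows "g v ! i \<longleftrightarrow> (v ! i \<noteq> swaps g (take i v))"
proof -
  have "take (Suc i) (g v) = g (take i v @ [v ! i])"
    using tree_aut_take_le[OF g(1), of "Suc i" v] g(2) by (simp add: take_Suc_conv_app_nth)
  also have "\<dots> = g (take i v) @ [v ! i \<noteq> swaps g (take i v)]"
    by (rule tree_aut_snoc[OF g(1)])
  finally have "last (take (Suc i) (g v)) \<longleftrightarrow> (v ! i \<noteq> swaps g (take i v))" by simp
  then show ?thesis
    using g(2) tree_aut_length[OF g(1), of v] by (simp add: take_Suc_conv_app_nth)
qed

lemma level_agree_iff_swaps:
  assumes g: "g \<in> tree_auts" and h: "h \<in> tree_auts"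
  shows "level_agree n g h \<longleftrightarrow> (\<forall>v. length v < n \<longrightarrow> swaps g v = swaps h v)"
proof
  show "level_agree n g h \<Longrightarrow> \<forall>v. length v < n \<longrightarrow> swaps g v = swaps h v"
    by (auto simp: level_agree_def swaps_def)
  assume *: "\<forall>v. length v < n \<longrightarrow> swaps g v = swaps h v"
  have "length w \<le> n \<Longrightarrow> g w = h w" for w
  proof (induction w rule: rev_induct)
    case Nil
    show ?case using g h by (simp add: tree_aut_Nil)
  next
    case (snoc x w)
    then show ?case using * tree_aut_snoc[OF g] tree_aut_snoc[OF h] by simp
  qed
  then show "level_agree n g h" by (simp add: level_agree_def)
qed

text \<open>The inverse of \<open>swaps\<close>: every boolean labelling of the vertices belongs to
  an automorphism. Labels sit at source vertices, so the recursion restricts the labelling to the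
  subtree below the original letter \<open>x\<close>, not below its image.\<close>

primrec portrait :: "(vertex \<Rightarrow> bool) \<Rightarrow> vertex \<Rightarrow> vertex" where
  "portrait p [] = []"
| "portrait p (x # s) = (x \<noteq> p []) # portrait (\<lambda>u. p (x # u)) s"

lemma portrait_snoc: "portrait p (v @ [c]) = portrait p v @ [c \<noteq> p v]"
  by (induction v arbitrary: p) auto

lemma portrait_aut: "portrait p \<in> tree_auts"
proof (rule tree_autsI)
  have "portrait p s = portrait p s' \<Longrightarrow> s = s'" for s s'
  proof (induction s arbitrary: p s')
    case Nil
    then show ?case by (cases s') auto
  next
    case (Cons x s)
    then obtain y t where s': "s' = y # t" by (cases s') auto
    with Cons have "x = y" by auto
    with Cons s' show ?case by auto
  qed
  moreover have "\<exists>s. portrait p s = v" for v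
  proof (induction v arbitrary: p)
    case Nil
    show ?case by (rule exI[of _ "[]"]) simp
  next
    case (Cons y v)
    obtain s where "portrait (\<lambda>u. p ((y \<noteq> p []) # u)) s = v" using Cons by blast
    then show ?case by (intro exI[of _ "(y \<noteq> p []) # s"]) auto
  qed
  ultimately show "bij (portrait p)" by (metis bijI injI surjI)
qed (auto simp: portrait_snoc)

lemma swaps_portrait [simp]: "swaps (portrait p) v = p v"
  by (simp add: swaps_def portrait_snoc)

section \<open>Parity conditions on the blocks of depth r\<close>

definition words :: "nat \<Rightarrow> vertex set" where "words n = {u. length u = n}"

lemma finite_words [simp]: "finite (words n)"
  unfolding words_def using finite_lists_length_eq[of "UNIV :: bool set" n] by simp

lemma card_words: "card (words n) = 2 ^ n"
  unfolding words_def using card_lists_length_eq[of "UNIV :: bool set" n] by simp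

definition bsgn :: "bool \<Rightarrow> int" where "bsgn b = (if b then - 1 else 1)"

lemma bsgn_simps [simp]: "bsgn True = - 1" "bsgn False = 1" "bsgn b * bsgn b = 1"
  by (simp_all add: bsgn_def)

lemma bsgn_xor: "bsgn (a \<noteq> b) = bsgn a * bsgn b"
  by (simp add: bsgn_def)

lemma prod_bsgn: "finite A \<Longrightarrow> (\<Prod>x\<in>A. bsgn (P x)) = (- 1) ^ card {x\<in>A. P x}"
proof (induction A rule: finite_induct)
  case (insert x A)
  have "{y \<in> insert x A. P y} = (if P x then insert x {y\<in>A. P y} else {y\<in>A. P y})" by auto
  then show ?case using insert by simp
qed simp

definition block_sgn :: "nat \<Rightarrow> (vertex \<Rightarrow> vertex) \<Rightarrow> vertex \<Rightarrow> int" where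
  "block_sgn r g v = (\<Prod>u\<in>words r. bsgn (swaps g (v @ u)))"

lemma block_sgn_values: "block_sgn r g v = 1 \<or> block_sgn r g v = - 1"
  by (simp add: block_sgn_def prod_bsgn) (metis minus_one_power_iff)

text \<open>The change of variables in products over a block: the block below \<open>v\<close> is
  carried onto the block below \<open>h v\<close>.\<close>

lemma block_reindex:
  assumes h: "h \<in> tree_auts"
  shows "bij_betw (\<lambda>u. drop (length v) (h (v @ u))) (words r) (words r)"
    and "h (v @ u) = h v @ drop (length v) (h (v @ u))"
proof -
  show *: "h (v @ u) = h v @ drop (length v) (h (v @ u))" for u
    using tree_aut_take[OF h, of v u] by (metis append_take_drop_id)
  let ?f = "\<lambda>u. drop (length v) (h (v @ u))"
  have "inj_on ?f (words r)"
    by (rule inj_onI) (metis * tree_aut_inj[OF h] same_append_eq)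
  moreover have "?f ` words r \<subseteq> words r"
    using tree_aut_length[OF h] by (auto simp: words_def)
  ultimately show "bij_betw ?f (words r) (words r)"
    unfolding bij_betw_def using endo_inj_surj[OF finite_words] by blast
qed

text \<open>The cocycle rule for single labels, multiplied over a block.\<close>

lemma block_sgn_comp:
  assumes g: "g \<in> tree_auts" and h: "h \<in> tree_auts"
  shows "block_sgn r (g \<circ> h) v = block_sgn r h v * block_sgn r g (h v)"
proof -
  have "block_sgn r g (h v) = (\<Prod>u\<in>words r. bsgn (swaps g (h v @ drop (length v) (h (v @ u)))))"
    unfolding block_sgn_def
    by (rule prod.reindex_bij_betw[symmetric]) (rule block_reindex(1)[OF h])
  also have "\<dots> = (\<Prod>u\<in>words r. bsgn (swaps g (h (v @ u))))"
    using block_reindex(2)[OF h] by simp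
  finally show ?thesis
    unfolding block_sgn_def swaps_comp[OF g h] bsgn_xor by (simp add: prod.distrib)
qed

lemma block_sgn_id [simp]: "block_sgn r id v = 1"
  by (simp add: block_sgn_def)

lemma block_sgn_inv:
  assumes g: "g \<in> tree_auts"
  shows "block_sgn r (inv_into UNIV g) (g v) = block_sgn r g v"
  using block_sgn_comp[OF tree_aut_inv[OF g] g, of r v] block_sgn_values[of r g v]
  by (auto simp: tree_aut_inv_cancel[OF g])

definition even_auts :: "nat \<Rightarrow> (vertex \<Rightarrow> vertex) set" where
  "even_auts r = {g \<in> tree_auts. \<forall>v. block_sgn r g v = 1}"

lemma even_auts_comp: "g \<in> even_auts r \<Longrightarrow> h \<in> even_auts r \<Longrightarrow> g \<circ> h \<in> even_auts r"
  by (simp add: even_auts_def block_sgn_comp tree_aut_comp)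

lemma even_auts_inv: "g \<in> even_auts r \<Longrightarrow> inv_into UNIV g \<in> even_auts r"
  unfolding even_auts_def
  by (auto simp: tree_aut_inv) (metis block_sgn_inv tree_aut_inv_cancel(2))

lemma even_auts_id: "id \<in> even_auts r"
  by (simp add: even_auts_def tree_aut_id)

text \<open>The condition at \<open>v\<close> concerns the labels on level
  \<open>length v + r\<close> only. They are visible in the action on the next level, hence the
  \<open>+ 1\<close> in the proof. So the parity conditions are closed.\<close>

lemma even_auts_limit:
  assumes g: "g \<in> tree_auts" and ex: "\<And>n. \<exists>h\<in>even_auts r. level_agree n g h"
  shows "g \<in> even_auts r"
proof -
  have "block_sgn r g v = 1" for v
  proof -
    obtain h where h: "h \<in> even_auts r" "level_agree (length v + r + 1) g h" using ex by blast
    have "swaps g (v @ u) = swaps h (v @ u)" if "u \<in> words r" for u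
      using that h(2) by (simp add: level_agree_def swaps_def words_def)
    then have "block_sgn r g v = block_sgn r h v"
      unfolding block_sgn_def by (intro prod.cong) auto
    then show ?thesis using h by (simp add: even_auts_def)
  qed
  then show ?thesis using g by (simp add: even_auts_def)
qed

text \<open>The value of the portrait at one free vertex of each block is used to correct the parity.\<close>

lemma even_aut_prescribed:
  assumes free: "\<And>v. \<exists>u. length u = r \<and> v @ u \<notin> P"
  shows "\<exists>g\<in>even_auts r. \<forall>w\<in>P. swaps g w = a w"
proof -
  obtain c where c: "\<And>v. length (c v) = r" "\<And>v. v @ c v \<notin> P" using free by metis
  define p0 where "p0 w \<longleftrightarrow> w \<in> P \<and> a w" for w
  define X where "X v = (\<Prod>u\<in>words r - {c v}. bsgn (p0 (v @ u)))" for v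
  \<comment> \<open>A vertex of length at least \<open>r\<close> lies in exactly one block, the one
    below its prefix of length \<open>length w - r\<close>, so the corrections in different blocks
    do not interfere.\<close>
  define p where "p w = (let v = take (length w - r) w in
      if r \<le> length w \<and> w = v @ c v then X v = - 1 else p0 w)" for w
  have "block_sgn r (portrait p) v = 1" for v
  proof -
    have cw: "c v \<in> words r" using c by (simp add: words_def)
    have "block_sgn r (portrait p) v = bsgn (p (v @ c v)) * (\<Prod>u\<in>words r - {c v}. bsgn (p (v @ u)))"
      unfolding block_sgn_def swaps_portrait using cw by (simp add: prod.remove)
    also have "(\<Prod>u\<in>words r - {c v}. bsgn (p (v @ u))) = X v"
      unfolding X_def by (rule prod.cong) (auto simp: p_def words_def)
    also have "bsgn (p (v @ c v)) = bsgn (X v = - 1)" using c by (simp add: p_def)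
    moreover have "X v = 1 \<or> X v = - 1"
      unfolding X_def by (simp add: prod_bsgn) (metis minus_one_power_iff)
    ultimately show ?thesis by auto
  qed
  then have "portrait p \<in> even_auts r" by (simp add: even_auts_def portrait_aut)
  moreover have "swaps (portrait p) w = a w" if "w \<in> P" for w
  proof -
    have "w \<noteq> take (length w - r) w @ c (take (length w - r) w)" using c(2) that by metis
    then show ?thesis using that by (simp add: p_def p0_def)
  qed
  ultimately show ?thesis by blast
qed

section \<open>A criterion for density\<close>

lemma take_Suc_eq_iff:
  assumes "i < length x" "i < length y"
  shows "take (Suc i) x = take (Suc i) y \<longleftrightarrow> take i x = take i y \<and> x ! i = y ! i"
  using assms by (simp add: take_Suc_conv_app_nth)

text \<open>The labels along the paths to \<open>x\<close> and \<open>x'\<close> are forced by the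
  targets. All other labels are at disposal, and by \<open>free\<close> every block contains a
  vertex off both paths where its parity can be repaired.\<close>

lemma even_aut_moves_pair:
  fixes x x' z z' :: vertex
  assumes len: "length x = n" "length x' = n" "length z = n" "length z' = n"
    and meet: "\<And>i. i \<le> n \<Longrightarrow> take i x = take i x' \<longleftrightarrow> take i z = take i z'"
    and free: "\<And>v. \<exists>u. length u = r \<and> v @ u \<notin> {take i y | i y. i < n \<and> y \<in> {x, x'}}"
  shows "\<exists>g\<in>even_auts r. g x = z \<and> g x' = z'"
proof -
  define a where "a w = (let i = length w in
      if w = take i x then x ! i \<noteq> z ! i else x' ! i \<noteq> z' ! i)" for w
  obtain g where g: "g \<in> even_auts r"
    and sw: "\<And>w. w \<in> {take i y | i y. i < n \<and> y \<in> {x, x'}} \<Longrightarrow> swaps g w = a w"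
    using even_aut_prescribed[OF free, of a] by blast
  have gt: "g \<in> tree_auts" using g by (simp add: even_auts_def)
  have "g x = z"
  proof (rule nth_equalityI)
    show "length (g x) = length z" using tree_aut_length[OF gt] len by simp
    fix i assume "i < length (g x)"
    then have i: "i < n" using tree_aut_length[OF gt] len by simp
    then have "take i x \<in> {take i y | i y. i < n \<and> y \<in> {x, x'}}" by blast
    then have "swaps g (take i x) \<longleftrightarrow> x ! i \<noteq> z ! i"
      using sw i len by (simp add: a_def)
    then show "g x ! i = z ! i" using tree_aut_nth[OF gt, of i x] i len by auto
  qed
  moreover have "g x' = z'"
  proof (rule nth_equalityI)
    show "length (g x') = length z'" using tree_aut_length[OF gt] len by simp
    fix i assume "i < length (g x')"
    then have i: "i < n" using tree_aut_length[OF gt] len by simp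
    then have "take i x' \<in> {take i y | i y. i < n \<and> y \<in> {x, x'}}" by blast
    then have s: "swaps g (take i x') = a (take i x')" using sw by blast
    \<comment> \<open>On the common part of the paths \<open>a\<close> was defined through
      \<open>x\<close>. By \<open>meet\<close> the next letters of \<open>x\<close> and
      \<open>x'\<close> agree iff those of \<open>z\<close> and \<open>z'\<close> do, so the same
      label also serves \<open>x'\<close>.\<close>
    have "a (take i x') \<longleftrightarrow> x' ! i \<noteq> z' ! i"
    proof (cases "take i x = take i x'")
      case True
      then have "x ! i = x' ! i \<longleftrightarrow> z ! i = z' ! i"
        using meet[of i] meet[of "Suc i"] i len take_Suc_eq_iff[of i x x'] take_Suc_eq_iff[of i z z']
        by simp
      then show ?thesis using True i len by (auto simp: a_def)
    next
      case False
      then show ?thesis using i len by (auto simp: a_def)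
    qed
    then show "g x' ! i = z' ! i" using s tree_aut_nth[OF gt, of i x'] i len by auto
  qed
  ultimately show ?thesis using g by blast
qed

lemma ex_free_word:
  fixes v :: vertex
  assumes "finite B" "card B < 2 ^ r" shows "\<exists>u. length u = r \<and> v @ u \<notin> B"
proof (rule ccontr)
  assume "\<not> ?thesis"
  then have "(\<lambda>u. v @ u) ` words r \<subseteq> B" by (auto simp: words_def)
  then have "card ((\<lambda>u. v @ u) ` words r) \<le> card B" using assms card_mono by blast
  moreover have "card ((\<lambda>u. v @ u) ` words r) = 2 ^ r"
    using card_words[of r] by (subst card_image) (auto simp: inj_on_def)
  ultimately show False using assms by simp
qed

text \<open>A path contains at most one vertex of each block, and a block has at least two because
  \<open>r\<close> is positive.\<close>

lemma even_aut_moves_vertex: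
  assumes "r \<ge> 1" "length x = n" "length z = n"
  shows "\<exists>g\<in>even_auts r. g x = z"
proof -
  have "\<exists>u. length u = r \<and> v @ u \<notin> {take i y | i y. i < n \<and> y \<in> {x, x}}" for v
  proof -
    have "card {take (length v + r) x} < 2 ^ r" using assms(1) one_less_power[of "2::nat" r] by simp
    then obtain u where u: "length u = r" "v @ u \<notin> {take (length v + r) x}"
      using ex_free_word[of "{take (length v + r) x}" r v] by blast
    have "v @ u \<noteq> take i x" if "i < n" for i
    proof
      assume *: "v @ u = take i x"
      then have "length v + r = i" using u(1) that assms by (metis length_append length_take min.absorb4)
      then show False using * u(2) by simp
    qed
    then show ?thesis using u(1) by auto
  qed
  then show ?thesis
    using even_aut_moves_pair[of x n x z z r] assms by auto
qed

text \<open>The deepest common ancestor of two distinct vertices of the same level lies on level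
  \<open>m\<close>.\<close>

definition meet_at :: "nat \<Rightarrow> vertex \<Rightarrow> vertex \<Rightarrow> bool" where
  "meet_at m x x' \<longleftrightarrow> m < length x \<and> length x = length x' \<and> take m x = take m x' \<and> x ! m \<noteq> x' ! m"

lemma meet_at_take:
  assumes "meet_at m x x'" "i \<le> length x"
  shows "take i x = take i x' \<longleftrightarrow> i \<le> m"
proof
  assume *: "take i x = take i x'"
  show "i \<le> m"
  proof (rule ccontr)
    assume "\<not> i \<le> m"
    then have "x ! m = take i x ! m" "x' ! m = take i x' ! m" by auto
    then show False using * assms by (simp add: meet_at_def)
  qed
next
  assume "i \<le> m"
  then have "take i x = take i (take m x)" "take i x' = take i (take m x')" by simp_all
  then show "take i x = take i x'" using assms unfolding meet_at_def by metis
qed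

text \<open>Two paths contain at most two vertices of a block, too few to fill it if
  \<open>r > 1\<close>. If \<open>r = 1\<close>, a block has only two vertices, but then the paths
  separate only at level \<open>n\<close>, so on the smaller levels they contribute a single
  vertex.\<close>

lemma even_aut_moves_meeting_pair:
  assumes r: "r \<ge> 1" "r \<le> n" and len: "length x = n" "length z = n"
    and x: "meet_at (n - r) x x'" and z: "meet_at (n - r) z z'"
  shows "\<exists>g\<in>even_auts r. g x = z \<and> g x' = z'"
proof (rule even_aut_moves_pair)
  have len': "length x' = n" "length z' = n" using x z len by (auto simp: meet_at_def)
  show "length x = n" "length x' = n" "length z = n" "length z' = n" using len len' by simp_all
  show "take i x = take i x' \<longleftrightarrow> take i z = take i z'" if "i \<le> n" for i
    using meet_at_take[OF x] meet_at_take[OF z] that len by simp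
  fix v :: vertex
  define B where "B = {take (length v + r) x, take (length v + r) x'}"
  have "\<exists>u. length u = r \<and> v @ u \<notin> B \<or> length u = r \<and> length (v @ u) \<ge> n"
  proof (cases "length v + r < n")
    case True
    have "card B < 2 ^ r"
    proof (cases "r = 1")
      case True
      then have "take (length v + r) x = take (length v + r) x'"
        using meet_at_take[OF x, of "length v + r"] \<open>length v + r < n\<close> len by simp
      then have "card B = 1" by (simp add: B_def)
      then show ?thesis using True by simp
    next
      case False
      then have "(2::nat) ^ 2 \<le> 2 ^ r" using r by (intro power_increasing) auto
      moreover have "card B \<le> 2" unfolding B_def by (simp add: card_insert_if)
      ultimately show ?thesis by simp
    qed
    then show ?thesis using ex_free_word[of B r v] by (auto simp: B_def)
  next
    case False
    then show ?thesis by (intro exI[of _ "replicate r False"]) simp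
  qed
  then obtain u where u: "length u = r" "v @ u \<notin> B \<or> length (v @ u) \<ge> n" by blast
  have "v @ u \<noteq> take i y" if "i < n" "y \<in> {x, x'}" for i y
  proof
    assume *: "v @ u = take i y"
    then have l: "length v + r = i" using u(1) that len len'
      by (metis insertE length_append length_take min.absorb4 singletonD)
    then have "v @ u \<in> B" using * that by (auto simp: B_def)
    then show False using u l that by simp
  qed
  then show "\<exists>u. length u = r \<and> v @ u \<notin> {take i y | i y. i < n \<and> y \<in> {x, x'}}"
    using u(1) by blast
qed

section \<open>Approximation level by level through kernels of truncation\<close>

definition swap_set :: "nat \<Rightarrow> (vertex \<Rightarrow> vertex) \<Rightarrow> vertex set" where
  "swap_set n g = {v \<in> words n. swaps g v}"

definition aut_subgroup :: "(vertex \<Rightarrow> vertex) set \<Rightarrow> bool" where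
  "aut_subgroup H \<longleftrightarrow> H \<subseteq> tree_auts \<and> id \<in> H \<and> (\<forall>g\<in>H. \<forall>h\<in>H. g \<circ> h \<in> H) \<and>
     (\<forall>g\<in>H. inv_into UNIV g \<in> H)"

text \<open>The part of \<open>H\<close> that is trivial up to level \<open>n\<close>, seen one
  level further and encoded by subsets of that level: composition becomes symmetric difference,
  conjugation becomes the action on subsets.\<close>

definition level_swap_sets :: "nat \<Rightarrow> (vertex \<Rightarrow> vertex) set \<Rightarrow> vertex set set" where
  "level_swap_sets n H = {swap_set n h | h. h \<in> H \<and> level_agree n h id}"

definition dense_upto :: "nat \<Rightarrow> (vertex \<Rightarrow> vertex) set \<Rightarrow> (vertex \<Rightarrow> vertex) set \<Rightarrow> bool" where
  "dense_upto n H N \<longleftrightarrow> (\<forall>g\<in>N. \<exists>h\<in>H. level_agree n g h)"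

lemma level_swap_sets_sym_diff:
  assumes H: "aut_subgroup H" and S: "S \<in> level_swap_sets n H" and T: "T \<in> level_swap_sets n H"
  shows "(S - T) \<union> (T - S) \<in> level_swap_sets n H"
proof -
  obtain g h where g: "g \<in> H" "level_agree n g id" "S = swap_set n g"
    and h: "h \<in> H" "level_agree n h id" "T = swap_set n h"
    using S T by (auto simp: level_swap_sets_def)
  have t: "g \<in> tree_auts" "h \<in> tree_auts" "g \<circ> h \<in> H" using H g h by (auto simp: aut_subgroup_def)
  have "level_agree n (g \<circ> h) id" using level_agree_comp[OF g(2) h(2) t(2)] by simp
  moreover have "swap_set n (g \<circ> h) = (S - T) \<union> (T - S)"
    using h(2) unfolding g(3) h(3)
    by (auto simp: swap_set_def swaps_comp[OF t(1,2)] level_agree_def words_def)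
  ultimately show ?thesis using t(3) by (auto simp: level_swap_sets_def)
qed

text \<open>The labels of \<open>h\<close> and of its inverse cancel because \<open>g\<close> fixes
  level \<open>n\<close>, so conjugation merely transports the swap set.\<close>

lemma swap_set_conj:
  assumes g: "g \<in> tree_auts" "level_agree n g id" and h: "h \<in> tree_auts"
  shows "level_agree n (h \<circ> (g \<circ> inv_into UNIV h)) id"
    and "swap_set n (h \<circ> (g \<circ> inv_into UNIV h)) = h ` swap_set n g"
proof -
  let ?i = "inv_into UNIV h"
  have it: "?i \<in> tree_auts" by (rule tree_aut_inv[OF h])
  have gi: "g \<circ> ?i \<in> tree_auts" by (rule tree_aut_comp[OF g(1) it])
  have gv: "g v = v" if "length v \<le> n" for v using g(2) that by (simp add: level_agree_def)
  have il: "length (?i v) = length v" for v by (rule tree_aut_length[OF it])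
  show "level_agree n (h \<circ> (g \<circ> ?i)) id"
    by (simp add: level_agree_def gv il tree_aut_inv_cancel[OF h])
  have sw: "swaps (h \<circ> (g \<circ> ?i)) v \<longleftrightarrow> swaps g (?i v)" if "length v = n" for v
  proof -
    have "swaps (h \<circ> ?i) v \<longleftrightarrow> False" by (simp add: tree_aut_inv_cancel[OF h])
    then have "swaps ?i v = swaps h (?i v)" by (simp add: swaps_comp[OF h it])
    then show ?thesis
      using that by (auto simp: swaps_comp[OF h gi] swaps_comp[OF g(1) it] gv il)
  qed
  show "swap_set n (h \<circ> (g \<circ> ?i)) = h ` swap_set n g"
    unfolding swap_set_def
  proof (intro equalityI subsetI)
    fix v assume "v \<in> {v \<in> words n. swaps (h \<circ> (g \<circ> ?i)) v}"
    then have "?i v \<in> {v \<in> words n. swaps g v}" using sw il by (auto simp: words_def)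
    then show "v \<in> h ` {v \<in> words n. swaps g v}"
      using tree_aut_inv_cancel(2)[OF h, of v] by (intro image_eqI[of _ _ "?i v"]) simp_all
  next
    fix v assume "v \<in> h ` {v \<in> words n. swaps g v}"
    then obtain w where "w \<in> words n" "swaps g w" "v = h w" by blast
    then show "v \<in> {v \<in> words n. swaps (h \<circ> (g \<circ> ?i)) v}"
      using sw[of v] by (simp add: words_def tree_aut_length[OF h] tree_aut_inv_cancel[OF h])
  qed
qed

text \<open>The element \<open>k\<close> need not lie in \<open>H\<close>, but on level
  \<open>n\<close> it acts like some element of \<open>H\<close>, and conjugation by the latter does
  the same to swap sets.\<close>

lemma level_swap_sets_image:
  assumes H: "aut_subgroup H" and S: "S \<in> level_swap_sets n H"
    and k: "dense_upto n H N" "k \<in> N"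
  shows "k ` S \<in> level_swap_sets n H"
proof -
  obtain g where g: "g \<in> H" "level_agree n g id" "S = swap_set n g"
    using S by (auto simp: level_swap_sets_def)
  obtain h where h: "h \<in> H" "level_agree n k h" using k by (auto simp: dense_upto_def)
  have t: "g \<in> tree_auts" "h \<in> tree_auts" using H g h by (auto simp: aut_subgroup_def)
  have "h \<circ> (g \<circ> inv_into UNIV h) \<in> H" using H g(1) h(1) by (auto simp: aut_subgroup_def)
  moreover have "k ` S = h ` S"
    using h(2) by (intro image_cong) (auto simp: g(3) swap_set_def words_def level_agree_def)
  ultimately show ?thesis
    using swap_set_conj[OF t(1) g(2) t(2)] g(3) unfolding level_swap_sets_def
    by (intro CollectI exI[of _ "h \<circ> (g \<circ> inv_into UNIV h)"]) simp
qed

text \<open>If \<open>h\<close> approximates \<open>g\<close> up to level \<open>n\<close>, the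
  quotient of the two is trivial there, so only its swap set on level \<open>n\<close> remains to be
  matched inside \<open>H\<close>.\<close>

lemma dense_upto_Suc:
  assumes H: "aut_subgroup H" and N: "aut_subgroup N" "H \<subseteq> N" and d: "dense_upto n H N"
    and sw: "\<And>g. g \<in> N \<Longrightarrow> level_agree n g id \<Longrightarrow> swap_set n g \<in> level_swap_sets n H"
  shows "dense_upto (Suc n) H N"
  unfolding dense_upto_def
proof
  fix g assume g: "g \<in> N"
  then obtain h where h: "h \<in> H" "level_agree n g h" using d by (auto simp: dense_upto_def)
  let ?i = "inv_into UNIV h"
  have t: "g \<in> tree_auts" "h \<in> tree_auts" using H N g h by (auto simp: aut_subgroup_def)
  have it: "?i \<in> tree_auts" by (rule tree_aut_inv[OF t(2)])
  have "?i \<circ> g \<in> N" using N g h by (auto simp: aut_subgroup_def)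
  moreover have "level_agree n (?i \<circ> g) id"
    using h(2) by (auto simp: level_agree_def tree_aut_inv_cancel[OF t(2)])
  ultimately obtain k where k: "k \<in> H" "level_agree n k id" "swap_set n (?i \<circ> g) = swap_set n k"
    using sw by (force simp: level_swap_sets_def)
  have kt: "k \<in> tree_auts" using H k by (auto simp: aut_subgroup_def)
  have igt: "?i \<circ> g \<in> tree_auts" by (rule tree_aut_comp[OF it t(1)])
  have "level_agree (Suc n) (?i \<circ> g) k"
    unfolding level_agree_iff_swaps[OF igt kt]
  proof (intro allI impI)
    fix v :: vertex assume v: "length v < Suc n"
    show "swaps (?i \<circ> g) v = swaps k v"
    proof (cases "length v = n")
      case True
      then have "v \<in> swap_set n (?i \<circ> g) \<longleftrightarrow> v \<in> swap_set n k" using k(3) by simp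
      then show ?thesis using True by (simp add: swap_set_def words_def)
    next
      case False
      then have "length v < n" using v by simp
      then show ?thesis using \<open>level_agree n (?i \<circ> g) id\<close> k(2)
          level_agree_iff_swaps[OF igt tree_aut_id] level_agree_iff_swaps[OF kt tree_aut_id] by simp
    qed
  qed
  then have "level_agree (Suc n) g (h \<circ> k)"
    by (auto simp: level_agree_def) (metis tree_aut_inv_cancel(2)[OF t(2)])
  moreover have "h \<circ> k \<in> H" using H h k by (auto simp: aut_subgroup_def)
  ultimately show "\<exists>h\<in>H. level_agree (Suc n) g h" by blast
qed

lemma aut_subgroup_even_auts: "aut_subgroup (even_auts r)"
  by (auto simp: aut_subgroup_def even_auts_comp even_auts_inv even_auts_id) (simp add: even_auts_def)

lemma aut_subgroup_tree_auts: "aut_subgroup tree_auts"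
  by (auto simp: aut_subgroup_def tree_aut_comp tree_aut_inv tree_aut_id)

lemma dense_upto_0:
  assumes "aut_subgroup H" "aut_subgroup N" shows "dense_upto 0 H N"
proof -
  have "level_agree 0 g id" if "g \<in> N" for g
    using that assms by (auto simp: level_agree_def tree_aut_Nil aut_subgroup_def)
  then show ?thesis using assms unfolding dense_upto_def aut_subgroup_def by blast
qed

lemma all_subsets_from_singles:
  assumes H: "aut_subgroup H" and single: "\<And>z. length z = n \<Longrightarrow> {z} \<in> level_swap_sets n H"
    and S: "S \<subseteq> words n"
  shows "S \<in> level_swap_sets n H"
proof -
  have "finite S" using S finite_words finite_subset by blast
  then show ?thesis using S
  proof (induction S rule: finite_induct)
    case empty
    have "swap_set n id = {}" by (simp add: swap_set_def)
    then show ?case using H unfolding level_swap_sets_def aut_subgroup_def level_agree_def by blast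
  next
    case (insert x S)
    have "insert x S = (S - {x}) \<union> ({x} - S)" using insert by blast
    then show ?case using insert single level_swap_sets_sym_diff[OF H, of S n "{x}"]
      by (simp add: words_def)
  qed
qed

definition single_swap :: "nat \<Rightarrow> (vertex \<Rightarrow> vertex) \<Rightarrow> bool" where
  "single_swap n g \<longleftrightarrow> level_agree n g id \<and> (\<exists>x. length x = n \<and> swap_set n g = {x})"

text \<open>Meeting on level \<open>n - r\<close> means that the two swapped vertices lie in the
  same block, below different children of its root.\<close>

definition double_swap :: "nat \<Rightarrow> nat \<Rightarrow> (vertex \<Rightarrow> vertex) \<Rightarrow> bool" where
  "double_swap r n g \<longleftrightarrow> level_agree n g id \<and>
     (\<exists>x x'. length x = n \<and> meet_at (n - r) x x' \<and> swap_set n g = {x, x'})"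

lemma swap_set_subset: "swap_set n g \<subseteq> words n"
  by (auto simp: swap_set_def)

text \<open>The even automorphisms already act transitively on a level, so one swapped vertex can be
  moved to any other.\<close>

lemma singles_from_single_swap:
  assumes H: "aut_subgroup H" "dense_upto n H N" "even_auts r \<subseteq> N" "r \<ge> 1"
    and h: "h \<in> H" "single_swap n h" and z: "length z = n"
  shows "{z} \<in> level_swap_sets n H"
proof -
  obtain x where x: "length x = n" "swap_set n h = {x}" "level_agree n h id"
    using h by (auto simp: single_swap_def)
  then have "{x} \<in> level_swap_sets n H" using h(1) unfolding level_swap_sets_def by auto
  moreover obtain g where "g \<in> N" "g x = z"
    using even_aut_moves_vertex[OF H(4) x(1) z] H(3) by blast
  ultimately show ?thesis using level_swap_sets_image[OF H(1) _ H(2), of "{x}" g] by simp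
qed

lemma dense_tree_auts:
  assumes H: "aut_subgroup H" and single: "\<And>n. \<exists>h\<in>H. single_swap n h"
  shows "dense_upto n H tree_auts"
proof (induction n)
  case 0
  show ?case by (rule dense_upto_0[OF H aut_subgroup_tree_auts])
next
  case (Suc n)
  obtain h where h: "h \<in> H" "single_swap n h" using single by blast
  have "{z} \<in> level_swap_sets n H" if "length z = n" for z
    \<comment> \<open>The block depth 1 is chosen only to have a transitive group of even
      automorphisms inside \<open>tree_auts\<close>.\<close>
    by (rule singles_from_single_swap[OF H Suc _ _ h that, of 1]) (auto simp: even_auts_def)
  then show ?case
    using H all_subsets_from_singles[OF H _ swap_set_subset]
    by (intro dense_upto_Suc[OF H aut_subgroup_tree_auts _ Suc]) (auto simp: aut_subgroup_def)
qed

lemma even_swap_set: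
  assumes g: "g \<in> even_auts r" and v: "length v + r = n"
  shows "even (card {w \<in> swap_set n g. take (length v) w = v})"
proof -
  have "(- 1) ^ card {u \<in> words r. swaps g (v @ u)} = (1::int)"
    using g by (simp add: even_auts_def block_sgn_def prod_bsgn)
  then have "even (card {u \<in> words r. swaps g (v @ u)})" by (simp add: minus_one_power_iff split: if_splits)
  moreover have "{w \<in> swap_set n g. take (length v) w = v} = (\<lambda>u. v @ u) ` {u \<in> words r. swaps g (v @ u)}"
    (is "?L = ?R")
  proof (intro equalityI subsetI)
    fix w assume w: "w \<in> ?L"
    then have "w = v @ drop (length v) w" by (metis (mono_tags, lifting) append_take_drop_id mem_Collect_eq)
    moreover have "length (drop (length v) w) = r" "swaps g w" using w v by (auto simp: swap_set_def words_def)
    ultimately show "w \<in> ?R" by (intro image_eqI[of _ _ "drop (length v) w"]) (auto simp: words_def)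
  next
    fix w assume "w \<in> ?R"
    then show "w \<in> ?L" using v by (auto simp: swap_set_def words_def)
  qed
  moreover have "card ((\<lambda>u. v @ u) ` {u \<in> words r. swaps g (v @ u)}) = card {u \<in> words r. swaps g (v @ u)}"
    by (intro card_image) (auto simp: inj_on_def)
  ultimately show ?thesis by simp
qed

text \<open>Symmetric differences of pairs inside blocks yield all sets with even intersection with
  each block: remove two points of one block at a time, by induction on the size.\<close>

lemma even_sets_from_pairs:
  assumes H: "aut_subgroup H" and r: "r \<ge> 1" "r \<le> n"
    and pair: "\<And>z z'. length z = n \<Longrightarrow> meet_at (n - r) z z' \<Longrightarrow> {z, z'} \<in> level_swap_sets n H"
    and S: "S \<subseteq> words n" and ev: "\<And>v. length v = n - r \<Longrightarrow> even (card {w \<in> S. take (n - r) w = v})"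
  shows "S \<in> level_swap_sets n H"
proof -
  have pair': "{z, z'} \<in> level_swap_sets n H"
    if zz: "length z = n" "length z' = n" "take (n - r) z = take (n - r) z'" "z \<noteq> z'" for z z'
  proof (cases "z ! (n - r) = z' ! (n - r)")
    case False
    then show ?thesis using zz r by (intro pair) (auto simp: meet_at_def)
  next
    case True
    \<comment> \<open>The given pairs separate immediately below the root of the block. If
      \<open>z\<close> and \<open>z'\<close> lie below the same child, a vertex \<open>y\<close>
      below the other child links them: the pairs \<open>z, y\<close> and \<open>z', y\<close> have
      symmetric difference \<open>z, z'\<close>.\<close>
    define y where "y = z[n - r := (\<not> z ! (n - r))]"
    have y: "length y = n" "take (n - r) y = take (n - r) z" "y ! (n - r) \<noteq> z ! (n - r)"
      using zz r by (auto simp: y_def)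
    then have "meet_at (n - r) z y" "meet_at (n - r) z' y"
      using zz r True by (simp_all add: meet_at_def)
    then have "{z, y} \<in> level_swap_sets n H" "{z', y} \<in> level_swap_sets n H"
      using zz pair by simp_all
    then have "({z, y} - {z', y}) \<union> ({z', y} - {z, y}) \<in> level_swap_sets n H"
      by (rule level_swap_sets_sym_diff[OF H])
    moreover have "({z, y} - {z', y}) \<union> ({z', y} - {z, y}) = {z, z'}"
      using zz True y by auto
    ultimately show ?thesis by simp
  qed
  have "finite S" using S finite_words finite_subset by blast
  then show ?thesis using S ev
  proof (induction "card S" arbitrary: S rule: less_induct)
    case less
    show ?case
    proof (cases "S = {}")
      case True
      have "swap_set n id = {}" by (simp add: swap_set_def)
      then show ?thesis using H True unfolding level_swap_sets_def aut_subgroup_def level_agree_def by blast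
    next
      case False
      then obtain z where z: "z \<in> S" by blast
      define B where "B = {w \<in> S. take (n - r) w = take (n - r) z}"
      have lz: "length z = n" using z less by (auto simp: words_def)
      then have "even (card B)" unfolding B_def by (intro less.prems) simp
      moreover have zB: "z \<in> B" "finite B" using z less by (auto simp: B_def)
      ultimately have "B \<noteq> {z}" by auto
      then obtain z' where z': "z' \<in> B" "z' \<noteq> z" using zB by blast
      have lz': "length z' = n" "z' \<in> S" using z' less by (auto simp: words_def B_def)
      have p: "{z, z'} \<in> level_swap_sets n H"
        using z' lz lz' by (intro pair') (auto simp: B_def)
      define S' where "S' = S - {z, z'}"
      have "S' \<in> level_swap_sets n H"
      proof (rule less.hyps)
        show "card S' < card S" unfolding S'_def using z less.prems(1) by (intro psubset_card_mono) auto
        show "finite S'" "S' \<subseteq> words n" using less.prems by (auto simp: S'_def)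
        fix v :: vertex assume v: "length v = n - r"
        show "even (card {w \<in> S'. take (n - r) w = v})"
        proof (cases "take (n - r) z = v")
          case True
          then have "{w \<in> S'. take (n - r) w = v} = B - {z, z'}" by (auto simp: S'_def B_def)
          moreover have "card (B - {z, z'}) = card B - card {z, z'}"
            using zB z' by (intro card_Diff_subset) auto
          ultimately show ?thesis using \<open>even (card B)\<close> z' by auto
        next
          case False
          then have "{w \<in> S'. take (n - r) w = v} = {w \<in> S. take (n - r) w = v}"
            using z' by (auto simp: S'_def B_def)
          then show ?thesis using less.prems v by simp
        qed
      qed
      then have "(S' - {z, z'}) \<union> ({z, z'} - S') \<in> level_swap_sets n H"
        using p by (rule level_swap_sets_sym_diff[OF H])
      moreover have "(S' - {z, z'}) \<union> ({z, z'} - S') = S" using z lz' by (auto simp: S'_def)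
      ultimately show ?thesis by simp
    qed
  qed
qed

text \<open>A block starts at the root at the earliest, so its vertices have length at least
  \<open>r\<close>. On levels below \<open>r\<close> the labels are unconstrained and single swaps
  are available; from level \<open>r\<close> on, swaps come in pairs within a block.\<close>

lemma dense_even_auts:
  assumes H: "aut_subgroup H" "H \<subseteq> even_auts r" and r: "r \<ge> 1"
    and single: "\<And>n. n < r \<Longrightarrow> \<exists>h\<in>H. single_swap n h"
    and double: "\<And>n. n \<ge> r \<Longrightarrow> \<exists>h\<in>H. double_swap r n h"
  shows "dense_upto n H (even_auts r)"
proof (induction n)
  case 0
  show ?case by (rule dense_upto_0[OF H(1) aut_subgroup_even_auts])
next
  case (Suc n)
  have "swap_set n g \<in> level_swap_sets n H" if g: "g \<in> even_auts r" for g
  proof (cases "n < r")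
    case True
    then obtain h where h: "h \<in> H" "single_swap n h" using single by blast
    show ?thesis
      by (intro all_subsets_from_singles[OF H(1) _ swap_set_subset]
          singles_from_single_swap[OF H(1) Suc _ r h]) auto
  next
    case False
    then obtain h where h: "h \<in> H" "double_swap r n h" using double[of n] by auto
    then obtain x x' where x: "length x = n" "meet_at (n - r) x x'" "swap_set n h = {x, x'}"
      "level_agree n h id" by (auto simp: double_swap_def)
    then have xx: "{x, x'} \<in> level_swap_sets n H" using h(1) unfolding level_swap_sets_def by auto
    show ?thesis
    proof (rule even_sets_from_pairs[OF H(1) r _ _ swap_set_subset])
      show "r \<le> n" using False by simp
      fix z z' :: vertex assume z: "length z = n" "meet_at (n - r) z z'"
      obtain k where "k \<in> even_auts r" "k x = z" "k x' = z'"
        using even_aut_moves_meeting_pair[OF r \<open>r \<le> n\<close> x(1) z(1) x(2) z(2)] by blast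
      then show "{z, z'} \<in> level_swap_sets n H"
        using level_swap_sets_image[OF H(1) xx Suc, of k] by simp
    next
      fix v :: vertex assume "length v = n - r"
      then show "even (card {w \<in> swap_set n g. take (n - r) w = v})"
        using even_swap_set[OF g, of v n] False by simp
    qed
  qed
  then show ?case by (intro dense_upto_Suc[OF H(1) aut_subgroup_even_auts H(2) Suc])
qed

section \<open>The group G(r) as the group of all automorphisms with even blocks\<close>

lemma swaps_tree_pair:
  assumes "u \<in> tree_auts" "v \<in> tree_auts"
  shows "\<not> swaps (tree_pair u v) []" "swaps (tree_pair u v) (x # s) = swaps (if x then v else u) s"
proof -
  have "u (s @ [False]) \<noteq> []" "v (s @ [False]) \<noteq> []" for s
    using tree_aut_length[OF assms(1), of "s @ [False]"] tree_aut_length[OF assms(2), of "s @ [False]"]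
    by auto
  then show "\<not> swaps (tree_pair u v) []" "swaps (tree_pair u v) (x # s) = swaps (if x then v else u) s"
    using assms by (auto simp: swaps_def tree_pair_def tree_aut_Nil)
qed

lemma swaps_tree_swap [simp]: "swaps tree_swap [] = True" "swaps tree_swap (x # s) = False"
  by (simp_all add: swaps_def tree_swap_def)

lemma words_Suc: "words (Suc n) = Cons False ` words n \<union> Cons True ` words n"
  by (auto simp: words_def length_Suc_conv image_iff)

lemma words_0 [simp]: "words 0 = {[]}"
  by (auto simp: words_def)

lemma prod_words_Suc:
  fixes f :: "vertex \<Rightarrow> 'a::comm_monoid_mult"
  shows "(\<Prod>u\<in>words (Suc n). f u) = (\<Prod>u\<in>words n. f (False # u)) * (\<Prod>u\<in>words n. f (True # u))"
  unfolding words_Suc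
  by (subst prod.union_disjoint) (auto simp: prod.reindex inj_on_def)

lemma block_sgn_0 [simp]: "block_sgn 0 g v = bsgn (swaps g v)"
  by (simp add: block_sgn_def)

lemma block_sgn_tree_pair:
  assumes "u \<in> tree_auts" "v \<in> tree_auts"
  shows "block_sgn n (tree_pair u v) (x # s) = block_sgn n (if x then v else u) s"
    "block_sgn (Suc n) (tree_pair u v) [] = block_sgn n u [] * block_sgn n v []"
  by (simp_all add: block_sgn_def swaps_tree_pair[OF assms] prod_words_Suc)

lemma block_sgn_tree_swap:
  "block_sgn n tree_swap (x # s) = 1" "block_sgn (Suc n) tree_swap [] = 1"
  by (simp_all add: block_sgn_def prod_words_Suc)

lemma swap_set_tree_pair:
  assumes "u \<in> tree_auts" "v \<in> tree_auts"
  shows "swap_set (Suc n) (tree_pair u v) = Cons False ` swap_set n u \<union> Cons True ` swap_set n v"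
  unfolding swap_set_def words_Suc by (auto simp: swaps_tree_pair[OF assms])

lemma tree_pair_level_agree_id:
  assumes "level_agree n u id" "level_agree n v id"
  shows "level_agree (Suc n) (tree_pair u v) id"
proof -
  have "tree_pair id id = id" by (auto simp: fun_eq_iff tree_pair_def split: list.split)
  then show ?thesis using level_agree_pair[OF assms] by simp
qed

lemma swap_set_id [simp]: "swap_set n id = {}"
  by (simp add: swap_set_def)

lemma single_swap_conj:
  assumes "single_swap n g" "g \<in> tree_auts" "h \<in> tree_auts"
  shows "single_swap n (h \<circ> (g \<circ> inv_into UNIV h))"
  using assms swap_set_conj[of g n h] tree_aut_length[of h] unfolding single_swap_def by auto

lemma meet_at_image:
  assumes g: "g \<in> tree_auts" and m: "meet_at m x x'" shows "meet_at m (g x) (g x')"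
  using m tree_aut_take_le[OF g, of m x] tree_aut_take_le[OF g, of m x']
    tree_aut_nth[OF g, of m x] tree_aut_nth[OF g, of m x'] tree_aut_length[OF g]
  by (auto simp: meet_at_def)

lemma double_swap_conj:
  assumes d: "double_swap r n g" and g: "g \<in> tree_auts" and h: "h \<in> tree_auts"
  shows "double_swap r n (h \<circ> (g \<circ> inv_into UNIV h))"
proof -
  obtain x x' where x: "length x = n" "meet_at (n - r) x x'" "swap_set n g = {x, x'}"
    "level_agree n g id" using d by (auto simp: double_swap_def)
  have "length (h x) = n" "meet_at (n - r) (h x) (h x')"
    using x tree_aut_length[OF h] meet_at_image[OF h] by auto
  moreover have "swap_set n (h \<circ> (g \<circ> inv_into UNIV h)) = {h x, h x'}"
    using swap_set_conj(2)[OF g x(4) h] x(3) by simp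
  ultimately show ?thesis using swap_set_conj(1)[OF g x(4) h] unfolding double_swap_def by blast
qed

context
  fixes r :: nat and a b :: "nat \<Rightarrow> vertex \<Rightarrow> vertex"
  assumes r: "r \<ge> 1" and rel: "gen_relations r a b"
begin

lemma a_aut: "1 \<le> i \<Longrightarrow> a i \<in> tree_auts" and b_aut: "1 \<le> j \<Longrightarrow> j \<le> r \<Longrightarrow> b j \<in> tree_auts"
  using rel by (auto simp: gen_relations_def)

lemma b_last: "b r \<in> tree_auts" "inv_into UNIV (b r) \<in> tree_auts" "inv\<^bsub>W\<^esub> (b r) = inv_into UNIV (b r)"
  using b_aut[OF r order_refl] by (simp_all add: tree_aut_inv W_inv)

lemma a_rec: "a 1 = tree_swap" "a (Suc r) = tree_pair (a r) (b r)"
  "1 \<le> i \<Longrightarrow> i \<noteq> r \<Longrightarrow> a (Suc i) = tree_pair (a i) id"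
  using rel by (auto simp: gen_relations_def)

definition "b_conj j = b r \<circ> (b j \<circ> inv_into UNIV (b r))"

lemma b_rec: "b 1 = tree_pair (b r) (inv_into UNIV (b r)) \<circ> tree_swap"
  "1 \<le> j \<Longrightarrow> j < r \<Longrightarrow> b (Suc j) = tree_pair (b_conj j) id"
proof -
  have rel': "b 1 = tree_pair (b r) (inv\<^bsub>W\<^esub> (b r)) \<otimes>\<^bsub>W\<^esub> tree_swap"
    "\<And>j. 1 < j \<Longrightarrow> j \<le> r \<Longrightarrow>
        b j = tree_pair (b r \<otimes>\<^bsub>W\<^esub> b (j - 1) \<otimes>\<^bsub>W\<^esub> inv\<^bsub>W\<^esub> (b r)) \<one>\<^bsub>W\<^esub>"
    using rel unfolding gen_relations_def by blast+
  show "b 1 = tree_pair (b r) (inv_into UNIV (b r)) \<circ> tree_swap"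
    using rel'(1) b_last by simp
  show "b (Suc j) = tree_pair (b_conj j) id" if "1 \<le> j" "j < r"
    using rel'(2)[of "Suc j"] that b_last by (simp add: comp_assoc b_conj_def)
qed

lemma b_conj_aut: "1 \<le> j \<Longrightarrow> j \<le> r \<Longrightarrow> b_conj j \<in> tree_auts"
  unfolding b_conj_def using b_last by (intro tree_aut_comp b_aut) auto

text \<open>The sign of \<open>b j\<close> on a whole level is nontrivial on level
  \<open>j - 1\<close> only. Below the root the two sections of \<open>b 1\<close> are inverse to
  each other and have equal signs, and the conjugation by \<open>b r\<close> in the other generators
  does not affect signs.\<close>

lemma block_sgn_b_root:
  "1 \<le> j \<Longrightarrow> j \<le> r \<Longrightarrow> block_sgn m (b j) [] = (if Suc m = j then - 1 else 1)"
proof (induction m arbitrary: j)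
  have pair: "tree_pair (b r) (inv_into UNIV (b r)) \<in> tree_auts" by (intro tree_pair_aut b_last)
  {
    case 0
    show ?case
    proof (cases "j = 1")
      case True
      then have "block_sgn 0 (b j) [] = bsgn (swaps (tree_pair (b r) (inv_into UNIV (b r)) \<circ> tree_swap) [])"
        using b_rec(1) by simp
      then show ?thesis using True swaps_tree_pair[OF b_last(1,2)]
        unfolding swaps_comp[OF pair tree_swap_aut] by (simp add: tree_aut_Nil[OF tree_swap_aut])
    next
      case False
      then obtain i where "j = Suc i" "1 \<le> i" "i < r" using 0 by (cases j) auto
      then show ?thesis using swaps_tree_pair[OF b_conj_aut tree_aut_id] by (simp add: b_rec)
    qed
  next
    case (Suc m)
    show ?case
    proof (cases "j = 1")
      case True
      have "block_sgn m (inv_into UNIV (b r)) [] = block_sgn m (b r) []"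
        using block_sgn_inv[OF b_last(1), of m "[]"] by (simp add: tree_aut_Nil b_last)
      then have "block_sgn (Suc m) (tree_pair (b r) (inv_into UNIV (b r))) [] = 1"
        using block_sgn_values[of m "b r" "[]"] by (auto simp: block_sgn_tree_pair[OF b_last(1,2)])
      then have "block_sgn (Suc m) (b 1) [] = 1"
        unfolding b_rec(1) block_sgn_comp[OF pair tree_swap_aut]
        by (simp add: block_sgn_tree_swap tree_aut_Nil[OF tree_swap_aut])
      then show ?thesis using True by simp
    next
      case False
      then obtain i where i: "j = Suc i" "1 \<le> i" "i < r" using Suc by (cases j) auto
      have bi: "b i \<in> tree_auts" using i by (intro b_aut) auto
      have "block_sgn m (inv_into UNIV (b r)) [] = block_sgn m (b r) []"
        using block_sgn_inv[OF b_last(1), of m "[]"] by (simp add: tree_aut_Nil b_last)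
      then have "block_sgn m (b_conj i) [] = block_sgn m (b i) []"
        unfolding b_conj_def
        using block_sgn_values[of m "b r" "[]"] bi
        by (auto simp: block_sgn_comp b_last tree_aut_comp tree_aut_Nil)
      then show ?thesis using i Suc.IH[of i]
        by (simp add: b_rec block_sgn_tree_pair[OF b_conj_aut tree_aut_id])
    qed
  }
qed

text \<open>The pattern of \<open>b\<close> persists only for \<open>i\<close> up to
  \<open>r\<close>: the sections \<open>a r\<close> and \<open>b r\<close> of
  \<open>a (Suc r)\<close> are both odd on level \<open>r - 1\<close>, so the signs cancel one level
  further, and all later generators are even on every level.\<close>

lemma block_sgn_a_root:
  "1 \<le> i \<Longrightarrow> block_sgn m (a i) [] = (if i \<le> r \<and> Suc m = i then - 1 else 1)"
proof (induction m arbitrary: i)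
  case 0
  show ?case
  proof (cases "i = 1")
    case True
    then show ?thesis using r by (simp add: a_rec(1)[simplified])
  next
    case False
    then obtain k where k: "i = Suc k" "1 \<le> k" using 0 by (cases i) auto
    then show ?thesis
      using swaps_tree_pair[OF a_aut b_last(1)] swaps_tree_pair[OF a_aut tree_aut_id]
      by (cases "k = r") (simp_all add: a_rec)
  qed
next
  case (Suc m)
  show ?case
  proof (cases "i = 1")
    case True
    then show ?thesis by (simp add: a_rec(1)[simplified] block_sgn_tree_swap)
  next
    case False
    then obtain k where k: "i = Suc k" "1 \<le> k" using Suc by (cases i) auto
    show ?thesis
    proof (cases "k = r")
      case True
      then show ?thesis using k Suc.IH[of k] block_sgn_b_root[of r m] r
        by (simp add: a_rec block_sgn_tree_pair[OF a_aut b_last(1)])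
    next
      case False
      then show ?thesis using k Suc.IH[of k]
        by (auto simp: a_rec block_sgn_tree_pair[OF a_aut tree_aut_id])
    qed
  qed
qed

definition "gens = a ` {1..} \<union> b ` {1..r}"

lemma gens_sub: "gens \<subseteq> tree_auts"
  using a_aut b_aut by (auto simp: gens_def)

lemma aut_subgroup_generate: "aut_subgroup (generate W gens)"
proof -
  have sub: "subgroup (generate W gens) W"
    using group.generate_is_subgroup[OF group_W, of gens] gens_sub by simp
  have t: "generate W gens \<subseteq> tree_auts" using subgroup.subset[OF sub] by simp
  have "inv_into UNIV g \<in> generate W gens" if "g \<in> generate W gens" for g
  proof -
    have "inv\<^bsub>W\<^esub> g = inv_into UNIV g" using that t by (intro W_inv) blast
    then show ?thesis using subgroup.m_inv_closed[OF sub that] by simp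
  qed
  then show ?thesis
    using t subgroup.one_closed[OF sub] subgroup.m_closed[OF sub] by (simp add: aut_subgroup_def)
qed

lemma gens_generate: "1 \<le> i \<Longrightarrow> a i \<in> generate W gens" "1 \<le> j \<Longrightarrow> j \<le> r \<Longrightarrow> b j \<in> generate W gens"
  by (auto simp: gens_def intro!: generate.incl)

lemma generate_closed:
  "g \<in> generate W gens \<Longrightarrow> h \<in> generate W gens \<Longrightarrow> g \<circ> h \<in> generate W gens"
  "g \<in> generate W gens \<Longrightarrow> inv_into UNIV g \<in> generate W gens"
  "id \<in> generate W gens"
  using aut_subgroup_generate by (auto simp: aut_subgroup_def)

lemma generate_aut: "g \<in> generate W gens \<Longrightarrow> g \<in> tree_auts"
  using aut_subgroup_generate by (auto simp: aut_subgroup_def)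

text \<open>Stated for one level \<open>n\<close> at a time, so that it can be applied inside the
  induction on levels in \<open>block_sgn_gens\<close>; automorphisms preserve the level, which
  makes the cocycle rule close up.\<close>

lemma block_sgn_generate:
  assumes gen: "\<And>h v. h \<in> gens \<Longrightarrow> length v = n \<Longrightarrow> block_sgn r h v = 1"
    and g: "g \<in> generate W gens" and v: "length v = n"
  shows "block_sgn r g v = 1"
  using g v
proof (induction g arbitrary: v rule: generate.induct)
  case (inv h)
  then have h: "h \<in> tree_auts" using gens_sub by auto
  have "block_sgn r (inv_into UNIV h) (h (inv_into UNIV h v)) = block_sgn r h (inv_into UNIV h v)"
    by (rule block_sgn_inv[OF h])
  then show ?case
    using inv gen h by (simp add: W_inv tree_aut_inv_cancel tree_aut_length[OF tree_aut_inv])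
next
  case (eng h1 h2)
  then show ?case
    unfolding W_simps block_sgn_comp[OF generate_aut[OF eng(1)] generate_aut[OF eng(2)]]
    using tree_aut_length[OF generate_aut[OF eng(2)]] by simp
qed (use gen in auto)

text \<open>At the root, level \<open>r\<close> lies beyond the odd levels found above. At
  \<open>x # s\<close> the block sign is that of a section at \<open>s\<close>, and sections of
  generators belong to the generated group, to which the induction hypothesis extends.\<close>

lemma block_sgn_gens:
  "h \<in> gens \<Longrightarrow> length v = n \<Longrightarrow> block_sgn r h v = 1"
proof (induction n arbitrary: h v)
  case 0
  then show ?case
    by (auto simp: gens_def block_sgn_a_root block_sgn_b_root)
next
  case (Suc n)
  obtain x s where v: "v = x # s" "length s = n" using Suc(3) by (cases v) auto
  have gen: "block_sgn r g s' = 1" if "g \<in> generate W gens" "length s' = n" for g s'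
    using block_sgn_generate[OF Suc.IH that] by simp
  consider i where "1 \<le> i" "h = a i" | j where "1 \<le> j" "j \<le> r" "h = b j"
    using Suc(2) by (auto simp: gens_def)
  then show ?case
  proof cases
    case 1
    show ?thesis
    proof (cases "i = 1")
      case True
      then show ?thesis using 1 v by (simp add: a_rec(1)[simplified] block_sgn_tree_swap)
    next
      case False
      then obtain k where k: "i = Suc k" "1 \<le> k" using 1 by (cases i) auto
      then show ?thesis
        using 1 v r gen gens_generate generate_closed
        by (cases "k = r") (simp_all add: a_rec block_sgn_tree_pair a_aut b_last tree_aut_id)
    qed
  next
    case 2
    have pair: "tree_pair (b r) (inv_into UNIV (b r)) \<in> tree_auts" by (intro tree_pair_aut b_last)
    show ?thesis
    proof (cases "j = 1")
      case True
      have "tree_swap v = (\<not> x) # s" by (simp add: v tree_swap_def)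
      then have "block_sgn r (b 1) v = 1"
        unfolding b_rec(1) block_sgn_comp[OF pair tree_swap_aut] v(1)
        using v(2) r gen gens_generate(2)[OF r] generate_closed(2)
        by (simp add: block_sgn_tree_swap block_sgn_tree_pair[OF b_last(1,2)])
      then show ?thesis using True 2 by simp
    next
      case False
      then obtain k where k: "j = Suc k" "1 \<le> k" "k < r" using 2 by (cases j) auto
      have "b_conj k \<in> generate W gens"
        unfolding b_conj_def using k r by (intro generate_closed gens_generate) auto
      then show ?thesis
        using 2 k v gen generate_closed
        by (simp add: b_rec block_sgn_tree_pair b_conj_aut tree_aut_id)
    qed
  qed
qed

lemma generate_even: "generate W gens \<subseteq> even_auts r"
proof
  fix g assume g: "g \<in> generate W gens"
  have "block_sgn r g v = 1" for v
    by (rule block_sgn_generate[OF _ g refl]) (rule block_sgn_gens)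
  then show "g \<in> even_auts r" using generate_aut[OF g] by (simp add: even_auts_def)
qed

lemma single_swap_pair_id:
  assumes "single_swap n u" "u \<in> tree_auts" shows "single_swap (Suc n) (tree_pair u id)"
  using assms tree_pair_level_agree_id[of n u id] swap_set_tree_pair[OF assms(2) tree_aut_id, of n]
  unfolding single_swap_def by (auto simp: level_agree_def)

lemma single_swap_tree_swap: "single_swap 0 tree_swap"
  by (auto simp: single_swap_def level_agree_def swap_set_def tree_swap_def)

lemma single_swap_a: "n < r \<Longrightarrow> single_swap n (a (Suc n))"
proof (induction n)
  case 0
  then show ?case using single_swap_tree_swap a_rec(1) by simp
next
  case (Suc n)
  then show ?case using a_rec(3)[of "Suc n"] single_swap_pair_id a_aut[of "Suc n"] by simp
qed

lemma single_swap_b: "n < r \<Longrightarrow> single_swap n (b (Suc n))"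
proof (induction n)
  case 0
  have pair: "tree_pair (b r) (inv_into UNIV (b r)) \<in> tree_auts" by (intro tree_pair_aut b_last)
  have b1: "b 1 \<in> tree_auts" using r by (intro b_aut) auto
  have "swaps (b 1) []" using swaps_tree_pair[OF b_last(1,2)]
    unfolding b_rec(1) swaps_comp[OF pair tree_swap_aut] by (simp add: tree_aut_Nil[OF tree_swap_aut])
  then show ?case using tree_aut_Nil[OF b1]
    by (auto simp: single_swap_def swap_set_def level_agree_def)
next
  case (Suc n)
  then have "single_swap n (b_conj (Suc n))"
    unfolding b_conj_def by (intro single_swap_conj b_aut b_last) auto
  then show ?case using Suc b_rec(2)[of "Suc n"] single_swap_pair_id b_conj_aut[of "Suc n"] by simp
qed

text \<open>The sections \<open>a r\<close> and \<open>b r\<close> of \<open>a (Suc r)\<close> each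
  swap one vertex on level \<open>r - 1\<close>; together they give a pair meeting at the root. Each
  further generator pushes the pair down into the left subtree.\<close>

lemma double_swap_a: "double_swap r (r + m) (a (Suc (r + m)))"
proof (induction m)
  case 0
  obtain n where n: "r = Suc n" using r by (cases r) auto
  obtain x where x: "length x = n" "swap_set n (a r) = {x}" "level_agree n (a r) id"
    using single_swap_a[of n] n by (auto simp: single_swap_def)
  obtain x' where x': "length x' = n" "swap_set n (b r) = {x'}" "level_agree n (b r) id"
    using single_swap_b[of n] n by (auto simp: single_swap_def)
  have "swap_set r (a (Suc r)) = {False # x, True # x'}"
    using swap_set_tree_pair[OF a_aut[OF r] b_last(1), of n] x x' n a_rec(2) by auto
  moreover have "level_agree r (a (Suc r)) id"
    using tree_pair_level_agree_id[OF x(3) x'(3)] n a_rec(2) by simp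
  moreover have "meet_at 0 (False # x) (True # x')" using x x' by (simp add: meet_at_def)
  ultimately show ?case using x n unfolding double_swap_def
    by (intro conjI exI[of _ "False # x"] exI[of _ "True # x'"]) simp_all
next
  case (Suc m)
  let ?i = "Suc (r + m)"
  obtain x x' where x: "length x = r + m" "meet_at m x x'" "swap_set (r + m) (a ?i) = {x, x'}"
    "level_agree (r + m) (a ?i) id" using Suc by (auto simp: double_swap_def)
  have ai: "a ?i \<in> tree_auts" by (rule a_aut) simp
  have rec: "a (Suc ?i) = tree_pair (a ?i) id" by (rule a_rec(3)) auto
  have "swap_set (Suc (r + m)) (a (Suc ?i)) = {False # x, False # x'}"
    unfolding rec using swap_set_tree_pair[OF ai tree_aut_id, of "r + m"] x(3) by auto
  moreover have "level_agree (Suc (r + m)) (a (Suc ?i)) id"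
    unfolding rec by (rule tree_pair_level_agree_id[OF x(4)]) (simp add: level_agree_def)
  moreover have "meet_at (Suc m) (False # x) (False # x')" using x(2) by (simp add: meet_at_def)
  ultimately show ?case using x unfolding double_swap_def
    by (intro conjI exI[of _ "False # x"] exI[of _ "False # x'"]) simp_all
qed

lemma closure_generate_eq: "W_topology closure_of (generate W gens) = even_auts r"
proof -
  have cl: "W_topology closure_of (generate W gens) =
      {g \<in> tree_auts. \<forall>n. \<exists>h\<in>generate W gens. level_agree n g h}"
    using closure_of_W_topology[of "generate W gens"] generate_aut by auto
  have "dense_upto n (generate W gens) (even_auts r)" for n
  proof (rule dense_even_auts[OF aut_subgroup_generate generate_even r])
    fix n assume "n < r"
    then show "\<exists>h\<in>generate W gens. single_swap n h" using single_swap_a gens_generate by force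
  next
    fix n assume "r \<le> n"
    then obtain m where "n = r + m" using le_Suc_ex by blast
    then show "\<exists>h\<in>generate W gens. double_swap r n h"
      using double_swap_a[of m] gens_generate(1)[of "Suc (r + m)"] by auto
  qed
  then have "even_auts r \<subseteq> {g \<in> tree_auts. \<forall>n. \<exists>h\<in>generate W gens. level_agree n g h}"
    by (auto simp: dense_upto_def) (simp add: even_auts_def)
  moreover have "g \<in> even_auts r" if "g \<in> tree_auts" "\<And>n. \<exists>h\<in>generate W gens. level_agree n g h" for g
    using that generate_even by (intro even_auts_limit) blast+
  ultimately show ?thesis unfolding cl by blast
qed

end

theorem G_eq_even_auts: "r \<ge> 1 \<Longrightarrow> G r = even_auts r"
  using closure_generate_eq[OF _ gen_relations_gen] gens_def[OF _ gen_relations_gen]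
  by (simp add: G_def)

lemma aut_subgroup_conj:
  assumes H: "aut_subgroup H" and w: "w \<in> tree_auts"
  shows "aut_subgroup ((\<lambda>g. w \<circ> (g \<circ> inv_into UNIV w)) ` H)"
proof -
  let ?c = "\<lambda>g. w \<circ> (g \<circ> inv_into UNIV w)"
  have t: "g \<in> tree_auts" if "g \<in> H" for g using that H by (auto simp: aut_subgroup_def)
  have c: "?c g \<in> tree_auts" if "g \<in> H" for g
    using t[OF that] w by (intro tree_aut_comp tree_aut_inv)
  have "?c g \<circ> ?c h = ?c (g \<circ> h)" for g h
    by (simp add: fun_eq_iff tree_aut_inv_cancel[OF w])
  moreover have "?c id = id" by (simp add: fun_eq_iff tree_aut_inv_cancel[OF w])
  moreover have "inv_into UNIV (?c g) = ?c (inv_into UNIV g)" if "g \<in> H" for g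
  proof -
    have "inv_into UNIV (?c g) = inv_into UNIV (?c g) \<circ> (?c g \<circ> ?c (inv_into UNIV g))"
      by (simp add: fun_eq_iff tree_aut_inv_cancel[OF w] tree_aut_inv_cancel[OF t[OF that]])
    also have "\<dots> = ?c (inv_into UNIV g)"
      using tree_aut_inv_cancel(3)[OF c[OF that]] by (simp add: comp_assoc[symmetric])
    finally show ?thesis .
  qed
  ultimately show ?thesis
    using H c unfolding aut_subgroup_def ball_simps image_subset_iff
    by (metis (mono_tags, lifting) imageI)
qed

text \<open>Here \<open>\<eta>\<close> measures by how much the given labelling of the tree differs from one in which all
  elements of \<open>H\<close> have even blocks.\<close>

theorem closed_subgroup_conj_G:
  assumes H: "aut_subgroup H" and r: "r \<ge> 1"
    and closed: "\<And>g. g \<in> tree_auts \<Longrightarrow> (\<And>n. \<exists>h\<in>H. level_agree n g h) \<Longrightarrow> g \<in> H"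
    and eta: "\<And>v. \<eta> v = 1 \<or> \<eta> v = - 1"
    and sgn: "\<And>g v. g \<in> H \<Longrightarrow> block_sgn r g v = \<eta> v * \<eta> (g v)"
    and single: "\<And>n. n < r \<Longrightarrow> \<exists>h\<in>H. single_swap n h"
    and double: "\<And>n. n \<ge> r \<Longrightarrow> \<exists>h\<in>H. double_swap r n h"
  shows "\<exists>w\<in>tree_auts. H = (\<lambda>g. w \<circ> (g \<circ> inv_into UNIV w)) ` G r"
proof -
  \<comment> \<open>At most one swap per block, at its leftmost vertex, and there iff
    \<open>\<eta>\<close> is negative: thus the block signs of \<open>w\<close> are exactly
    \<open>\<eta>\<close>.\<close>
  define p where "p y \<longleftrightarrow> (r \<le> length y \<and> y = take (length y - r) y @ replicate r False \<and>
      \<eta> (take (length y - r) y) = - 1)" for y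
  define w where "w = portrait p"
  have w: "w \<in> tree_auts" by (simp add: w_def portrait_aut)
  have bw: "block_sgn r w v = \<eta> v" for v
  proof -
    have "{u \<in> words r. p (v @ u)} = (if \<eta> v = - 1 then {replicate r False} else {})"
      by (auto simp: p_def words_def)
    then show ?thesis using eta[of v] by (auto simp: block_sgn_def w_def prod_bsgn)
  qed
  let ?i = "inv_into UNIV w"
  have iw: "?i \<in> tree_auts" by (rule tree_aut_inv[OF w])
  let ?c = "\<lambda>g. w \<circ> (g \<circ> ?i)"
  define H' where "H' = ?c ` H"
  have t: "g \<in> tree_auts" if "g \<in> H" for g using that H by (auto simp: aut_subgroup_def)
  have H': "aut_subgroup H'" unfolding H'_def by (rule aut_subgroup_conj[OF H w])
  have sub: "H' \<subseteq> even_auts r"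
  proof
    fix h assume "h \<in> H'"
    then obtain g where g: "g \<in> H" "h = ?c g" by (auto simp: H'_def)
    have "block_sgn r h v = 1" for v
    proof -
      define u where "u = ?i v"
      have v: "v = w u" by (simp add: u_def tree_aut_inv_cancel[OF w])
      have "block_sgn r h v = block_sgn r ?i v * (block_sgn r g u * block_sgn r w (g u))"
        unfolding g(2) using w iw t[OF g(1)]
        by (simp add: block_sgn_comp tree_aut_comp u_def)
      also have "block_sgn r ?i v = \<eta> u" unfolding v by (simp add: block_sgn_inv[OF w] bw)
      finally show ?thesis using sgn[OF g(1), of u] bw eta[of u] eta[of "g u"] by auto
    qed
    then show "h \<in> even_auts r" using H' \<open>h \<in> H'\<close> by (auto simp: even_auts_def aut_subgroup_def)
  qed
  have dense: "dense_upto n H' (even_auts r)" for n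
  proof (rule dense_even_auts[OF H' sub r])
    fix n assume "n < r"
    then show "\<exists>h\<in>H'. single_swap n h"
      using single[of n] single_swap_conj[OF _ t w] by (auto simp: H'_def)
  next
    fix n assume "r \<le> n"
    then show "\<exists>h\<in>H'. double_swap r n h"
      using double[of n] double_swap_conj[OF _ t w] by (auto simp: H'_def)
  qed
  have conj_back: "?i \<circ> (?c g \<circ> w) = g" for g by (simp add: fun_eq_iff tree_aut_inv_cancel[OF w])
  have "even_auts r \<subseteq> H'"
  proof
    fix g assume g: "g \<in> even_auts r"
    then have gt: "g \<in> tree_auts" by (simp add: even_auts_def)
    have "?i \<circ> (g \<circ> w) \<in> H"
    proof (rule closed)
      show "?i \<circ> (g \<circ> w) \<in> tree_auts" using gt w iw by (intro tree_aut_comp)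
      fix n
      obtain h where h: "h \<in> H" "level_agree n g (?c h)"
        using dense[of n] g by (auto simp: dense_upto_def H'_def)
      have "level_agree n (?i \<circ> (g \<circ> w)) (?i \<circ> (?c h \<circ> w))"
        using h(2) tree_aut_length[OF w] by (simp add: level_agree_def)
      then show "\<exists>h\<in>H. level_agree n (?i \<circ> (g \<circ> w)) h" using h(1) conj_back by auto
    qed
    moreover have "g = ?c (?i \<circ> (g \<circ> w))" by (simp add: fun_eq_iff tree_aut_inv_cancel[OF w])
    ultimately show "g \<in> H'" unfolding H'_def by blast
  qed
  then have H'eq: "H' = G r" using sub G_eq_even_auts[OF r] by blast
  have ii: "inv_into UNIV ?i = w"
    using w by (simp add: tree_auts_def inv_inv_eq)
  have "H = (\<lambda>g. ?i \<circ> (g \<circ> w)) ` H'"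
    unfolding H'_def image_image conj_back by simp
  then show ?thesis using iw H'eq ii by (intro bexI[of _ ?i]) simp_all
qed

theorem closed_subgroup_eq_tree_auts:
  assumes H: "aut_subgroup H"
    and closed: "\<And>g. g \<in> tree_auts \<Longrightarrow> (\<And>n. \<exists>h\<in>H. level_agree n g h) \<Longrightarrow> g \<in> H"
    and single: "\<And>n. \<exists>h\<in>H. single_swap n h"
  shows "H = tree_auts"
proof
  show "H \<subseteq> tree_auts" using H by (simp add: aut_subgroup_def)
  show "tree_auts \<subseteq> H" using dense_tree_auts[OF H single] closed by (auto simp: dense_upto_def)
qed

section \<open>Subfields and their homomorphisms\<close>

definition subfield_set :: "'a::field set \<Rightarrow> bool" where
  "subfield_set E \<longleftrightarrow> 0 \<in> E \<and> 1 \<in> E \<and> (\<forall>x\<in>E. \<forall>y\<in>E. x + y \<in> E \<and> x * y \<in> E) \<and>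
     (\<forall>x\<in>E. - x \<in> E \<and> inverse x \<in> E)"

lemma subfield_setD:
  assumes "subfield_set E"
  shows "0 \<in> E" "1 \<in> E" "x \<in> E \<Longrightarrow> y \<in> E \<Longrightarrow> x + y \<in> E" "x \<in> E \<Longrightarrow> y \<in> E \<Longrightarrow> x * y \<in> E"
    "x \<in> E \<Longrightarrow> - x \<in> E" "x \<in> E \<Longrightarrow> inverse x \<in> E"
  using assms by (auto simp: subfield_set_def)

lemma subfield_set_more:
  assumes "subfield_set E"
  shows "x \<in> E \<Longrightarrow> y \<in> E \<Longrightarrow> x - y \<in> E" "x \<in> E \<Longrightarrow> y \<in> E \<Longrightarrow> x / y \<in> E" "x \<in> E \<Longrightarrow> x ^ n \<in> E"
    "of_nat n \<in> E" "numeral k \<in> E"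
proof -
  note E = subfield_setD[OF assms]
  show "x \<in> E \<Longrightarrow> y \<in> E \<Longrightarrow> x - y \<in> E"
    using E(3)[OF _ E(5), of x y] by simp
  show "x \<in> E \<Longrightarrow> y \<in> E \<Longrightarrow> x / y \<in> E"
    using E(4)[OF _ E(6), of x y] by (simp add: divide_inverse)
  show "x \<in> E \<Longrightarrow> x ^ n \<in> E" by (induction n) (auto intro: E)
  show *: "of_nat n \<in> E" for n by (induction n) (auto intro: E)
  show "numeral k \<in> E" using *[of "numeral k"] by simp
qed

lemma subfield_set_sum: "subfield_set E \<Longrightarrow> (\<And>i. i \<in> A \<Longrightarrow> f i \<in> E) \<Longrightarrow> sum f A \<in> E"
  by (induction A rule: infinite_finite_induct) (auto simp: subfield_setD)

lemma subfield_set_prod: "subfield_set E \<Longrightarrow> (\<And>i. i \<in> A \<Longrightarrow> f i \<in> E) \<Longrightarrow> prod f A \<in> E"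
  by (induction A rule: infinite_finite_induct) (auto simp: subfield_setD)

lemma subfield_set_UNIV [simp]: "subfield_set UNIV"
  by (simp add: subfield_set_def)

text \<open>A homomorphism on the subfield \<open>E\<close>, encoded as a total function whose
  values outside \<open>E\<close> are arbitrary. Extensions replace subfield and function
  together.\<close>

definition hom_on :: "'a::field set \<Rightarrow> ('a \<Rightarrow> 'b::field) \<Rightarrow> bool" where
  "hom_on E \<psi> \<longleftrightarrow> \<psi> 1 = 1 \<and> (\<forall>x\<in>E. \<forall>y\<in>E. \<psi> (x + y) = \<psi> x + \<psi> y \<and> \<psi> (x * y) = \<psi> x * \<psi> y)"

lemma field_hom_iff: "field_hom h \<longleftrightarrow> hom_on UNIV h"
  by (auto simp: field_hom_def hom_on_def)

lemma hom_onD: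
  assumes "hom_on E \<psi>"
  shows "\<psi> 1 = 1" "x \<in> E \<Longrightarrow> y \<in> E \<Longrightarrow> \<psi> (x + y) = \<psi> x + \<psi> y"
    "x \<in> E \<Longrightarrow> y \<in> E \<Longrightarrow> \<psi> (x * y) = \<psi> x * \<psi> y"
  using assms by (auto simp: hom_on_def)

context
  fixes E :: "'a::field set" and \<psi> :: "'a \<Rightarrow> 'b::field"
  assumes E: "subfield_set E" and h: "hom_on E \<psi>"
begin

lemma hom_on_0: "\<psi> 0 = 0"
proof -
  have "\<psi> 0 + 0 = \<psi> 0 + \<psi> 0" using hom_onD(2)[OF h, of 0 0] subfield_setD[OF E] by simp
  then show ?thesis by (metis add_left_cancel)
qed

lemma hom_on_uminus: "x \<in> E \<Longrightarrow> \<psi> (- x) = - \<psi> x"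
  using hom_onD(2)[OF h, of x "- x"] subfield_setD[OF E] hom_on_0
  by (simp add: eq_neg_iff_add_eq_0 add.commute)

lemma hom_on_diff: "x \<in> E \<Longrightarrow> y \<in> E \<Longrightarrow> \<psi> (x - y) = \<psi> x - \<psi> y"
  using hom_onD(2)[OF h, of x "- y"] hom_on_uminus subfield_setD[OF E] by simp

lemma hom_on_eq_0: "x \<in> E \<Longrightarrow> \<psi> x = 0 \<longleftrightarrow> x = 0"
  using hom_onD(3)[OF h, of x "inverse x"] subfield_setD[OF E] hom_on_0 hom_onD(1)[OF h]
  by (metis mult_zero_left right_inverse zero_neq_one)

lemma hom_on_inverse: "x \<in> E \<Longrightarrow> \<psi> (inverse x) = inverse (\<psi> x)"
proof (cases "x = 0")
  case False
  assume x: "x \<in> E"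
  then have "\<psi> x * \<psi> (inverse x) = 1"
    using hom_onD(3)[OF h, of x "inverse x"] subfield_setD[OF E] hom_onD(1)[OF h] False by simp
  then show ?thesis by (simp add: inverse_unique)
qed (simp add: hom_on_0)

lemma hom_on_divide: "x \<in> E \<Longrightarrow> y \<in> E \<Longrightarrow> \<psi> (x / y) = \<psi> x / \<psi> y"
  using hom_onD(3)[OF h, of x "inverse y"] hom_on_inverse subfield_setD[OF E]
  by (simp add: divide_inverse)

lemma hom_on_power: "x \<in> E \<Longrightarrow> \<psi> (x ^ n) = \<psi> x ^ n"
  using hom_onD[OF h] subfield_set_more[OF E] by (induction n) auto

lemma hom_on_of_nat: "\<psi> (of_nat n) = of_nat n"
  using hom_onD[OF h] subfield_set_more[OF E] subfield_setD[OF E] hom_on_0 by (induction n) auto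

lemma hom_on_numeral: "\<psi> (numeral k) = numeral k"
  using hom_on_of_nat[of "numeral k"] by simp

lemma hom_on_sum: "(\<And>i. i \<in> A \<Longrightarrow> f i \<in> E) \<Longrightarrow> \<psi> (sum f A) = (\<Sum>i\<in>A. \<psi> (f i))"
proof (induction A rule: infinite_finite_induct)
  case (insert x F)
  then show ?case using subfield_set_sum[OF E, of F f] by (simp add: hom_onD(2)[OF h])
qed (simp_all add: hom_on_0)

lemma hom_on_prod: "(\<And>i. i \<in> A \<Longrightarrow> f i \<in> E) \<Longrightarrow> \<psi> (prod f A) = (\<Prod>i\<in>A. \<psi> (f i))"
proof (induction A rule: infinite_finite_induct)
  case (insert x F)
  then show ?case using subfield_set_prod[OF E, of F f] by (simp add: hom_onD(3)[OF h])
qed (simp_all add: hom_onD(1)[OF h])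

lemma hom_on_inj: "x \<in> E \<Longrightarrow> y \<in> E \<Longrightarrow> \<psi> x = \<psi> y \<longleftrightarrow> x = y"
  using hom_on_eq_0[of "x - y"] hom_on_diff subfield_set_more[OF E] by auto

end

subsection \<open>Polynomials over a subfield\<close>

definition polys_over :: "'a::field set \<Rightarrow> 'a poly set" where
  "polys_over E = {p. \<forall>i. coeff p i \<in> E}"

lemma map_poly_pCons': "f 0 = 0 \<Longrightarrow> map_poly f (pCons c p) = pCons (f c) (map_poly f p)"
  by (rule poly_eqI) (auto simp: coeff_map_poly coeff_pCons split: nat.split)

lemma polys_over_pCons [simp]:
  "pCons c p \<in> polys_over E \<longleftrightarrow> c \<in> E \<and> p \<in> polys_over E"
  unfolding polys_over_def mem_Collect_eq
proof (intro iffI conjI allI)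
  assume "\<forall>i. coeff (pCons c p) i \<in> E"
  then show "c \<in> E" "coeff p i \<in> E" for i
    using spec[of _ 0] spec[of _ "Suc i"] by (metis coeff_pCons_0, metis coeff_pCons_Suc)
next
  fix i assume "c \<in> E \<and> (\<forall>i. coeff p i \<in> E)"
  then show "coeff (pCons c p) i \<in> E" by (cases i) auto
qed

context
  fixes E :: "'a::field set" assumes E: "subfield_set E"
begin

lemma polys_over_closed:
  "0 \<in> polys_over E" "1 \<in> polys_over E"
  "p \<in> polys_over E \<Longrightarrow> q \<in> polys_over E \<Longrightarrow> p + q \<in> polys_over E"
  "p \<in> polys_over E \<Longrightarrow> - p \<in> polys_over E"
  "p \<in> polys_over E \<Longrightarrow> q \<in> polys_over E \<Longrightarrow> p - q \<in> polys_over E"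
  "c \<in> E \<Longrightarrow> p \<in> polys_over E \<Longrightarrow> smult c p \<in> polys_over E"
  "c \<in> E \<Longrightarrow> monom c n \<in> polys_over E"
  "p \<in> polys_over E \<Longrightarrow> q \<in> polys_over E \<Longrightarrow> p * q \<in> polys_over E"
  using subfield_setD[OF E] subfield_set_more[OF E]
  by (auto simp: polys_over_def coeff_mult coeff_1 intro!: subfield_set_sum[OF E])

lemma poly_over_mem: "p \<in> polys_over E \<Longrightarrow> x \<in> E \<Longrightarrow> poly p x \<in> E"
  by (induction p) (auto simp: subfield_setD[OF E])

text \<open>The leading coefficient of \<open>m\<close> is invertible in \<open>E\<close>, so long
  division never leaves \<open>E\<close>.\<close>

lemma polys_over_division:
  assumes m: "m \<in> polys_over E" "m \<noteq> 0"
  shows "p \<in> polys_over E \<Longrightarrow>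
    \<exists>q\<in>polys_over E. \<exists>r\<in>polys_over E. p = m * q + r \<and> (r = 0 \<or> degree r < degree m)"
proof (induction "if p = 0 then 0 else Suc (degree p)" arbitrary: p rule: less_induct)
  case less
  show ?case
  proof (cases "p = 0 \<or> degree p < degree m")
    case True
    then show ?thesis using less.prems polys_over_closed(1)
      by (intro bexI[of _ 0] bexI[of _ p]) auto
  next
    case False
    define c where "c = monom (lead_coeff p / lead_coeff m) (degree p - degree m)"
    have c: "c \<in> polys_over E" unfolding c_def
      using less.prems m by (intro polys_over_closed subfield_set_more[OF E]) (auto simp: polys_over_def)
    define p' where "p' = p - m * c"
    have p': "p' \<in> polys_over E" unfolding p'_def using less.prems m c by (intro polys_over_closed)
    have cn: "lead_coeff p / lead_coeff m \<noteq> 0" using m False by simp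
    then have dc: "degree c = degree p - degree m" "c \<noteq> 0"
      by (simp_all add: c_def degree_monom_eq)
    have dm: "degree (m * c) = degree p" using dc m False by (simp add: degree_mult_eq)
    have "lead_coeff (m * c) = lead_coeff p"
      using m cn dc by (simp add: lead_coeff_mult c_def lead_coeff_monom)
    then have lc: "coeff p' (degree p) = 0" using dm by (simp add: p'_def)
    have "(if p' = 0 then 0 else Suc (degree p')) < (if p = 0 then 0 else Suc (degree p))"
    proof (cases "p' = 0")
      case True
      then show ?thesis using False by simp
    next
      case p'0: False
      have "degree p' \<le> degree p" unfolding p'_def using dm by (intro degree_diff_le) auto
      moreover have "degree p' \<noteq> degree p" using lc p'0 by (metis leading_coeff_0_iff)
      ultimately show ?thesis using False p'0 by simp
    qed
    then obtain q r where qr: "q \<in> polys_over E" "r \<in> polys_over E" "p' = m * q + r"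
      "r = 0 \<or> degree r < degree m" using less.hyps[OF _ p'] by blast
    have "p = m * (q + c) + r" using qr(3) by (simp add: p'_def algebra_simps)
    then show ?thesis using qr c polys_over_closed(3) by blast
  qed
qed

end

context
  fixes E :: "'a::field set" and \<psi> :: "'a \<Rightarrow> 'b::field"
  assumes E: "subfield_set E" and h: "hom_on E \<psi>"
begin

lemma map_poly_hom_on:
  assumes "p \<in> polys_over E" "q \<in> polys_over E"
  shows "map_poly \<psi> (p + q) = map_poly \<psi> p + map_poly \<psi> q"
    "map_poly \<psi> (p * q) = map_poly \<psi> p * map_poly \<psi> q"
    "map_poly \<psi> (pderiv p) = pderiv (map_poly \<psi> p)"
  using assms
  by (auto intro!: poly_eqI simp: coeff_map_poly hom_on_0[OF E h] polys_over_def hom_onD[OF h]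
      coeff_mult hom_on_sum[OF E h] subfield_setD[OF E] coeff_pderiv hom_on_of_nat[OF E h]
      subfield_set_more[OF E] intro!: sum.cong simp del: of_nat_Suc)

lemma poly_hom_on:
  "p \<in> polys_over E \<Longrightarrow> x \<in> E \<Longrightarrow> \<psi> (poly p x) = poly (map_poly \<psi> p) (\<psi> x)"
proof (induction p)
  case (pCons c p)
  then show ?case
    using poly_over_mem[OF E, of p x] subfield_setD[OF E]
    by (simp add: map_poly_pCons' hom_on_0[OF E h] hom_onD[OF h])
qed (simp add: hom_on_0[OF E h])

lemma degree_map_poly_hom_on:
  assumes "p \<in> polys_over E" shows "degree (map_poly \<psi> p) = degree p"
proof (cases "p = 0")
  case False
  have "\<psi> (lead_coeff p) \<noteq> 0"
    using assms False hom_on_eq_0[OF E h, of "lead_coeff p"] by (auto simp: polys_over_def)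
  then show ?thesis by (simp add: map_poly_degree_eq)
qed simp

end

lemma polys_over_UNIV [simp]: "p \<in> polys_over UNIV"
  by (simp add: polys_over_def)

text \<open>Coprimality of a polynomial with its derivative is a Bezout identity, which every
  homomorphism preserves.\<close>

lemma separable_poly_map:
  fixes \<iota> :: "'k::field \<Rightarrow> 'l::field"
  assumes h: "field_hom \<iota>" and P: "separable_poly P"
  shows "separable_poly (map_poly \<iota> P)"
proof -
  have h': "hom_on UNIV \<iota>" using h by (simp add: field_hom_iff)
  note mp = map_poly_hom_on[OF subfield_set_UNIV h', simplified]
  obtain u v where uv: "u * P + v * pderiv P = 1"
    using coprime_poly_bezout P unfolding separable_poly_def by blast
  have "map_poly \<iota> (u * P + v * pderiv P) = 1"
    unfolding uv using hom_onD(1)[OF h'] by (simp add: map_poly_1)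
  then have "map_poly \<iota> u * map_poly \<iota> P + map_poly \<iota> v * pderiv (map_poly \<iota> P) = 1"
    by (simp add: mp)
  then show ?thesis unfolding separable_poly_def
    by (intro coprimeI) (metis dvd_add dvd_mult)
qed

lemma separable_poly_factor:
  assumes "separable_poly (p * q)" shows "separable_poly p"
  unfolding separable_poly_def
proof (rule coprimeI)
  fix d assume "d dvd p" "d dvd pderiv p"
  then have "d dvd p * q" "d dvd pderiv (p * q)" by (auto simp: pderiv_mult)
  then show "is_unit d" using assms by (auto simp: separable_poly_def coprime_def)
qed

section \<open>Extension of homomorphisms\<close>

text \<open>The minimal polynomial \<open>m\<close> divides every polynomial over \<open>E\<close>
  that vanishes at \<open>a\<close>, so evaluating the transported polynomial at the root
  \<open>b\<close> depends only on the value at \<open>a\<close>. The values at \<open>a\<close>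
  already form a field.\<close>

lemma hom_on_simple_extension:
  fixes E :: "'a::field set" and \<psi> :: "'a \<Rightarrow> 'b::field"
  assumes E: "subfield_set E" and h: "hom_on E \<psi>"
    and m: "m \<in> polys_over E" "m \<noteq> 0" "poly m a = 0"
    and min: "\<And>p. p \<in> polys_over E \<Longrightarrow> p \<noteq> 0 \<Longrightarrow> poly p a = 0 \<Longrightarrow> degree m \<le> degree p"
    and b: "poly (map_poly \<psi> m) b = 0"
  shows "\<exists>E' \<psi>'. subfield_set E' \<and> E \<subseteq> E' \<and> a \<in> E' \<and> hom_on E' \<psi>' \<and> (\<forall>x\<in>E. \<psi>' x = \<psi> x) \<and> \<psi>' a = b"
proof -
  define E' where "E' = {poly p a | p. p \<in> polys_over E}"
  note cl = polys_over_closed[OF E]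
  have wd: "poly (map_poly \<psi> p) b = 0" if p: "p \<in> polys_over E" "poly p a = 0" for p
  proof -
    obtain q r where qr: "q \<in> polys_over E" "r \<in> polys_over E" "p = m * q + r"
      "r = 0 \<or> degree r < degree m" using polys_over_division[OF E m(1,2) p(1)] by blast
    have "poly r a = 0" using p(2) qr(3) m(3) by simp
    then have "r = 0" using min[OF qr(2)] qr(4) by force
    then have "map_poly \<psi> p = map_poly \<psi> m * map_poly \<psi> q"
      using qr map_poly_hom_on(2)[OF E h m(1) qr(1)] by simp
    then show ?thesis using b by simp
  qed
  \<comment> \<open>After reduction modulo \<open>m\<close>, divide \<open>m\<close> by
    \<open>p\<close>: the value of the remainder at \<open>a\<close> is that of \<open>p\<close>
    times \<open>- q\<close>, it is nonzero by minimality of \<open>m\<close>, and the degree has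
    dropped.\<close>
  have inv: "\<exists>q\<in>polys_over E. poly q a * poly p a = 1" if "p \<in> polys_over E" "poly p a \<noteq> 0" for p
    using that
  proof (induction "degree p" arbitrary: p rule: less_induct)
    case less
    have small: "\<exists>q\<in>polys_over E. poly q a * poly p a = 1"
      if p: "p \<in> polys_over E" "poly p a \<noteq> 0" "degree p < degree m"
        "\<And>p'. degree p' < degree p \<Longrightarrow> p' \<in> polys_over E \<Longrightarrow> poly p' a \<noteq> 0 \<Longrightarrow>
              \<exists>q\<in>polys_over E. poly q a * poly p' a = 1" for p
    proof (cases "degree p = 0")
      case True
      then obtain c where c: "p = [:c:]" by (rule degree_eq_zeroE)
      then have "[:inverse c:] \<in> polys_over E" using p(1) cl(1) subfield_setD[OF E] by simp
      moreover have "c \<noteq> 0" using p(2) c by simp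
      ultimately show ?thesis using c by (intro bexI[of _ "[:inverse c:]"]) auto
    next
      case False
      then have p0: "p \<noteq> 0" by auto
      obtain q r where qr: "q \<in> polys_over E" "r \<in> polys_over E" "m = p * q + r"
        "r = 0 \<or> degree r < degree p" using polys_over_division[OF E p(1) p0 m(1)] by blast
      have ra: "poly r a = - (poly p a * poly q a)" using m(3) unfolding qr(3)
        by (simp add: eq_neg_iff_add_eq_0 add.commute)
      have "poly r a \<noteq> 0"
      proof
        assume r0: "poly r a = 0"
        then have "poly q a = 0" using ra p(2) by simp
        have "r = 0" using min[OF qr(2) _ r0] qr(4) p(3) by force
        then have "q \<noteq> 0" using qr(3) m(2) by auto
        then have "degree m \<le> degree q" using min[OF qr(1)] \<open>poly q a = 0\<close> by blast
        moreover have "degree m = degree p + degree q"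
          using qr(3) \<open>r = 0\<close> p0 \<open>q \<noteq> 0\<close> by (simp add: degree_mult_eq)
        ultimately show False using False by simp
      qed
      then have "degree r < degree p" using qr(4) by auto
      then obtain s where s: "s \<in> polys_over E" "poly s a * poly r a = 1"
        using p(4)[OF _ qr(2)] \<open>poly r a \<noteq> 0\<close> by blast
      have "poly (- (s * q)) a * poly p a = 1" using s(2) by (simp add: ra algebra_simps)
      moreover have "- (s * q) \<in> polys_over E" by (intro cl(4,8) s(1) qr(1))
      ultimately show ?thesis by blast
    qed
    show ?case
    proof (cases "degree p < degree m")
      case True
      then show ?thesis using small[OF less.prems True] less.hyps by blast
    next
      case False
      obtain q r where qr: "q \<in> polys_over E" "r \<in> polys_over E" "p = m * q + r"
        "r = 0 \<or> degree r < degree m" using polys_over_division[OF E m(1,2) less.prems(1)] by blast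
      have ra: "poly r a = poly p a" using qr(3) m(3) by simp
      then have "r \<noteq> 0" using less.prems by auto
      then have "degree r < degree p" using qr(4) False by auto
      then show ?thesis using less.hyps[OF _ qr(2)] ra less.prems by simp
    qed
  qed
  have sub: "subfield_set E'"
    unfolding subfield_set_def
  proof (intro conjI ballI)
    show "0 \<in> E'" "1 \<in> E'" unfolding E'_def using cl(1,2) by (auto intro: exI[of _ 0] exI[of _ 1])
  next
    fix x y assume "x \<in> E'" "y \<in> E'"
    then obtain p q where pq: "p \<in> polys_over E" "q \<in> polys_over E" "x = poly p a" "y = poly q a"
      by (auto simp: E'_def)
    then have "x + y = poly (p + q) a" "x * y = poly (p * q) a" by simp_all
    then show "x + y \<in> E'" "x * y \<in> E'"
      using cl(3)[OF pq(1,2)] cl(8)[OF pq(1,2)] by (auto simp: E'_def simp del: poly_add poly_mult)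
  next
    fix x assume "x \<in> E'"
    then obtain p where p: "p \<in> polys_over E" "x = poly p a" by (auto simp: E'_def)
    then have "- x = poly (- p) a" by simp
    then show "- x \<in> E'" unfolding E'_def using cl p by blast
    show "inverse x \<in> E'"
    proof (cases "x = 0")
      case True
      then show ?thesis using \<open>x \<in> E'\<close> by simp
    next
      case False
      then obtain q where "q \<in> polys_over E" "poly q a * x = 1" using inv p by blast
      then show ?thesis unfolding E'_def using inverse_unique[of x "poly q a"]
        by (auto simp: mult.commute)
    qed
  qed
  define \<psi>' where "\<psi>' z = poly (map_poly \<psi> (SOME p. p \<in> polys_over E \<and> poly p a = z)) b" for z
  have psi': "\<psi>' (poly p a) = poly (map_poly \<psi> p) b" if p: "p \<in> polys_over E" for p
  proof -
    let ?q = "SOME q. q \<in> polys_over E \<and> poly q a = poly p a"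
    have q: "?q \<in> polys_over E \<and> poly ?q a = poly p a" by (rule someI[of _ p]) (simp add: p)
    then have d: "?q - p \<in> polys_over E" using cl(5) p by blast
    have "poly (map_poly \<psi> (?q - p)) b = 0" using wd[OF d] q by simp
    moreover have "map_poly \<psi> ?q = map_poly \<psi> (?q - p) + map_poly \<psi> p"
      using map_poly_hom_on(1)[OF E h d p] by simp
    ultimately show ?thesis by (simp add: \<psi>'_def)
  qed
  have "hom_on E' \<psi>'"
    unfolding hom_on_def
  proof (intro conjI ballI)
    show "\<psi>' 1 = 1" using psi'[OF cl(2)] hom_onD(1)[OF h] by (simp add: map_poly_1)
    fix x y assume "x \<in> E'" "y \<in> E'"
    then obtain p q where pq: "p \<in> polys_over E" "q \<in> polys_over E" "x = poly p a" "y = poly q a"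
      by (auto simp: E'_def)
    show "\<psi>' (x + y) = \<psi>' x + \<psi>' y" "\<psi>' (x * y) = \<psi>' x * \<psi>' y"
      using psi'[OF cl(3)[OF pq(1,2)]] psi'[OF cl(8)[OF pq(1,2)]] psi'[OF pq(1)] psi'[OF pq(2)]
        map_poly_hom_on(1,2)[OF E h pq(1,2)] pq by simp_all
  qed
  moreover have "x \<in> E' \<and> \<psi>' x = \<psi> x" if "x \<in> E" for x
  proof -
    have "[:x:] \<in> polys_over E" using that cl(1) by simp
    moreover have "x = poly [:x:] a" by simp
    ultimately have "x \<in> E'" unfolding E'_def by blast
    then show ?thesis using psi'[OF \<open>[:x:] \<in> polys_over E\<close>] hom_on_0[OF E h]
      by (simp add: map_poly_pCons')
  qed
  moreover have "a \<in> E' \<and> \<psi>' a = b"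
  proof -
    have "[:0, 1:] \<in> polys_over E" using cl(1) subfield_setD[OF E] by simp
    moreover have "a = poly [:0, 1:] a" by simp
    ultimately have "a \<in> E'" unfolding E'_def by blast
    then show ?thesis using psi'[OF \<open>[:0, 1:] \<in> polys_over E\<close>] hom_on_0[OF E h] hom_onD(1)[OF h]
      by (simp add: map_poly_pCons')
  qed
  ultimately show ?thesis using sub by blast
qed

text \<open>The minimal polynomial of \<open>a\<close> over \<open>E\<close> divides a separable
  polynomial with coefficients in K, which \<open>\<psi>\<close> fixes. Its image under
  \<open>\<psi>\<close> divides the same polynomial, hence is separable and has a root.\<close>

lemma hom_on_extends_to_element:
  fixes \<iota> :: "'k::field \<Rightarrow> 'l::field"
  assumes sc: "is_separable_closure \<iota>"
    and E: "subfield_set E" "range \<iota> \<subseteq> E" and h: "hom_on E \<psi>" "\<And>x. \<psi> (\<iota> x) = \<iota> x"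
  shows "\<exists>E' \<psi>'. subfield_set E' \<and> E \<subseteq> E' \<and> a \<in> E' \<and> hom_on E' \<psi>' \<and> (\<forall>x\<in>E. \<psi>' x = (\<psi> x :: 'l))"
proof -
  have \<iota>: "field_hom \<iota>" "hom_on UNIV \<iota>" and sep: "separable_over \<iota> a"
    and root: "\<And>p :: 'l poly. separable_poly p \<Longrightarrow> degree p > 0 \<Longrightarrow> \<exists>x. poly p x = 0"
    using sc by (auto simp: is_separable_closure_def field_hom_iff)
  obtain P where P: "separable_poly P" "poly (map_poly \<iota> P) a = 0"
    using sep by (auto simp: separable_over_def)
  define P' where "P' = map_poly \<iota> P"
  have sP': "separable_poly P'" unfolding P'_def by (rule separable_poly_map[OF \<iota>(1) P(1)])
  then have P'0: "P' \<noteq> 0" by (auto simp: separable_poly_def)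
  have i0: "\<iota> 0 = 0" by (rule hom_on_0[OF subfield_set_UNIV \<iota>(2)])
  have P'E: "P' \<in> polys_over E"
    using E(2) by (auto simp: polys_over_def P'_def coeff_map_poly i0)
  define R where "R n \<longleftrightarrow> (\<exists>p\<in>polys_over E. p \<noteq> 0 \<and> poly p a = 0 \<and> degree p = n)" for n
  have "R (degree P')" using P'E P'0 P by (auto simp: R_def P'_def)
  then have "R (LEAST n. R n)" by (rule LeastI)
  then obtain m where m: "m \<in> polys_over E" "m \<noteq> 0" "poly m a = 0" "degree m = (LEAST n. R n)"
    by (auto simp: R_def)
  have min: "degree m \<le> degree p" if "p \<in> polys_over E" "p \<noteq> 0" "poly p a = 0" for p
    unfolding m(4) using that by (intro Least_le) (auto simp: R_def)
  obtain q r where qr: "q \<in> polys_over E" "r \<in> polys_over E" "P' = m * q + r"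
    "r = 0 \<or> degree r < degree m" using polys_over_division[OF E(1) m(1,2) P'E] by blast
  have "poly r a = 0" using P(2) qr(3) m(3) by (simp add: P'_def)
  then have "r = 0" using min[OF qr(2)] qr(4) by force
  then have Pm: "P' = m * q" using qr by simp
  have "map_poly \<psi> P' = P'"
    by (rule poly_eqI) (simp add: P'_def coeff_map_poly i0 hom_on_0[OF E(1) h(1)] h(2))
  then have "separable_poly (map_poly \<psi> m)"
    using sP' Pm map_poly_hom_on(2)[OF E(1) h(1) m(1) qr(1)] separable_poly_factor by metis
  moreover have "degree (map_poly \<psi> m) > 0"
  proof -
    have "degree m \<noteq> 0"
    proof
      assume "degree m = 0"
      then obtain c where "m = [:c:]" by (rule degree_eq_zeroE)
      then show False using m by simp
    qed
    then show ?thesis using degree_map_poly_hom_on[OF E(1) h(1) m(1)] by simp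
  qed
  ultimately obtain b where "poly (map_poly \<psi> m) b = 0" using root by blast
  from hom_on_simple_extension[OF E(1) h(1) m(1-3) min this] show ?thesis by blast
qed

text \<open>Partial homomorphisms as graphs, so that domain and values grow together and the union
  of a chain is just a union. Uniqueness of values need only be required at 0, since differences
  stay in the graph.\<close>

definition hom_graph :: "('a::field \<times> 'b::field) set \<Rightarrow> bool" where
  "hom_graph Q \<longleftrightarrow> (1, 1) \<in> Q \<and> (\<forall>y. (0, y) \<in> Q \<longrightarrow> y = 0) \<and>
     (\<forall>x y x' y'. (x, y) \<in> Q \<longrightarrow> (x', y') \<in> Q \<longrightarrow> (x + x', y + y') \<in> Q \<and> (x * x', y * y') \<in> Q) \<and>
     (\<forall>x y. (x, y) \<in> Q \<longrightarrow> (- x, - y) \<in> Q \<and> (inverse x, inverse y) \<in> Q)"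

lemma hom_graphD:
  assumes "hom_graph Q"
  shows "(1, 1) \<in> Q" "(0, y) \<in> Q \<Longrightarrow> y = 0"
    "(x, y) \<in> Q \<Longrightarrow> (x', y') \<in> Q \<Longrightarrow> (x + x', y + y') \<in> Q"
    "(x, y) \<in> Q \<Longrightarrow> (x', y') \<in> Q \<Longrightarrow> (x * x', y * y') \<in> Q"
    "(x, y) \<in> Q \<Longrightarrow> (- x, - y) \<in> Q" "(x, y) \<in> Q \<Longrightarrow> (inverse x, inverse y) \<in> Q"
  using assms unfolding hom_graph_def by blast+

lemma hom_graph_of_hom_on:
  assumes E: "subfield_set E" and h: "hom_on E \<psi>"
  shows "hom_graph ((\<lambda>x. (x, \<psi> x)) ` E)"
  unfolding hom_graph_def
  using subfield_setD[OF E] hom_onD[OF h] hom_on_0[OF E h] hom_on_uminus[OF E h] hom_on_inverse[OF E h]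
  by (auto simp: image_iff)

lemma hom_on_of_hom_graph:
  assumes Q: "hom_graph Q"
  obtains \<psi> where "subfield_set (Domain Q)" "hom_on (Domain Q) \<psi>" "Q = (\<lambda>x. (x, \<psi> x)) ` Domain Q"
proof -
  have un: "y = y'" if "(x, y) \<in> Q" "(x, y') \<in> Q" for x y y'
  proof -
    have "(x + - x, y + - y') \<in> Q"
      by (rule hom_graphD(3)[OF Q that(1) hom_graphD(5)[OF Q that(2)]])
    then show ?thesis using hom_graphD(2)[OF Q, of "y - y'"] by simp
  qed
  define \<psi> where "\<psi> x = (THE y. (x, y) \<in> Q)" for x
  have psi: "\<psi> x = y" if "(x, y) \<in> Q" for x y
    unfolding \<psi>_def using that un by blast
  have Q0: "(0, 0) \<in> Q"
  proof -
    have "(1, 1) \<in> Q" "(- 1, - 1) \<in> Q" using Q by (auto simp: hom_graph_def)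
    then have "(1 + - 1, 1 + - 1) \<in> Q" using Q unfolding hom_graph_def by blast
    then show ?thesis by simp
  qed
  have "subfield_set (Domain Q)"
    using Q Q0 unfolding subfield_set_def hom_graph_def by (auto simp: Domain_iff) blast+
  moreover have "hom_on (Domain Q) \<psi>"
    unfolding hom_on_def
  proof (intro conjI ballI)
    show "\<psi> 1 = 1" using Q psi by (auto simp: hom_graph_def)
    fix x y assume "x \<in> Domain Q" "y \<in> Domain Q"
    then obtain x' y' where xy: "(x, x') \<in> Q" "(y, y') \<in> Q" by auto
    then have "(x + y, x' + y') \<in> Q" "(x * y, x' * y') \<in> Q" using Q by (auto simp: hom_graph_def)
    then show "\<psi> (x + y) = \<psi> x + \<psi> y" "\<psi> (x * y) = \<psi> x * \<psi> y" using xy psi by auto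
  qed
  moreover have "Q = (\<lambda>x. (x, \<psi> x)) ` Domain Q" using psi by (force simp: image_iff)
  ultimately show ?thesis using that by blast
qed

theorem hom_on_extends_to_automorphism:
  fixes \<iota> :: "'k::field \<Rightarrow> 'l::field"
  assumes sc: "is_separable_closure \<iota>"
    and E: "subfield_set E" "range \<iota> \<subseteq> E" and h: "hom_on E \<psi>" "\<And>x. \<psi> (\<iota> x) = \<iota> x"
  shows "\<exists>s\<in>galois_group (range \<iota>). \<forall>x\<in>E. s x = \<psi> x"
proof -
  define G0 where "G0 = (\<lambda>x. (x, \<psi> x)) ` E"
  define A where "A = {G. hom_graph G \<and> G0 \<subseteq> G}"
  have "\<exists>M\<in>A. \<forall>X\<in>A. M \<subseteq> X \<longrightarrow> X = M"
  proof (rule subset_Zorn_nonempty)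
    show "A \<noteq> {}" using hom_graph_of_hom_on[OF E(1) h(1)] by (auto simp: A_def G0_def)
    fix C assume C: "C \<noteq> {}" "subset.chain A C"
    have ch: "X \<in> A" "X \<in> C \<Longrightarrow> Y \<in> C \<Longrightarrow> X \<subseteq> Y \<or> Y \<subseteq> X" if "X \<in> C" for X Y
      using C that by (auto simp: subset.chain_def)
    have "hom_graph (\<Union>C)"
      unfolding hom_graph_def
    proof (intro conjI allI impI)
      obtain X where "X \<in> C" using C by blast
      then show "(1, 1) \<in> \<Union>C" using ch(1) by (auto simp: A_def hom_graph_def)
      show "y = 0" if "(0, y) \<in> \<Union>C" for y using that ch(1) by (auto simp: A_def hom_graph_def)
      show "(- x, - y) \<in> \<Union>C" "(inverse x, inverse y) \<in> \<Union>C" if "(x, y) \<in> \<Union>C" for x y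
        using that ch(1) by (auto simp: A_def hom_graph_def)
      fix x y x' y' assume "(x, y) \<in> \<Union>C" "(x', y') \<in> \<Union>C"
      then obtain X Y where XY: "X \<in> C" "Y \<in> C" "(x, y) \<in> X" "(x', y') \<in> Y" by blast
      then obtain Z where Z: "Z \<in> C" "(x, y) \<in> Z" "(x', y') \<in> Z" using ch(2)[of X Y] by blast
      then have "hom_graph Z" using ch(1) by (auto simp: A_def)
      then have "(x + x', y + y') \<in> Z" "(x * x', y * y') \<in> Z" using Z unfolding hom_graph_def by blast+
      then show "(x + x', y + y') \<in> \<Union>C" "(x * x', y * y') \<in> \<Union>C" using Z by blast+
    qed
    moreover have "G0 \<subseteq> \<Union>C" using C ch(1) by (auto simp: A_def)
    ultimately show "\<Union>C \<in> A" by (simp add: A_def)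
  qed
  then obtain M where "M \<in> A" "\<And>X. X \<in> A \<Longrightarrow> M \<subseteq> X \<Longrightarrow> X = M" by blast
  then have M: "hom_graph M" "G0 \<subseteq> M" "\<And>X. hom_graph X \<Longrightarrow> M \<subseteq> X \<Longrightarrow> X = M"
    by (auto simp: A_def)
  obtain s where s: "subfield_set (Domain M)" "hom_on (Domain M) s" "M = (\<lambda>x. (x, s x)) ` Domain M"
    by (rule hom_on_of_hom_graph[OF M(1)])
  have sE: "x \<in> Domain M \<and> s x = \<psi> x" if "x \<in> E" for x
  proof -
    have "(x, \<psi> x) \<in> M" using that M(2) by (auto simp: G0_def)
    then show ?thesis using s(3) by (metis (no_types, lifting) Domain.DomainI Pair_inject imageE)
  qed
  have K: "range \<iota> \<subseteq> Domain M" and fix_K: "s (\<iota> x) = \<iota> x" for x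
    using sE[of "\<iota> x" for x] E(2) h(2) by (simp_all add: image_subset_iff)
  have "Domain M = UNIV"
  proof (rule ccontr)
    assume "Domain M \<noteq> UNIV"
    then obtain a where a: "a \<notin> Domain M" by blast
    obtain E' \<psi>' where E': "subfield_set E'" "Domain M \<subseteq> E'" "a \<in> E'" "hom_on E' \<psi>'"
      "\<forall>x\<in>Domain M. \<psi>' x = s x"
      using hom_on_extends_to_element[OF sc s(1) K s(2) fix_K, of a] by blast
    have "(\<lambda>x. (x, \<psi>' x)) ` E' = M"
    proof (rule M(3)[OF hom_graph_of_hom_on[OF E'(1,4)]])
      show "M \<subseteq> (\<lambda>x. (x, \<psi>' x)) ` E'"
      proof
        fix z assume "z \<in> M"
        then obtain x where "x \<in> Domain M" "z = (x, s x)" using s(3) by blast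
        then show "z \<in> (\<lambda>x. (x, \<psi>' x)) ` E'" using E'(2,5) by (intro image_eqI[of _ _ x]) auto
      qed
    qed
    then have "(a, \<psi>' a) \<in> M" using E'(3) by blast
    then show False using a by blast
  qed
  then have hs: "hom_on UNIV s" using s(2) by simp
  have inj: "inj s" using hom_on_inj[OF subfield_set_UNIV hs] by (auto simp: inj_def)
  \<comment> \<open>An injective \<open>s\<close> fixing K maps the finite root set of a polynomial
    over K into itself, hence onto itself, and every element is such a root.\<close>
  have "surj s"
  proof -
    have "y \<in> range s" for y
    proof -
      have \<iota>: "field_hom \<iota>" "hom_on UNIV \<iota>" and sep: "separable_over \<iota> y"
        using sc by (auto simp: is_separable_closure_def field_hom_iff)
      obtain P where P: "separable_poly P" "poly (map_poly \<iota> P) y = 0"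
        using sep by (auto simp: separable_over_def)
      define P' where "P' = map_poly \<iota> P"
      have "P' \<noteq> 0" using separable_poly_map[OF \<iota>(1) P(1)] by (auto simp: separable_poly_def P'_def)
      then have fin: "finite {x. poly P' x = 0}" by (rule poly_roots_finite)
      have i0: "\<iota> 0 = 0" by (rule hom_on_0[OF subfield_set_UNIV \<iota>(2)])
      have "map_poly s P' = P'"
        by (rule poly_eqI) (simp add: P'_def coeff_map_poly i0 hom_on_0[OF subfield_set_UNIV hs] fix_K)
      then have "s ` {x. poly P' x = 0} \<subseteq> {x. poly P' x = 0}"
        using poly_hom_on[OF subfield_set_UNIV hs, of P'] hom_on_0[OF subfield_set_UNIV hs]
        by (metis (mono_tags, lifting) UNIV_I image_subset_iff mem_Collect_eq polys_over_UNIV)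
      moreover have "inj_on s {x. poly P' x = 0}" using inj by (rule inj_on_subset) simp
      ultimately have "s ` {x. poly P' x = 0} = {x. poly P' x = 0}"
        using fin endo_inj_surj by blast
      then show ?thesis using P(2) unfolding P'_def by blast
    qed
    then show ?thesis by blast
  qed
  then have "s \<in> galois_group (range \<iota>)"
    using inj hs fix_K by (auto simp: galois_group_def bij_def field_hom_iff)
  then show ?thesis using sE by blast
qed

section \<open>Square roots\<close>

text \<open>The image of \<open>s\<close> can be prescribed only if \<open>s\<close> is new;
  otherwise it is already determined up to sign. For a new \<open>s\<close> the polynomial
  \<open>X^2 - s^2\<close> is minimal, as a linear relation would put \<open>s\<close> into
  \<open>E\<close>.\<close>

lemma hom_on_adjoin_sqrt:
  fixes E :: "'a::field set" and \<psi> :: "'a \<Rightarrow> 'b::field"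
  assumes E: "subfield_set E" and h: "hom_on E \<psi>" and s: "s\<^sup>2 \<in> E" and m: "m\<^sup>2 = \<psi> (s\<^sup>2)"
  shows "\<exists>E' \<psi>'. subfield_set E' \<and> E \<subseteq> E' \<and> s \<in> E' \<and> hom_on E' \<psi>' \<and> (\<forall>x\<in>E. \<psi>' x = \<psi> x) \<and>
    (s \<notin> E \<longrightarrow> \<psi>' s = m)"
proof (cases "s \<in> E")
  case True
  then show ?thesis using E h by (intro exI[of _ E] exI[of _ \<psi>]) auto
next
  case False
  define q where "q = [:- (s\<^sup>2), 0, 1:]"
  have q: "q \<in> polys_over E" "q \<noteq> 0" "poly q s = 0"
    using s polys_over_closed(1)[OF E] subfield_setD[OF E]
    by (simp_all add: q_def power2_eq_square)
  have min: "degree q \<le> degree p" if p: "p \<in> polys_over E" "p \<noteq> 0" "poly p s = 0" for p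
  proof (rule ccontr)
    assume "\<not> degree q \<le> degree p"
    then have "degree p \<le> 1" by (simp add: q_def)
    then have pp: "p = [:coeff p 0, coeff p 1:]"
      by (intro poly_eqI) (auto simp: coeff_pCons coeff_eq_0 split: nat.split)
    have c: "coeff p 0 \<in> E" "coeff p 1 \<in> E" using p(1) by (auto simp: polys_over_def)
    have 0: "coeff p 0 + s * coeff p 1 = 0" using p(3) by (subst (asm) pp) simp
    have "coeff p 1 \<noteq> 0"
    proof
      assume "coeff p 1 = 0"
      then have "coeff p 0 = 0" using 0 by simp
      then show False using pp p(2) \<open>coeff p 1 = 0\<close> by simp
    qed
    then have "s = - coeff p 0 / coeff p 1" using 0 by (simp add: field_simps eq_neg_iff_add_eq_0)
    moreover have "- coeff p 0 / coeff p 1 \<in> E"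
      using c by (intro subfield_set_more[OF E] subfield_setD[OF E])
    ultimately show False using False by simp
  qed
  have "poly (map_poly \<psi> q) m = 0"
    using m hom_on_0[OF E h] hom_onD(1)[OF h] hom_on_uminus[OF E h s]
    by (simp add: q_def map_poly_pCons' power2_eq_square)
  from hom_on_simple_extension[OF E h q min this] show ?thesis by blast
qed

text \<open>Only membership in the domain is asserted, so an \<open>s\<close> that earlier steps
  have already produced causes no conflict of signs.\<close>

lemma hom_on_adjoin_sqrts:
  fixes E :: "'a::field set" and \<psi> :: "'a \<Rightarrow> 'b::field"
  assumes E: "subfield_set E" and h: "hom_on E \<psi>" and S: "finite S"
    and sq: "\<And>s. s \<in> S \<Longrightarrow> s\<^sup>2 \<in> E \<and> (\<exists>m. m\<^sup>2 = \<psi> (s\<^sup>2))"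
  shows "\<exists>E' \<psi>'. subfield_set E' \<and> E \<subseteq> E' \<and> S \<subseteq> E' \<and> hom_on E' \<psi>' \<and> (\<forall>x\<in>E. \<psi>' x = \<psi> x)"
  using S sq
proof (induction S rule: finite_induct)
  case empty
  then show ?case using E h by blast
next
  case (insert s S)
  then obtain E1 \<psi>1 where 1: "subfield_set E1" "E \<subseteq> E1" "S \<subseteq> E1" "hom_on E1 \<psi>1" "\<forall>x\<in>E. \<psi>1 x = \<psi> x"
    by blast
  obtain m where m: "m\<^sup>2 = \<psi>1 (s\<^sup>2)" and s: "s\<^sup>2 \<in> E1" using insert.prems[of s] 1 by force
  obtain E2 \<psi>2 where "subfield_set E2" "E1 \<subseteq> E2" "s \<in> E2" "hom_on E2 \<psi>2" "\<forall>x\<in>E1. \<psi>2 x = \<psi>1 x"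
    using hom_on_adjoin_sqrt[OF 1(1,4) s m] by blast
  then show ?case using 1 by (intro exI[of _ E2] exI[of _ \<psi>2]) (auto simp: subset_iff)
qed

lemma galois_group_negates_sqrt:
  fixes \<iota> :: "'k::field \<Rightarrow> 'l::field"
  assumes sc: "is_separable_closure \<iota>" and E: "subfield_set E" "range \<iota> \<subseteq> E"
    and s: "s\<^sup>2 \<in> E" "s \<notin> E"
  shows "\<exists>g\<in>galois_group E. g s = - s"
proof -
  have "hom_on E (\<lambda>x. x)" by (simp add: hom_on_def)
  moreover have "(- s)\<^sup>2 = s\<^sup>2" by simp
  ultimately obtain E' \<psi>' where E': "subfield_set E'" "E \<subseteq> E'" "s \<in> E'" "hom_on E' \<psi>'"
    "\<forall>x\<in>E. \<psi>' x = x" "\<psi>' s = - s"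
    using hom_on_adjoin_sqrt[OF E(1) _ s(1), of "\<lambda>x. x" "- s"] s(2) by blast
  have "\<psi>' (\<iota> x) = \<iota> x" for x using E(2) E'(5) by blast
  then obtain g where "g \<in> galois_group (range \<iota>)" "\<forall>x\<in>E'. g x = \<psi>' x"
    using hom_on_extends_to_automorphism[OF sc E'(1) _ E'(4)] E(2) E'(2) by blast
  then show ?thesis using E' by (intro bexI[of _ g]) (auto simp: galois_group_def)
qed

lemma separable_X2:
  fixes x :: "'a::field"
  assumes "(2::'a) \<noteq> 0" "x \<noteq> 0" shows "separable_poly [:- x, 0, 1:]"
  unfolding separable_poly_def
proof (rule coprimeI)
  fix d assume d: "d dvd [:- x, 0, 1:]" "d dvd pderiv [:- x, 0, 1:]"
  have "[:0, inverse (2 * x):] * pderiv [:- x, 0, 1:] - [:inverse x:] * [:- x, 0, 1:] = 1"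
    using assms by (simp add: pderiv_pCons field_simps one_pCons)
  then show "is_unit d" using d by (metis dvd_diff dvd_mult)
qed

lemma sep_closed_sqrt:
  fixes \<iota> :: "'k::field \<Rightarrow> 'l::field"
  assumes sc: "is_separable_closure \<iota>" and 2: "(2::'l) \<noteq> 0"
  shows "\<exists>y::'l. y\<^sup>2 = x"
proof (cases "x = 0")
  case True
  then show ?thesis by (intro exI[of _ 0]) simp
next
  case False
  have "degree [:- x, 0, 1:] > 0" by simp
  then obtain y where "poly [:- x, 0, 1:] y = 0"
    using sc separable_X2[OF 2 False] by (auto simp: is_separable_closure_def)
  then show ?thesis by (intro exI[of _ y]) (simp add: power2_eq_square eq_neg_iff_add_eq_0 algebra_simps)
qed

lemma four_nonzero: "(2::'a::field) \<noteq> 0 \<Longrightarrow> (4::'a) \<noteq> 0"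
  by (metis mult_2 mult_eq_0_iff numeral_Bit0 numeral_code(2))

lemma separable_X4:
  fixes a e :: "'a::field"
  assumes 2: "(2::'a) \<noteq> 0" and e: "e \<noteq> 0" "a\<^sup>2 - e \<noteq> 0"
  shows "separable_poly [:a\<^sup>2 - e, 0, - (2 * a), 0, 1:]"
  unfolding separable_poly_def
proof (rule coprimeI)
  let ?p = "[:a\<^sup>2 - e, 0, - (2 * a), 0, 1:]"
  fix d assume d: "d dvd ?p" "d dvd pderiv ?p"
  have 4: "(4::'a) \<noteq> 0" using 2 by (rule four_nonzero)
  have pd: "pderiv ?p = [:0, 1:] * [:- (4 * a), 0, 4:]" by (simp add: pderiv_pCons algebra_simps)
  define n where "n = a\<^sup>2 - e"
  have n: "n \<noteq> 0" using e by (simp add: n_def)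
  \<comment> \<open>With \<open>p = (X\<^sup>2 - a)\<^sup>2 - e\<close>, the polynomial \<open>p\<close> is a nonzero constant modulo each of the
    factors \<open>X\<close> and \<open>X\<^sup>2 - a\<close> of its derivative.\<close>
  have X: "?p = [:0, 1:] * [:0, - (2 * a), 0, 1:] + [:n:]" by (simp add: n_def)
  have Y: "?p = [:- a, 0, 1:] * [:- a, 0, 1:] + [:- e:]" by (simp add: power2_eq_square)
  have "(?p - [:n:]) * (?p - [:- e:]) = [:0, 1:] * [:- a, 0, 1:] * ([:0, - (2 * a), 0, 1:] * [:- a, 0, 1:])"
    unfolding X[THEN arg_cong[where f = "\<lambda>p. p - [:n:]"], simplified add_diff_cancel_right']
      Y[THEN arg_cong[where f = "\<lambda>p. p - [:- e:]"], simplified add_diff_cancel_right']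
    by (simp only: mult_ac)
  moreover have "[:- (4 * a), 0, 4:] = [:4:] * [:- a, 0, 1:]" by simp
  then have "[:0, 1:] * [:- a, 0, 1:] = [:inverse 4:] * pderiv ?p"
    using 4 unfolding pd by simp
  ultimately have "d dvd (?p - [:n:]) * (?p - [:- e:])"
    using d(2) by (metis dvd_mult dvd_mult2)
  moreover have "(?p - [:n:]) * (?p - [:- e:]) = ?p * (?p - [:- e:] - [:n:]) + [:- (n * e):]"
    by (simp add: algebra_simps)
  ultimately have "d dvd [:- (n * e):]"
    using d(1) by (metis dvd_add_right_iff dvd_mult2)
  moreover have "is_unit [:- (n * e):]" using n e by (simp add: is_unit_const_poly_iff dvd_field_iff)
  ultimately show "is_unit d" by (rule dvd_trans)
qed

text \<open>Squaring twice shows that \<open>s\<close> is a zero of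
  \<open>(X^2 - a)^2 - b^2 \<delta>\<close>. Its separability could fail only if
  \<open>a^2 = b^2 \<delta>\<close> or \<open>b^2 \<delta> = 0\<close>; then \<open>\<theta>\<close>
  or \<open>w\<close> already comes from the base field and a polynomial of degree at most two
  does.\<close>

lemma separable_sqrt_of_quadratic:
  fixes c :: "'k::field \<Rightarrow> 'l::field"
  assumes c: "field_hom c" and 2: "(2::'k) \<noteq> 0" and th: "\<theta>\<^sup>2 = c \<delta>"
    and w: "w = c a + c b * \<theta>" and s: "s\<^sup>2 = w"
  shows "separable_over c s"
proof -
  have c': "hom_on UNIV c" using c by (simp add: field_hom_iff)
  note cs = hom_onD[OF c', simplified] hom_on_0[OF subfield_set_UNIV c']
    hom_on_uminus[OF subfield_set_UNIV c', simplified] hom_on_diff[OF subfield_set_UNIV c', simplified]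
    hom_on_divide[OF subfield_set_UNIV c', simplified] hom_on_power[OF subfield_set_UNIV c', simplified]
    hom_on_numeral[OF subfield_set_UNIV c']
  have base: "separable_over c s" if "s\<^sup>2 = c e" for e
  proof (cases "e = 0")
    case True
    then have "poly (map_poly c [:0, 1:]) s = 0" using that cs by (simp add: map_poly_pCons')
    moreover have "separable_poly ([:0, 1:] :: 'k poly)"
      by (simp add: separable_poly_def pderiv_pCons one_pCons[symmetric])
    ultimately show ?thesis unfolding separable_over_def by blast
  next
    case False
    have "poly (map_poly c [:- e, 0, 1:]) s = 0"
      using that cs by (simp add: map_poly_pCons' power2_eq_square)
    then show ?thesis using separable_X2[OF 2 False] unfolding separable_over_def by blast
  qed
  show ?thesis
  proof (cases "\<theta> \<in> range c \<or> b = 0")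
    case True
    then obtain e where "w = c e" using w cs by auto (metis cs(2,3))
    then show ?thesis using base s by simp
  next
    case False
    define e where "e = b\<^sup>2 * \<delta>"
    have ct: "c e = (c b * \<theta>)\<^sup>2" by (simp add: e_def cs power_mult_distrib th)
    have "\<theta> \<noteq> 0" using False cs by (metis rangeI)
    then have "c e \<noteq> 0" using False ct hom_on_eq_0[OF subfield_set_UNIV c'] by simp
    then have e0: "e \<noteq> 0" using cs by auto
    have "a\<^sup>2 - e \<noteq> 0"
    proof
      assume "a\<^sup>2 - e = 0"
      then have "(c a)\<^sup>2 = (c b * \<theta>)\<^sup>2" using ct cs by (metis eq_iff_diff_eq_0)
      then have "c b * \<theta> = c a \<or> c b * \<theta> = - c a" by (metis power2_eq_iff)
      then have "\<theta> = c a / c b \<or> \<theta> = - c a / c b"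
        using False hom_on_eq_0[OF subfield_set_UNIV c', of b] by (auto simp: field_simps)
      then have "\<theta> = c (a / b) \<or> \<theta> = c (- a / b)" by (simp add: cs)
      then show False using False by auto
    qed
    have "poly (map_poly c [:a\<^sup>2 - e, 0, - (2 * a), 0, 1:]) s
        = s * s * (s * s) - 2 * c a * (s * s) + c a * c a - c e"
      by (simp add: map_poly_pCons' cs algebra_simps power2_eq_square)
    also have "\<dots> = (s\<^sup>2)\<^sup>2 - 2 * c a * s\<^sup>2 + (c a)\<^sup>2 - c e" by (simp add: power2_eq_square)
    also have "\<dots> = (w - c a)\<^sup>2 - c e" unfolding s by (simp add: power2_eq_square algebra_simps)
    also have "\<dots> = 0" by (simp add: w ct)
    finally show ?thesis using separable_X4[OF 2 e0 \<open>a\<^sup>2 - e \<noteq> 0\<close>] unfolding separable_over_def by blast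
  qed
qed

section \<open>Elements algebraic over the constants\<close>

definition algebraic_over :: "('k::field \<Rightarrow> 'l::field) \<Rightarrow> 'l \<Rightarrow> bool" where
  "algebraic_over c x \<longleftrightarrow> (\<exists>p. p \<noteq> 0 \<and> poly (map_poly c p) x = 0)"

context
  fixes c :: "'k::field \<Rightarrow> 'l::field"
  assumes c: "field_hom c"
begin

lemma field_hom_simps: "c 0 = 0" "c 1 = 1" "c (x + y) = c x + c y" "c (x * y) = c x * c y" "c x = 0 \<longleftrightarrow> x = 0"
  "c (- x) = - c x" "c (x - y) = c x - c y" "c (inverse x) = inverse (c x)" "c (x / y) = c x / c y"
proof -
  have c': "hom_on UNIV c" using c by (simp add: field_hom_iff)
  note U = subfield_set_UNIV
  show "c 0 = 0" "c 1 = 1" "c (x + y) = c x + c y" "c (x * y) = c x * c y" "c x = 0 \<longleftrightarrow> x = 0"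
    "c (- x) = - c x" "c (x - y) = c x - c y" "c (inverse x) = inverse (c x)" "c (x / y) = c x / c y"
    using hom_on_0[OF U c'] hom_onD[OF c'] hom_on_eq_0[OF U c'] hom_on_uminus[OF U c']
      hom_on_diff[OF U c'] hom_on_inverse[OF U c'] hom_on_divide[OF U c'] by simp_all
qed

interpretation V: vector_space "\<lambda>a x. c a * x"
  by unfold_locales (simp_all add: field_hom_simps algebra_simps)

text \<open>A finite spanning set of a subalgebra over the base field. Closure of algebraic elements
  under the field operations is proved by dimension, without minimal polynomials.\<close>

definition "finite_algebra B \<longleftrightarrow> finite B \<and> 1 \<in> V.span B \<and> (\<forall>x\<in>B. \<forall>y\<in>B. x * y \<in> V.span B)"

lemma span_mult_right:
  assumes "\<And>b. b \<in> B \<Longrightarrow> b * z \<in> V.span C" "y \<in> V.span B" shows "y * z \<in> V.span C"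
  using assms(2)
proof (induction rule: V.span_induct_alt)
  case base
  then show ?case by (simp add: V.span_zero)
next
  case (step a x y)
  have "c a * (x * z) + y * z \<in> V.span C"
    using step assms(1) by (intro V.span_add V.span_scale) auto
  then show ?case by (simp add: algebra_simps)
qed

lemma finite_algebra_mult:
  assumes B: "finite_algebra B" and xy: "x \<in> V.span B" "y \<in> V.span B" shows "x * y \<in> V.span B"
proof (rule span_mult_right[OF _ xy(1)])
  fix b assume "b \<in> B"
  then have "y * b \<in> V.span B"
    using B by (intro span_mult_right[OF _ xy(2)]) (auto simp: finite_algebra_def)
  then show "b * y \<in> V.span B" by (simp add: mult.commute)
qed

text \<open>One more power of \<open>x\<close> than there are spanning vectors must satisfy a linear
  relation.\<close>

lemma finite_algebra_algebraic:
  assumes B: "finite_algebra B" and x: "x \<in> V.span B" shows "algebraic_over c x"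
proof -
  have pow: "x ^ i \<in> V.span B" for i
    using B x finite_algebra_mult[OF B] by (induction i) (auto simp: finite_algebra_def)
  define S where "S = (\<lambda>i. x ^ i) ` {..card B}"
  show ?thesis
  \<comment> \<open>Dependence is a property of the set of powers, which loses track of coinciding
    powers; a coincidence is itself an algebraic relation.\<close>
  proof (cases "inj_on (\<lambda>i. x ^ i) {..card B}")
    case False
    then obtain i j where ij: "x ^ i = x ^ j" "i \<noteq> j" by (auto simp: inj_on_def)
    define p :: "'k poly" where "p = monom 1 i - monom 1 j"
    have "coeff p i = 1" using ij by (simp add: p_def)
    then have "p \<noteq> 0" by auto
    moreover have "map_poly c p = monom 1 i - monom 1 j"
      by (rule poly_eqI) (simp add: p_def coeff_map_poly field_hom_simps)
    then have "poly (map_poly c p) x = 0" using ij by (simp add: poly_monom)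
    ultimately show ?thesis unfolding algebraic_over_def by blast
  next
    case True
    then have card: "card S = Suc (card B)" by (simp add: S_def card_image)
    have "V.dependent S"
    proof (rule ccontr)
      assume "\<not> V.dependent S"
      then have "card S \<le> card B"
        using V.independent_span_bound[of B S] B pow by (auto simp: S_def finite_algebra_def)
      then show False using card by simp
    qed
    then obtain u v where u: "v \<in> S" "u v \<noteq> 0" "(\<Sum>v\<in>S. c (u v) * v) = 0"
      using V.dependent_finite[of S] by (auto simp: S_def)
    define p :: "'k poly" where "p = (\<Sum>i\<le>card B. monom (u (x ^ i)) i)"
    have cp: "coeff p i = (if i \<le> card B then u (x ^ i) else 0)" for i
      by (simp add: p_def coeff_sum if_distrib cong: if_cong)
    have "p \<noteq> 0"
    proof -
      obtain i where "i \<le> card B" "v = x ^ i" using u(1) by (auto simp: S_def)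
      then have "coeff p i \<noteq> 0" using u(2) cp by simp
      then show ?thesis by auto
    qed
    have "map_poly c p = (\<Sum>i\<le>card B. monom (c (u (x ^ i))) i)"
      by (rule poly_eqI) (simp add: coeff_map_poly field_hom_simps cp coeff_sum if_distrib cong: if_cong)
    then have "poly (map_poly c p) x = (\<Sum>i\<le>card B. c (u (x ^ i)) * x ^ i)"
      by (simp add: poly_sum poly_monom)
    also have "\<dots> = (\<Sum>v\<in>S. c (u v) * v)" unfolding S_def using True by (simp add: sum.reindex)
    finally have "poly (map_poly c p) x = 0" using u(3) by simp
    with \<open>p \<noteq> 0\<close> show ?thesis unfolding algebraic_over_def by blast
  qed
qed

text \<open>The products of \<open>B\<close> with the powers of \<open>x\<close> below
  \<open>d\<close> span: the monic relation returns \<open>x ^ d\<close> to this span.\<close>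

lemma finite_algebra_adjoin:
  assumes B: "finite_algebra B" and d: "d \<ge> 1" and v: "\<And>i. i < d \<Longrightarrow> v i \<in> V.span B"
    and x: "x ^ d = (\<Sum>i<d. v i * x ^ i)"
  shows "\<exists>B'. finite_algebra B' \<and> V.span B \<subseteq> V.span B' \<and> x \<in> V.span B'"
proof -
  define B' where "B' = (\<lambda>(b, i). b * x ^ i) ` (B \<times> {..<d})"
  have fin: "finite B'" using B by (auto simp: B'_def finite_algebra_def)
  have mem: "y * x ^ i \<in> V.span B'" if "y \<in> V.span B" "i < d" for y i
    by (rule span_mult_right[OF _ that(1)]) (use that(2) in \<open>auto simp: B'_def intro!: V.span_base\<close>)
  have sub: "V.span B \<subseteq> V.span B'" using mem[of _ 0] d by auto
  have mx: "y * x \<in> V.span B'" if "y \<in> V.span B'" for y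
  proof (rule span_mult_right[OF _ that])
    fix z assume "z \<in> B'"
    then obtain b i where z: "z = b * x ^ i" "b \<in> B" "i < d" by (auto simp: B'_def)
    then have bB: "b \<in> V.span B" by (intro V.span_base)
    show "z * x \<in> V.span B'"
    proof (cases "Suc i < d")
      case True
      then show ?thesis using mem[OF bB, of "Suc i"] z by (simp add: algebra_simps)
    next
      case False
      then have "z * x = b * x ^ d" using z by (metis Suc_lessI mult.assoc power_Suc2)
      also have "\<dots> = (\<Sum>i<d. (b * v i) * x ^ i)" unfolding x by (simp add: sum_distrib_left mult.assoc)
      also have "\<dots> \<in> V.span B'"
        by (intro V.span_sum mem finite_algebra_mult[OF B bB v]) auto
      finally show ?thesis .
    qed
  qed
  have mpow: "y * x ^ i \<in> V.span B'" if "y \<in> V.span B'" for y i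
    using that by (induction i arbitrary: y) (auto simp: mult.assoc[symmetric] mx)
  have mb: "y * b \<in> V.span B'" if y: "y \<in> V.span B'" and b: "b \<in> B" for y b
  proof (rule span_mult_right[OF _ y])
    fix z assume "z \<in> B'"
    then obtain b' i where z: "z = b' * x ^ i" "b' \<in> B" "i < d" by (auto simp: B'_def)
    then have "(b' * b) * x ^ i \<in> V.span B'" using b B by (intro mem) (auto simp: finite_algebra_def)
    then show "z * b \<in> V.span B'" using z by (simp add: mult_ac)
  qed
  have 1: "1 \<in> V.span B'" using B sub by (auto simp: finite_algebra_def)
  have "y * z \<in> V.span B'" if "y \<in> B'" "z \<in> B'" for y z
  proof -
    obtain b i where z: "z = b * x ^ i" "b \<in> B" using \<open>z \<in> B'\<close> by (auto simp: B'_def)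
    have "y * b * x ^ i \<in> V.span B'" using \<open>y \<in> B'\<close> z by (intro mpow mb V.span_base)
    then show ?thesis by (simp add: z mult.assoc)
  qed
  then have "finite_algebra B'" using fin 1 by (simp add: finite_algebra_def)
  moreover have "x \<in> V.span B'" using mx[OF 1] by simp
  ultimately show ?thesis using sub by blast
qed

lemma monic_relation:
  assumes "P \<noteq> 0" "poly P x = 0"
  shows "degree P \<ge> 1" "(x::'l) ^ degree P = (\<Sum>i<degree P. (- coeff P i / lead_coeff P) * x ^ i)"
proof -
  show "degree P \<ge> 1"
  proof (rule ccontr)
    assume "\<not> ?thesis"
    then obtain a where "P = [:a:]" by (metis degree_eq_zeroE less_one not_le)
    then show False using assms by simp
  qed
  have "0 = (\<Sum>i\<le>degree P. coeff P i * x ^ i)" using assms(2) by (simp add: poly_altdef)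
  also have "\<dots> = (\<Sum>i<degree P. coeff P i * x ^ i) + lead_coeff P * x ^ degree P"
    by (simp add: lessThan_Suc_atMost[symmetric])
  finally have "x ^ degree P = - (\<Sum>i<degree P. coeff P i * x ^ i) / lead_coeff P"
    using assms(1) by (simp add: field_simps eq_neg_iff_add_eq_0)
  then show "x ^ degree P = (\<Sum>i<degree P. (- coeff P i / lead_coeff P) * x ^ i)"
    by (simp add: sum_divide_distrib sum_negf)
qed

lemma finite_algebra_containing:
  assumes "finite A" "\<And>x. x \<in> A \<Longrightarrow> algebraic_over c x"
  shows "\<exists>B. finite_algebra B \<and> A \<subseteq> V.span B"
  using assms
proof (induction A rule: finite_induct)
  case empty
  have "finite_algebra {1}" by (auto simp: finite_algebra_def intro: V.span_base)
  then show ?case by blast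
next
  case (insert x A)
  then obtain B where B: "finite_algebra B" "A \<subseteq> V.span B" by blast
  obtain p where p: "p \<noteq> 0" "poly (map_poly c p) x = 0"
    using insert.prems[of x] by (auto simp: algebraic_over_def)
  define P where "P = map_poly c p"
  have dP: "degree P = degree p" unfolding P_def using p field_hom_simps by (intro map_poly_degree_eq) auto
  have P0: "P \<noteq> 0" using p dP field_hom_simps
    by (metis P_def coeff_map_poly leading_coeff_0_iff)
  have "- coeff P i / lead_coeff P \<in> V.span B" for i
  proof -
    have "- coeff P i / lead_coeff P = c (- coeff p i / lead_coeff p) * 1"
      by (simp add: P_def coeff_map_poly field_hom_simps dP[unfolded P_def])
    also have "\<dots> \<in> V.span B" using B by (intro V.span_scale) (auto simp: finite_algebra_def)
    finally show ?thesis .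
  qed
  then obtain B' where "finite_algebra B'" "V.span B \<subseteq> V.span B'" "x \<in> V.span B'"
    using finite_algebra_adjoin[OF B(1) monic_relation(1)[OF P0] _ monic_relation(2)[OF P0]] p(2)
    unfolding P_def by blast
  then show ?case using B by blast
qed

text \<open>The finitely many coefficients of the monic equation lie in one finite algebra, and
  adjoining \<open>x\<close> keeps it finite.\<close>

lemma algebraic_over_trans:
  assumes P: "P \<in> polys_over {x. algebraic_over c x}" "P \<noteq> 0" "poly P x = 0"
    and inv: "\<And>i. algebraic_over c (- coeff P i / lead_coeff P)"
  shows "algebraic_over c x"
proof -
  obtain B where B: "finite_algebra B" "(\<lambda>i. - coeff P i / lead_coeff P) ` {..<degree P} \<subseteq> V.span B"
    using finite_algebra_containing[of "(\<lambda>i. - coeff P i / lead_coeff P) ` {..<degree P}"] inv by auto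
  obtain B' where "finite_algebra B'" "x \<in> V.span B'"
    using finite_algebra_adjoin[OF B(1) monic_relation(1)[OF P(2,3)] _ monic_relation(2)[OF P(2,3)]] B(2)
    by blast
  then show ?thesis by (rule finite_algebra_algebraic)
qed

lemma algebraic_over_const: "algebraic_over c (c a)"
  unfolding algebraic_over_def
  by (intro exI[of _ "[:- a, 1:]"]) (simp add: map_poly_pCons' field_hom_simps)

lemma subfield_set_algebraic: "subfield_set {x. algebraic_over c x}"
  unfolding subfield_set_def
proof (intro conjI ballI)
  show "0 \<in> {x. algebraic_over c x}" "1 \<in> {x. algebraic_over c x}"
    using algebraic_over_const[of 0] algebraic_over_const[of 1] by (simp_all add: field_hom_simps)
next
  fix x y assume "x \<in> {x. algebraic_over c x}" "y \<in> {x. algebraic_over c x}"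
  then obtain B where B: "finite_algebra B" "x \<in> V.span B" "y \<in> V.span B"
    using finite_algebra_containing[of "{x, y}"] by auto
  show "x + y \<in> {x. algebraic_over c x}" "x * y \<in> {x. algebraic_over c x}"
    using B V.span_add finite_algebra_mult finite_algebra_algebraic by blast+
next
  fix x assume "x \<in> {x. algebraic_over c x}"
  then have x: "algebraic_over c x" by simp
  then obtain B where B: "finite_algebra B" "x \<in> V.span B"
    using finite_algebra_containing[of "{x}"] by auto
  show "- x \<in> {x. algebraic_over c x}" using finite_algebra_algebraic[OF B(1) V.span_neg[OF B(2)]] by simp
  have "algebraic_over c (inverse x)"
  proof (cases "x = 0")
    case True
    then show ?thesis using x by simp
  next
    case False
    obtain p where p: "p \<noteq> 0" "poly (map_poly c p) x = 0" using x by (auto simp: algebraic_over_def)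
    have d: "degree (map_poly c p) = degree p" using p field_hom_simps by (intro map_poly_degree_eq) auto
    have "map_poly c (reflect_poly p) = reflect_poly (map_poly c p)"
      by (rule poly_eqI) (simp add: coeff_map_poly coeff_reflect_poly d field_hom_simps)
    then have "poly (map_poly c (reflect_poly p)) (inverse x) = 0"
      using p False poly_reflect_poly_nz[of "inverse x" "map_poly c p"] by simp
    then show ?thesis using p unfolding algebraic_over_def by (intro exI[of _ "reflect_poly p"]) simp
  qed
  then show "inverse x \<in> {x. algebraic_over c x}" by simp
qed

text \<open>This permits an embedding to be prescribed on the algebraic constants and on
  \<open>t\<close> independently.\<close>

lemma transcendental_over_algebraic:
  assumes t: "\<not> algebraic_over c t" and P: "P \<in> polys_over {x. algebraic_over c x}" "poly P t = 0"
  shows "P = 0"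
proof (rule ccontr)
  assume P0: "P \<noteq> 0"
  note A = subfield_set_algebraic
  have co: "coeff P i \<in> {x. algebraic_over c x}" for i using P by (auto simp: polys_over_def)
  have "- coeff P i / lead_coeff P \<in> {x. algebraic_over c x}" for i
    by (intro subfield_set_more(2)[OF A] subfield_setD(5)[OF A] co)
  then show False using algebraic_over_trans[OF P(1) P0 P(2)] t by blast
qed

end

section \<open>Homogeneous coordinates\<close>

fun px :: "'a::field proj_line \<Rightarrow> 'a" where "px (Fin x) = x" | "px Infty = 1"
fun py :: "'a::field proj_line \<Rightarrow> 'a" where "py (Fin x) = 1" | "py Infty = 0"

lemma px_py_nonzero: "px p \<noteq> 0 \<or> py p \<noteq> 0"
  by (cases p) auto

lemma quotient_point_px_py [simp]: "quotient_point (px p) (py p) = p"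
  by (cases p) (auto simp: quotient_point_def)

lemma quotient_point_eq_iff:
  assumes "x \<noteq> 0 \<or> y \<noteq> 0" "x' \<noteq> 0 \<or> y' \<noteq> 0"
  shows "quotient_point x y = quotient_point x' y' \<longleftrightarrow> x * y' = x' * (y::'a::field)"
  using assms by (auto simp: quotient_point_def field_simps)

lemma quotient_point_scale:
  assumes "x \<noteq> 0 \<or> y \<noteq> (0::'a::field)"
  obtains k where "k \<noteq> 0" "x = k * px (quotient_point x y)" "y = k * py (quotient_point x y)"
  using assms that[of x] that[of y] by (cases "y = 0") (auto simp: quotient_point_def)

section \<open>Binary quadratic forms\<close>

definition qform :: "'a::comm_ring_1 \<Rightarrow> 'a \<Rightarrow> 'a \<Rightarrow> 'a \<Rightarrow> 'a \<Rightarrow> 'a" where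
  "qform u v w x y = u * x\<^sup>2 + v * x * y + w * y\<^sup>2"

lemma qform_scale: "qform u v w (k * x) (k * y) = k\<^sup>2 * qform u v w x y"
  by (simp add: qform_def power2_eq_square algebra_simps)

text \<open>The polar form of a quadratic form, applied to two of its zeros, is up to sign the square root
  of the discriminant times the determinant of the two vectors.\<close>

lemma qform_polar_identity:
  "(2 * u * x * x' + v * (x * y' + x' * y) + 2 * w * y * y')\<^sup>2 =
   4 * qform u v w x y * qform u v w x' y' + (v\<^sup>2 - 4 * u * w) * (x * y' - x' * y)\<^sup>2"
  by (simp add: qform_def power2_eq_square algebra_simps)

text \<open>The quantity in \<open>res\<close> is the resultant of the two quadratic forms: they
  have no common zero, so the map has degree two.\<close>

locale quadratic_map =
  fixes a0 a1 a2 b0 b1 b2 :: "'a::field"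
  assumes two: "(2::'a) \<noteq> 0"
    and res: "(a2 * b0 - a0 * b2)\<^sup>2 - (a2 * b1 - a1 * b2) * (a1 * b0 - a0 * b1) \<noteq> 0"
begin

definition "A x y = qform a2 a1 a0 x y"
definition "B x y = qform b2 b1 b0 x y"

text \<open>\<open>J\<close> is half the Jacobian determinant of \<open>(A, B)\<close>, and \<open>D\<close> is the discriminant of the form whose
  zeros are the points of the fibre.\<close>

definition "J x y = qform (a2 * b1 - a1 * b2) (2 * (a2 * b0 - a0 * b2)) (a1 * b0 - a0 * b1) x y"
definition "D x y = (a1 * y - b1 * x)\<^sup>2 - 4 * (a2 * y - b2 * x) * (a0 * y - b0 * x)"
definition "F p = quotient_point (A (px p) (py p)) (B (px p) (py p))"

lemma D_qform: "D x y = qform (b1\<^sup>2 - 4 * b2 * b0) (4 * a2 * b0 + 4 * a0 * b2 - 2 * a1 * b1) (a1\<^sup>2 - 4 * a2 * a0) x y"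
  by (simp add: D_def qform_def power2_eq_square algebra_simps)

text \<open>The discriminant of \<open>D\<close>, itself a quadratic form, is 16 times the
  resultant, so the zeros of \<open>D\<close> are simple.\<close>

lemma D_disc: "(4 * a2 * b0 + 4 * a0 * b2 - 2 * a1 * b1)\<^sup>2 - 4 * (b1\<^sup>2 - 4 * b2 * b0) * (a1\<^sup>2 - 4 * a2 * a0) =
    16 * ((a2 * b0 - a0 * b2)\<^sup>2 - (a2 * b1 - a1 * b2) * (a1 * b0 - a0 * b1))"
  by (simp add: power2_eq_square algebra_simps)

text \<open>One zero of the fibre form over the image of a point is the point itself, so the
  discriminant of this form must be a square; its root is \<open>J\<close>.\<close>

lemma D_AB: "D (A x y) (B x y) = (J x y)\<^sup>2"
  by (simp add: D_def A_def B_def J_def qform_def power2_eq_square algebra_simps)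

lemma D_scale: "D (k * x) (k * y) = k\<^sup>2 * D x y"
  unfolding D_qform by (rule qform_scale)

lemma four: "(4::'a) \<noteq> 0"
  using two by (rule four_nonzero)

text \<open>The three combinations of \<open>A\<close> and \<open>B\<close> in the proof each
  eliminate one coefficient. A common zero would make the symmetric matrix of \<open>J\<close>, with
  entries \<open>\<alpha>, \<beta>, \<gamma>\<close>, singular, contrary to
  \<open>res\<close>.\<close>

lemma AB_nonzero:
  assumes "x \<noteq> 0 \<or> y \<noteq> 0" shows "A x y \<noteq> 0 \<or> B x y \<noteq> 0"
proof (rule ccontr)
  assume "\<not> ?thesis"
  then have 0: "A x y = 0" "B x y = 0" by auto
  have 1: "b2 * A x y - a2 * B x y = - y * ((a2 * b1 - a1 * b2) * x + (a2 * b0 - a0 * b2) * y)"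
    "b0 * A x y - a0 * B x y = x * ((a2 * b0 - a0 * b2) * x + (a1 * b0 - a0 * b1) * y)"
    "b1 * A x y - a1 * B x y = (a2 * b1 - a1 * b2) * x\<^sup>2 - (a1 * b0 - a0 * b1) * y\<^sup>2"
    by (simp_all add: A_def B_def qform_def power2_eq_square algebra_simps)
  define \<alpha> where "\<alpha> = a2 * b1 - a1 * b2"
  define \<beta> where "\<beta> = a2 * b0 - a0 * b2"
  define \<gamma> where "\<gamma> = a1 * b0 - a0 * b1"
  have 2: "y * (\<alpha> * x + \<beta> * y) = 0" "x * (\<beta> * x + \<gamma> * y) = 0" "\<alpha> * x\<^sup>2 - \<gamma> * y\<^sup>2 = 0"
    using 1 0 by (simp_all add: \<alpha>_def \<beta>_def \<gamma>_def)
  have res': "\<beta>\<^sup>2 - \<alpha> * \<gamma> \<noteq> 0" using res by (simp add: \<alpha>_def \<beta>_def \<gamma>_def)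
  show False
  proof (cases "x = 0 \<or> y = 0")
    case True
    then have "\<beta> = 0" "\<alpha> * \<gamma> = 0" using 2 assms by auto
    then show False using res' by simp
  next
    case False
    then have "\<alpha> * x = - \<beta> * y" "\<beta> * x = - \<gamma> * y" using 2 by (auto simp: eq_neg_iff_add_eq_0)
    then have "\<alpha> * x * (\<gamma> * y) = \<beta> * y * (\<beta> * x)" by simp
    then have "(\<beta>\<^sup>2 - \<alpha> * \<gamma>) * (x * y) = 0" by (auto simp: power2_eq_square algebra_simps)
    then show False using False res' by simp
  qed
qed

lemma F_quotient_point:
  assumes "x \<noteq> 0 \<or> y \<noteq> 0"
  shows "F (quotient_point x y) = quotient_point (A x y) (B x y)"
proof -
  obtain k where k: "k \<noteq> 0" "x = k * px (quotient_point x y)" "y = k * py (quotient_point x y)"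
    using quotient_point_scale[OF assms] by blast
  define p where "p = quotient_point x y"
  have "A x y = k\<^sup>2 * A (px p) (py p)" "B x y = k\<^sup>2 * B (px p) (py p)"
    unfolding A_def B_def by (subst k(2), subst k(3), simp only: p_def qform_scale)+
  then show ?thesis
    unfolding F_def p_def[symmetric] using k(1) AB_nonzero[OF px_py_nonzero, of p]
    by (subst quotient_point_eq_iff) auto
qed

lemma F_eq_iff:
  assumes "P \<noteq> 0 \<or> Q \<noteq> 0"
  shows "F p = quotient_point P Q \<longleftrightarrow> qform (a2 * Q - b2 * P) (a1 * Q - b1 * P) (a0 * Q - b0 * P) (px p) (py p) = 0"
proof -
  have "F p = quotient_point P Q \<longleftrightarrow> A (px p) (py p) * Q = P * B (px p) (py p)"
    unfolding F_def using AB_nonzero[OF px_py_nonzero] assms by (rule quotient_point_eq_iff)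
  also have "\<dots> \<longleftrightarrow> A (px p) (py p) * Q - P * B (px p) (py p) = 0" by simp
  also have "A (px p) (py p) * Q - P * B (px p) (py p) =
     qform (a2 * Q - b2 * P) (a1 * Q - b1 * P) (a0 * Q - b0 * P) (px p) (py p)"
    by (simp add: A_def B_def qform_def algebra_simps)
  finally show ?thesis .
qed

text \<open>Otherwise the coefficient vectors of \<open>A\<close> and \<open>B\<close> would be
  proportional.\<close>

lemma fibre_form_nonzero:
  assumes "P \<noteq> 0 \<or> Q \<noteq> 0"
  shows "a2 * Q - b2 * P \<noteq> 0 \<or> a1 * Q - b1 * P \<noteq> 0 \<or> a0 * Q - b0 * P \<noteq> 0"
proof (rule ccontr)
  assume "\<not> ?thesis"
  then have e: "a2 * Q = b2 * P" "a1 * Q = b1 * P" "a0 * Q = b0 * P" by auto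
  have "(a2 * b0 - a0 * b2) * Q = (a2 * Q) * b0 - (a0 * Q) * b2" by (simp add: algebra_simps)
  then have 1: "(a2 * b0 - a0 * b2) * Q = 0" unfolding e(1,3) by simp
  have "(a2 * b1 - a1 * b2) * Q = (a2 * Q) * b1 - (a1 * Q) * b2" by (simp add: algebra_simps)
  then have 2: "(a2 * b1 - a1 * b2) * Q = 0" unfolding e(1,2) by simp
  have "(a2 * b0 - a0 * b2) * P = a2 * (b0 * P) - a0 * (b2 * P)" by (simp add: algebra_simps)
  then have 3: "(a2 * b0 - a0 * b2) * P = 0" unfolding e(1,3)[symmetric] by simp
  have "(a2 * b1 - a1 * b2) * P = a2 * (b1 * P) - a1 * (b2 * P)" by (simp add: algebra_simps)
  then have 4: "(a2 * b1 - a1 * b2) * P = 0" unfolding e(1,2)[symmetric] by simp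
  have "a2 * b0 - a0 * b2 = 0" "a2 * b1 - a1 * b2 = 0" using 1 2 3 4 assms by auto
  then show False using res by simp
qed

lemma proj_line_eq_iff: "p = q \<longleftrightarrow> px p * py q - px q * py p = (0::'a)"
  by (cases p; cases q) auto

text \<open>With vanishing discriminant the polar form also vanishes between two points of the
  fibre. If they were distinct, they would span the plane and the fibre form would be zero.\<close>

lemma fibre_of_branch_point:
  assumes "D (px (F p)) (py (F p)) = 0" "F p = F q" shows "p = q"
proof (rule ccontr)
  assume "p \<noteq> q"
  define P where "P = px (F p)"
  define Q where "Q = py (F p)"
  define u v w where "u = a2 * Q - b2 * P" and "v = a1 * Q - b1 * P" and "w = a0 * Q - b0 * P"
  have PQ: "P \<noteq> 0 \<or> Q \<noteq> 0" unfolding P_def Q_def by (rule px_py_nonzero)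
  have "F p = quotient_point P Q" "F q = quotient_point P Q" by (simp_all add: P_def Q_def assms(2))
  then have z: "qform u v w (px p) (py p) = 0" "qform u v w (px q) (py q) = 0"
    using F_eq_iff[OF PQ] by (simp_all add: u_def v_def w_def)
  define bp where "bp = 2 * u * px p * px q + v * (px p * py q + px q * py p) + 2 * w * py p * py q"
  have d: "v\<^sup>2 - 4 * u * w = 0" using assms(1) by (simp add: D_def P_def Q_def u_def v_def w_def)
  have "bp\<^sup>2 = 0" unfolding bp_def qform_polar_identity z d by simp
  then have b: "bp = 0" by simp
  have det: "px p * py q - px q * py p \<noteq> 0" using \<open>p \<noteq> q\<close> proj_line_eq_iff[of p q] by blast
  have "u = 0 \<and> v = 0 \<and> w = 0"
  proof (cases p)
    case Infty
    then obtain y where q: "q = Fin y" using \<open>p \<noteq> q\<close> by (cases q) auto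
    have "u = 0" using z Infty by (simp add: qform_def)
    then have "v = 0" using b Infty q by (simp add: bp_def)
    then show ?thesis using z q \<open>u = 0\<close> by (simp add: qform_def)
  next
    case (Fin x)
    show ?thesis
    proof (cases q)
      case Infty
      have "u = 0" using z Infty by (simp add: qform_def)
      then have "v = 0" using b Infty Fin by (simp add: bp_def)
      then show ?thesis using z Fin \<open>u = 0\<close> by (simp add: qform_def)
    next
      case (Fin y)
      have ne: "x - y \<noteq> 0" using \<open>p \<noteq> q\<close> \<open>p = Fin x\<close> Fin by simp
      have zx: "u * x\<^sup>2 + v * x + w = 0" "u * y\<^sup>2 + v * y + w = 0"
        using z \<open>p = Fin x\<close> Fin by (simp_all add: qform_def)
      have bb: "2 * u * x * y + v * (x + y) + 2 * w = 0" using b \<open>p = Fin x\<close> Fin by (simp add: bp_def)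
      have "u * (x - y)\<^sup>2 = (u * x\<^sup>2 + v * x + w) + (u * y\<^sup>2 + v * y + w) - (2 * u * x * y + v * (x + y) + 2 * w)"
        by (simp add: power2_eq_square algebra_simps)
      then have u: "u = 0" using zx bb ne by simp
      have "v * (x - y) = (u * x\<^sup>2 + v * x + w) - (u * y\<^sup>2 + v * y + w)" using u by (simp add: algebra_simps)
      then have v: "v = 0" using zx ne by simp
      show ?thesis using u v zx by simp
    qed
  qed
  then show False using fibre_form_nonzero[OF PQ] by (simp add: u_def v_def w_def)
qed

lemma fibre_at_most_two:
  assumes "F p = v" "F q = v" "F z = v" "p \<noteq> q" shows "z = p \<or> z = q"
proof (rule ccontr)
  assume *: "\<not> ?thesis"
  define P where "P = px v"
  define Q where "Q = py v"
  define u v' w where "u = a2 * Q - b2 * P" and "v' = a1 * Q - b1 * P" and "w = a0 * Q - b0 * P"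
  have PQ: "P \<noteq> 0 \<or> Q \<noteq> 0" unfolding P_def Q_def by (rule px_py_nonzero)
  have zero: "qform u v' w (px r) (py r) = 0" if "F r = v" for r
    using F_eq_iff[OF PQ, of r] that by (simp add: u_def v'_def w_def P_def Q_def)
  \<comment> \<open>Among three distinct points at least two are finite, which reduces the positions
    of infinity to this one computation.\<close>
  have fin: "u = 0 \<and> v' = 0 \<and> w = 0"
    if d: "x \<noteq> y" "r \<noteq> Fin x" "r \<noteq> Fin y" and f: "F (Fin x) = v" "F (Fin y) = v" "F r = v" for x y r
  proof -
    have e: "u * x\<^sup>2 + v' * x + w = 0" "u * y\<^sup>2 + v' * y + w = 0"
      using zero[OF f(1)] zero[OF f(2)] by (simp_all add: qform_def)
    have "(x - y) * (u * (x + y) + v') = (u * x\<^sup>2 + v' * x + w) - (u * y\<^sup>2 + v' * y + w)"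
      by (simp add: power2_eq_square algebra_simps)
    then have s: "u * (x + y) + v' = 0" using e d by simp
    have "u = 0"
    proof (cases r)
      case Infty
      then show ?thesis using zero[OF f(3)] by (simp add: qform_def)
    next
      case (Fin r')
      have e3: "u * r'\<^sup>2 + v' * r' + w = 0" using zero[OF f(3)] Fin by (simp add: qform_def)
      have "(x - r') * (u * (x + r') + v') = (u * x\<^sup>2 + v' * x + w) - (u * r'\<^sup>2 + v' * r' + w)"
        by (simp add: power2_eq_square algebra_simps)
      then have "u * (x + r') + v' = 0" using e e3 d Fin by simp
      moreover have "u * (y - r') = (u * (x + y) + v') - (u * (x + r') + v')" by (simp add: algebra_simps)
      ultimately have "u * (y - r') = 0" using s by simp
      then show ?thesis using d Fin by simp
    qed
    then show ?thesis using s e by simp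
  qed
  have "u = 0 \<and> v' = 0 \<and> w = 0"
    using fin[of _ _ z] fin[of _ _ p] fin[of _ _ q] assms *
    by (cases p; cases q; cases z) auto
  then show False using fibre_form_nonzero[OF PQ] by (simp add: u_def v'_def w_def)
qed

text \<open>The fibre form has a double zero, at \<open>- v' / (2 u)\<close> or at infinity, so no
  square root has to be extracted; by \<open>D_AB\<close> this zero is critical.\<close>

lemma F_surj_on_branch:
  assumes "D (px v) (py v) = 0" shows "\<exists>p. F p = v \<and> J (px p) (py p) = 0"
proof -
  define P where "P = px v"
  define Q where "Q = py v"
  define u v' w where "u = a2 * Q - b2 * P" and "v' = a1 * Q - b1 * P" and "w = a0 * Q - b0 * P"
  have PQ: "P \<noteq> 0 \<or> Q \<noteq> 0" unfolding P_def Q_def by (rule px_py_nonzero)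
  have v: "v = quotient_point P Q" by (simp add: P_def Q_def)
  have d: "v'\<^sup>2 = 4 * u * w" using assms by (simp add: D_def P_def Q_def u_def v'_def w_def)
  have "\<exists>p. qform u v' w (px p) (py p) = 0"
  proof (cases "u = 0")
    case True
    then show ?thesis by (intro exI[of _ Infty]) (simp add: qform_def)
  next
    case False
    define x where "x = - v' / (2 * u)"
    have x: "2 * u * x = - v'" using False two by (simp add: x_def)
    have "4 * u * (u * x\<^sup>2 + v' * x + w) = (2 * u * x)\<^sup>2 + 2 * v' * (2 * u * x) + 4 * u * w"
      by (simp add: power2_eq_square algebra_simps)
    also have "\<dots> = 0" unfolding x d[symmetric] by (simp add: power2_eq_square)
    finally have "u * x\<^sup>2 + v' * x + w = 0" using four False by simp
    then show ?thesis by (intro exI[of _ "Fin x"]) (simp add: qform_def)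
  qed
  then obtain p where p: "F p = v" using F_eq_iff[OF PQ] v by (auto simp: u_def v'_def w_def)
  obtain k where k: "k \<noteq> 0" "A (px p) (py p) = k * P" "B (px p) (py p) = k * Q"
    using quotient_point_scale[OF AB_nonzero[OF px_py_nonzero, of p]] p
    unfolding F_def P_def Q_def by metis
  have "(J (px p) (py p))\<^sup>2 = k\<^sup>2 * D P Q" using k(2,3) D_scale D_AB by metis
  then show ?thesis using p assms by (auto simp: P_def Q_def)
qed

lemma D_F: "D (px (F p)) (py (F p)) = 0 \<longleftrightarrow> J (px p) (py p) = 0"
proof -
  obtain k where k: "k \<noteq> 0" "A (px p) (py p) = k * px (F p)" "B (px p) (py p) = k * py (F p)"
    using quotient_point_scale[OF AB_nonzero[OF px_py_nonzero, of p]] unfolding F_def by metis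
  have "(J (px p) (py p))\<^sup>2 = D (k * px (F p)) (k * py (F p))" unfolding D_AB[symmetric] k(2,3) ..
  then have "(J (px p) (py p))\<^sup>2 = k\<^sup>2 * D (px (F p)) (py (F p))" by (simp add: D_scale)
  then have "(J (px p) (py p))\<^sup>2 = 0 \<longleftrightarrow> D (px (F p)) (py (F p)) = 0" using k(1) by simp
  then show ?thesis by simp
qed

lemma D_quotient_point:
  assumes "x \<noteq> 0 \<or> y \<noteq> 0"
  shows "D (px (quotient_point x y)) (py (quotient_point x y)) = 0 \<longleftrightarrow> D x y = 0"
proof -
  obtain k where k: "k \<noteq> 0" "x = k * px (quotient_point x y)" "y = k * py (quotient_point x y)"
    using quotient_point_scale[OF assms] by blast
  have "D x y = k\<^sup>2 * D (px (quotient_point x y)) (py (quotient_point x y))"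
    by (subst k(2), subst k(3), rule D_scale)
  then show ?thesis using k(1) by simp
qed

end

section \<open>Lifting points to power series\<close>

text \<open>Comparing coefficients of degree \<open>n > 0\<close> in \<open>g^2 = f\<close> is a
  linear equation for the coefficient of \<open>g\<close> of degree \<open>n\<close>, with factor
  \<open>2 * r\<close>.\<close>

function fps_sqrt_coeff :: "'a::field fps \<Rightarrow> 'a \<Rightarrow> nat \<Rightarrow> 'a" where
  "fps_sqrt_coeff f r n = (if n = 0 then r else
     (f $ n - (\<Sum>i\<in>{1..<n}. fps_sqrt_coeff f r i * fps_sqrt_coeff f r (n - i))) / (2 * r))"
  by pat_completeness auto
termination by (relation "measure (\<lambda>(f, r, n). n)") auto

declare fps_sqrt_coeff.simps [simp del]

lemma fps_sqrt_exists:
  fixes f :: "'a::field fps"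
  assumes two: "(2::'a) \<noteq> 0" and r: "r\<^sup>2 = f $ 0" "r \<noteq> 0"
  shows "\<exists>g. g\<^sup>2 = f"
proof -
  define g where "g = Abs_fps (fps_sqrt_coeff f r)"
  have g0: "g $ 0 = r" by (simp add: g_def fps_sqrt_coeff.simps)
  have gn: "2 * r * g $ n = f $ n - (\<Sum>i\<in>{1..<n}. g $ i * g $ (n - i))" if "n > 0" for n
    using that two r by (simp add: g_def fps_sqrt_coeff.simps[of f r n])
  have "(g * g) $ n = f $ n" for n
  proof (cases "n = 0")
    case True
    then show ?thesis using g0 r by (simp add: power2_eq_square)
  next
    case False
    have "(g * g) $ n = (\<Sum>i\<in>{0..n}. g $ i * g $ (n - i))" by (simp add: fps_mult_nth)
    also have "{0..n} = insert 0 (insert n {1..<n})" using False by auto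
    also have "(\<Sum>i\<in>\<dots>. g $ i * g $ (n - i)) = 2 * r * g $ n + (\<Sum>i\<in>{1..<n}. g $ i * g $ (n - i))"
      using False g0 by (simp add: algebra_simps)
    also have "\<dots> = f $ n" using gn False by simp
    finally show ?thesis .
  qed
  then show ?thesis by (intro exI[of _ g]) (simp add: power2_eq_square fps_eq_iff)
qed

lemma fps_to_fls_mult: "fps_to_fls (f * g :: 'a::field fps) = fps_to_fls f * fps_to_fls g"
  by (rule fls_times_fps_to_fls)

text \<open>A Laurent series \<open>z\<close>, regarded as a point of the projective line over the power series ring
  with coordinates \<open>(P, Q)\<close>, which is nonconstant modulo the square of the variable.\<close>

definition unram_rep :: "'a::field fls \<Rightarrow> 'a fps \<Rightarrow> 'a fps \<Rightarrow> bool" where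
  "unram_rep z P Q \<longleftrightarrow> fps_to_fls P = z * fps_to_fls Q \<and> (P $ 0 \<noteq> 0 \<or> Q $ 0 \<noteq> 0) \<and>
     P $ 1 * Q $ 0 - P $ 0 * Q $ 1 \<noteq> 0"

definition unram_red :: "'a::field fls \<Rightarrow> 'a proj_line \<Rightarrow> bool" where
  "unram_red z p \<longleftrightarrow> (\<exists>P Q. unram_rep z P Q \<and> p = quotient_point (P $ 0) (Q $ 0))"

lemma unram_rep_Q: "unram_rep z P Q \<Longrightarrow> fps_to_fls Q \<noteq> 0"
  by (auto simp: unram_rep_def)

context quadratic_map
begin

text \<open>\<open>alpha\<close>, \<open>beta\<close>, \<open>gamma\<close> are the coefficients of
  the fibre equation over a Laurent series \<open>y\<close>. The versions with suffix
  \<open>P\<close> use homogeneous coordinates of \<open>y\<close> and are power series, so they can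
  be reduced.\<close>

definition "alpha y = fls_const a2 - fls_const b2 * y"
definition "beta y = fls_const a1 - fls_const b1 * y"
definition "gamma y = fls_const a0 - fls_const b0 * y"
definition "disc y = (beta y)\<^sup>2 - 4 * alpha y * gamma y"
definition "alphaP P Q = fps_const a2 * Q - fps_const b2 * P"
definition "betaP P Q = fps_const a1 * Q - fps_const b1 * P"
definition "gammaP P Q = fps_const a0 * Q - fps_const b0 * P"
definition "discP P Q = (betaP P Q)\<^sup>2 - 4 * alphaP P Q * gammaP P Q"

lemma rep_scaled:
  assumes "unram_rep y P Q"
  shows "fps_to_fls (alphaP P Q) = alpha y * fps_to_fls Q" "fps_to_fls (betaP P Q) = beta y * fps_to_fls Q"
    "fps_to_fls (gammaP P Q) = gamma y * fps_to_fls Q" "fps_to_fls (discP P Q) = disc y * (fps_to_fls Q)\<^sup>2"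
proof -
  have P: "fps_to_fls P = y * fps_to_fls Q" using assms by (simp add: unram_rep_def)
  show 1: "fps_to_fls (alphaP P Q) = alpha y * fps_to_fls Q" "fps_to_fls (betaP P Q) = beta y * fps_to_fls Q"
    "fps_to_fls (gammaP P Q) = gamma y * fps_to_fls Q"
    by (simp_all add: alphaP_def betaP_def gammaP_def alpha_def beta_def gamma_def fps_to_fls_mult P algebra_simps)
  show "fps_to_fls (discP P Q) = disc y * (fps_to_fls Q)\<^sup>2"
    by (simp add: discP_def disc_def fps_to_fls_mult power2_eq_square 1 algebra_simps)
qed

lemma discP_0: "discP P Q $ 0 = D (P $ 0) (Q $ 0)"
  by (simp add: discP_def alphaP_def betaP_def gammaP_def D_def power2_eq_square fps_numeral_nth_0)

text \<open>The constant term of the equation says that reduction commutes with \<open>F\<close>. If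
  the lift were constant to first order, its first-order term would be a multiple of its value; as
  \<open>A\<close> and \<open>B\<close> are homogeneous, the same would hold for
  \<open>(P, Q)\<close>.\<close>

lemma wronskian_lift:
  assumes PQ: "P $ 0 \<noteq> 0 \<or> Q $ 0 \<noteq> 0" "P $ 1 * Q $ 0 - P $ 0 * Q $ 1 \<noteq> 0"
    and Z: "X $ 0 \<noteq> 0 \<or> Y $ 0 \<noteq> 0"
    and zero: "alphaP P Q * X\<^sup>2 + betaP P Q * X * Y + gammaP P Q * Y\<^sup>2 = 0"
  shows "X $ 1 * Y $ 0 - X $ 0 * Y $ 1 \<noteq> 0"
    and "F (quotient_point (X $ 0) (Y $ 0)) = quotient_point (P $ 0) (Q $ 0)"
proof -
  define x y x' y' p q p' q' where d: "x = X $ 0" "y = Y $ 0" "x' = X $ 1" "y' = Y $ 1"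
    "p = P $ 0" "q = Q $ 0" "p' = P $ 1" "q' = Q $ 1"
  have c0: "(alphaP P Q * X\<^sup>2 + betaP P Q * X * Y + gammaP P Q * Y\<^sup>2) $ 0 = A x y * q - p * B x y"
    by (simp add: alphaP_def betaP_def gammaP_def A_def B_def qform_def power2_eq_square d algebra_simps)
  define A' where "A' = 2 * a2 * x * x' + a1 * (x * y' + x' * y) + 2 * a0 * y * y'"
  define B' where "B' = 2 * b2 * x * x' + b1 * (x * y' + x' * y) + 2 * b0 * y * y'"
  have c1: "(alphaP P Q * X\<^sup>2 + betaP P Q * X * Y + gammaP P Q * Y\<^sup>2) $ 1 =
      A' * q + A x y * q' - p' * B x y - p * B'"
    by (simp add: alphaP_def betaP_def gammaP_def A_def B_def A'_def B'_def qform_def power2_eq_square d algebra_simps)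
  have e0: "A x y * q = p * B x y" using c0 unfolding zero by simp
  have e1: "A' * q + A x y * q' = p' * B x y + p * B'" using c1 unfolding zero
    by (simp add: algebra_simps eq_diff_eq)
  have xy: "x \<noteq> 0 \<or> y \<noteq> 0" and pq: "p \<noteq> 0 \<or> q \<noteq> 0" using Z PQ by (simp_all add: d)
  have F: "quotient_point (A x y) (B x y) = quotient_point p q"
    using quotient_point_eq_iff[OF AB_nonzero[OF xy] pq] e0 by simp
  then show "F (quotient_point (X $ 0) (Y $ 0)) = quotient_point (P $ 0) (Q $ 0)"
    using F_quotient_point[OF xy] by (simp add: d)
  show "X $ 1 * Y $ 0 - X $ 0 * Y $ 1 \<noteq> 0"
  proof
    assume "X $ 1 * Y $ 0 - X $ 0 * Y $ 1 = 0"
    then have w: "x' * y = x * y'" by (simp add: d)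
    define l where "l = (if y = 0 then x' / x else y' / y)"
    have l: "x' = l * x" "y' = l * y" using w xy by (auto simp: l_def field_simps)
    have "A' = 2 * l * A x y" "B' = 2 * l * B x y"
      unfolding A'_def B'_def l A_def B_def qform_def by (simp_all add: power2_eq_square algebra_simps)
    then have "A x y * q' + 2 * l * (A x y * q) = p' * B x y + 2 * l * (p * B x y)"
      using e1 by (simp add: algebra_simps)
    then have e2: "A x y * q' = p' * B x y" using e0 by simp
    have "A x y * (p' * q - p * q') = 0" "B x y * (p' * q - p * q') = 0"
    proof -
      have "A x y * (p' * q - p * q') = p' * (A x y * q) - p * (A x y * q')" by (simp add: algebra_simps)
      then show "A x y * (p' * q - p * q') = 0" unfolding e0 e2 by simp
      have "B x y * (p' * q - p * q') = q * (p' * B x y) - q' * (p * B x y)" by (simp add: algebra_simps)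
      then show "B x y * (p' * q - p * q') = 0" unfolding e0[symmetric] e2[symmetric] by simp
    qed
    then have "p' * q - p * q' = 0" using AB_nonzero[OF xy] by auto
    then show False using PQ(2) by (simp add: d)
  qed
qed

text \<open>The last two equations record which square root of the discriminant belongs to
  \<open>z\<close>; they will separate the two reductions over one point.\<close>

lemma lift_root:
  assumes rep: "unram_rep y P Q" and D: "D (P $ 0) (Q $ 0) \<noteq> 0"
    and S: "S\<^sup>2 = disc y" and d: "fps_to_fls d = S * fps_to_fls Q"
    and al: "alpha y \<noteq> 0" and z: "2 * alpha y * z = - beta y + S"
  shows "\<exists>X Y. unram_rep z X Y \<and> F (quotient_point (X $ 0) (Y $ 0)) = quotient_point (P $ 0) (Q $ 0) \<and>
     2 * (alphaP P Q $ 0) * X $ 0 + betaP P Q $ 0 * Y $ 0 = d $ 0 * Y $ 0 \<and>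
     2 * (gammaP P Q $ 0) * Y $ 0 + betaP P Q $ 0 * X $ 0 = - d $ 0 * X $ 0"
proof -
  define a b c where abc: "a = alphaP P Q" "b = betaP P Q" "c = gammaP P Q"
  have Q0: "fps_to_fls Q \<noteq> 0" by (rule unram_rep_Q[OF rep])
  have PQ: "P $ 0 \<noteq> 0 \<or> Q $ 0 \<noteq> 0" "P $ 1 * Q $ 0 - P $ 0 * Q $ 1 \<noteq> 0"
    using rep by (simp_all add: unram_rep_def)
  have "fps_to_fls (d\<^sup>2) = fps_to_fls (discP P Q)"
    unfolding rep_scaled(4)[OF rep] S[symmetric] by (simp add: power2_eq_square fps_to_fls_mult d)
  then have "d\<^sup>2 = discP P Q" by (rule fps_to_fls_eq_imp_fps_eq)
  then have dd: "d\<^sup>2 = b\<^sup>2 - 4 * a * c" by (simp add: discP_def abc)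
  have "(d $ 0)\<^sup>2 = D (P $ 0) (Q $ 0)" using arg_cong[OF dd, of "\<lambda>f. f $ 0"] discP_0[of P Q]
    by (simp add: discP_def abc power2_eq_square)
  then have d0: "d $ 0 \<noteq> 0" using D by auto
  have 1: "2 * fps_to_fls a * z = - fps_to_fls b + fps_to_fls d"
    using arg_cong[OF z, of "\<lambda>w. w * fps_to_fls Q"]
    by (simp add: abc rep_scaled[OF rep] d algebra_simps)
  have a0: "fps_to_fls a \<noteq> 0" using al Q0 by (simp add: abc rep_scaled(1)[OF rep])
  have "2 * fps_to_fls a * ((- fps_to_fls b - fps_to_fls d) * z) =
      (- fps_to_fls b - fps_to_fls d) * (2 * fps_to_fls a * z)" by (simp add: algebra_simps)
  also have "\<dots> = fps_to_fls (b\<^sup>2 - d\<^sup>2)"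
    unfolding 1 by (simp add: fps_to_fls_mult power2_eq_square algebra_simps)
  also have "\<dots> = 2 * fps_to_fls a * (2 * fps_to_fls c)" unfolding dd by (simp add: fps_to_fls_mult)
  finally have "2 * fps_to_fls a * ((- fps_to_fls b - fps_to_fls d) * z) = 2 * fps_to_fls a * (2 * fps_to_fls c)" .
  moreover have two': "(2 :: 'a fls) \<noteq> 0" using two by (metis fls_const_eq_0_iff fls_const_numeral)
  then have "2 * fps_to_fls a \<noteq> 0" using a0 by simp
  ultimately have 2: "(- fps_to_fls b - fps_to_fls d) * z = 2 * fps_to_fls c"
    by (metis mult_left_cancel)
  have ex: "\<exists>X Y. fps_to_fls X = z * fps_to_fls Y \<and> (X $ 0 \<noteq> 0 \<or> Y $ 0 \<noteq> 0) \<and>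
      a * X\<^sup>2 + b * X * Y + c * Y\<^sup>2 = 0"
  \<comment> \<open>The root has the coordinates \<open>(- b + d, 2 a)\<close> and also
    \<open>(2 c, - b - d)\<close>. The entries \<open>- b + d\<close> and \<open>- b - d\<close>
    differ by \<open>2 d\<close>, whose constant term is nonzero, so one of the two representations
    can be reduced.\<close>
  proof (cases "(- b - d) $ 0 = 0")
    case False
    have "a * (2 * c)\<^sup>2 + b * (2 * c) * (- b - d) + c * (- b - d)\<^sup>2 = c * (4 * a * c - b\<^sup>2 + d\<^sup>2)"
      by (simp add: power2_eq_square algebra_simps)
    then have "a * (2 * c)\<^sup>2 + b * (2 * c) * (- b - d) + c * (- b - d)\<^sup>2 = 0" unfolding dd by simp
    moreover have "fps_to_fls (2 * c) = z * fps_to_fls (- b - d)"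
      using 2 by (simp add: fps_to_fls_mult mult.commute)
    ultimately show ?thesis using False by blast
  next
    case True
    have "(- b + d) $ 0 = (- b - d) $ 0 + 2 * d $ 0" by simp
    then have "(- b + d) $ 0 = 2 * d $ 0" unfolding True by simp
    then have nz: "(- b + d) $ 0 \<noteq> 0" using d0 two by (simp only: mult_eq_0_iff) simp
    have "a * (- b + d)\<^sup>2 + b * (- b + d) * (2 * a) + c * (2 * a)\<^sup>2 = a * (d\<^sup>2 - b\<^sup>2 + 4 * a * c)"
      by (simp add: power2_eq_square algebra_simps)
    then have "a * (- b + d)\<^sup>2 + b * (- b + d) * (2 * a) + c * (2 * a)\<^sup>2 = 0" unfolding dd by simp
    moreover have "fps_to_fls (- b + d) = z * fps_to_fls (2 * a)"
      using 1 by (simp add: fps_to_fls_mult mult.commute mult.left_commute)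
    ultimately show ?thesis using nz by blast
  qed
  then obtain X Y where XY: "fps_to_fls X = z * fps_to_fls Y" "X $ 0 \<noteq> 0 \<or> Y $ 0 \<noteq> 0"
    "a * X\<^sup>2 + b * X * Y + c * Y\<^sup>2 = 0" by blast
  note w = wronskian_lift[OF PQ XY(2) XY(3)[unfolded abc]]
  have "fps_to_fls (2 * a * X + b * Y) = (2 * fps_to_fls a * z + fps_to_fls b) * fps_to_fls Y"
    by (simp add: fps_to_fls_mult XY(1) algebra_simps)
  also have "\<dots> = fps_to_fls (d * Y)" unfolding 1 by (simp add: fps_to_fls_mult)
  finally have r1: "2 * a * X + b * Y = d * Y" by (rule fps_to_fls_eq_imp_fps_eq)
  have "fps_to_fls (2 * c * Y + b * X) = (2 * fps_to_fls c + fps_to_fls b * z) * fps_to_fls Y"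
    by (simp add: fps_to_fls_mult XY(1) algebra_simps)
  also have "\<dots> = fps_to_fls (- d * X)" unfolding 2[symmetric] by (simp add: fps_to_fls_mult XY(1) algebra_simps)
  finally have r2: "2 * c * Y + b * X = - d * X" by (rule fps_to_fls_eq_imp_fps_eq)
  have "unram_rep z X Y" using XY w by (simp add: unram_rep_def)
  moreover have "2 * (a $ 0) * X $ 0 + b $ 0 * Y $ 0 = d $ 0 * Y $ 0"
    using arg_cong[OF r1, of "\<lambda>f. f $ 0"] by simp
  moreover have "2 * (c $ 0) * Y $ 0 + b $ 0 * X $ 0 = - d $ 0 * X $ 0"
    using arg_cong[OF r2, of "\<lambda>f. f $ 0"] by simp
  ultimately show ?thesis using w(2) unfolding abc by blast
qed

context
  assumes sqrt_ex: "\<And>x::'a. \<exists>r. r\<^sup>2 = x"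
begin

lemma fps_sqrt:
  fixes f :: "'a fps" assumes "f $ 0 \<noteq> 0" shows "\<exists>g. g\<^sup>2 = f"
proof -
  obtain r where r: "r\<^sup>2 = f $ 0" using sqrt_ex by blast
  then have "r \<noteq> 0" using assms by auto
  then show ?thesis using fps_sqrt_exists[OF two r] by blast
qed

lemma disc_square:
  assumes rep: "unram_rep y P Q" and D: "D (P $ 0) (Q $ 0) \<noteq> 0"
  shows "\<exists>S. S\<^sup>2 = disc y"
proof -
  obtain d where d: "d\<^sup>2 = discP P Q" using fps_sqrt D discP_0 by metis
  have "(fps_to_fls d / fps_to_fls Q)\<^sup>2 = disc y"
    using unram_rep_Q[OF rep] rep_scaled(4)[OF rep] d
    by (simp add: power_divide power2_eq_square flip: fps_to_fls_mult)
  then show ?thesis by blast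
qed

text \<open>The two reductions satisfy the linear equations of \<open>lift_root\<close> with
  opposite signs of \<open>d'\<close>. A common reduction would have both coordinates annihilated by
  \<open>2 * d' $ 0\<close>.\<close>

lemma lift_fibre:
  assumes rep: "unram_rep y P Q" and D: "D (P $ 0) (Q $ 0) \<noteq> 0"
    and S: "S\<^sup>2 = disc y" and al: "alpha y \<noteq> 0"
    and z0: "2 * alpha y * z0 = - beta y + S" and z1: "2 * alpha y * z1 = - beta y - S"
  shows "\<exists>p0 p1. unram_red z0 p0 \<and> unram_red z1 p1 \<and> F p0 = quotient_point (P $ 0) (Q $ 0) \<and>
     F p1 = quotient_point (P $ 0) (Q $ 0) \<and> p0 \<noteq> p1"
proof -
  obtain d where d: "d\<^sup>2 = discP P Q" using fps_sqrt D discP_0 by metis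
  have "(S * fps_to_fls Q)\<^sup>2 = (fps_to_fls d)\<^sup>2"
    using rep_scaled(4)[OF rep] d S by (simp add: power_mult_distrib flip: fps_to_fls_power)
  then have "S * fps_to_fls Q = fps_to_fls d \<or> S * fps_to_fls Q = fps_to_fls (- d)"
    using power2_eq_iff by fastforce
  then obtain d' where d': "fps_to_fls d' = S * fps_to_fls Q" by metis
  then have dm: "fps_to_fls (- d') = (- S) * fps_to_fls Q" by simp
  have S': "(- S)\<^sup>2 = disc y" "2 * alpha y * z1 = - beta y + (- S)" using S z1 by simp_all
  have "fps_to_fls (d'\<^sup>2) = fps_to_fls (discP P Q)"
    unfolding rep_scaled(4)[OF rep] S[symmetric] by (simp add: power2_eq_square fps_to_fls_mult d')
  then have "d'\<^sup>2 = discP P Q" by (rule fps_to_fls_eq_imp_fps_eq)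
  then have "(d' $ 0)\<^sup>2 = D (P $ 0) (Q $ 0)" unfolding discP_0[symmetric] by (simp add: power2_eq_square flip: \<open>d'\<^sup>2 = discP P Q\<close>)
  then have d0: "d' $ 0 \<noteq> 0" using D by auto
  obtain X Y where XY: "unram_rep z0 X Y" "F (quotient_point (X $ 0) (Y $ 0)) = quotient_point (P $ 0) (Q $ 0)"
     "2 * (alphaP P Q $ 0) * X $ 0 + betaP P Q $ 0 * Y $ 0 = d' $ 0 * Y $ 0"
     "2 * (gammaP P Q $ 0) * Y $ 0 + betaP P Q $ 0 * X $ 0 = - d' $ 0 * X $ 0"
    using lift_root[OF rep D S d' al z0] by blast
  obtain X' Y' where XY': "unram_rep z1 X' Y'" "F (quotient_point (X' $ 0) (Y' $ 0)) = quotient_point (P $ 0) (Q $ 0)"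
     "2 * (alphaP P Q $ 0) * X' $ 0 + betaP P Q $ 0 * Y' $ 0 = (- d') $ 0 * Y' $ 0"
     "2 * (gammaP P Q $ 0) * Y' $ 0 + betaP P Q $ 0 * X' $ 0 = - (- d') $ 0 * X' $ 0"
    using lift_root[OF rep D S'(1) dm al S'(2)] by blast
  have nz: "X $ 0 \<noteq> 0 \<or> Y $ 0 \<noteq> 0" "X' $ 0 \<noteq> 0 \<or> Y' $ 0 \<noteq> 0" using XY XY' by (auto simp: unram_rep_def)
  have "quotient_point (X $ 0) (Y $ 0) \<noteq> quotient_point (X' $ 0) (Y' $ 0)"
  proof
    assume "quotient_point (X $ 0) (Y $ 0) = quotient_point (X' $ 0) (Y' $ 0)"
    then obtain k k' p q where k: "k \<noteq> 0" "k' \<noteq> 0" "X $ 0 = k * p" "Y $ 0 = k * q" "X' $ 0 = k' * p" "Y' $ 0 = k' * q"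
      using quotient_point_scale[OF nz(1)] quotient_point_scale[OF nz(2)] by metis
    have "k * (2 * (alphaP P Q $ 0) * p + betaP P Q $ 0 * q - d' $ 0 * q) = 0"
      "k' * (2 * (alphaP P Q $ 0) * p + betaP P Q $ 0 * q + d' $ 0 * q) = 0"
      "k * (2 * (gammaP P Q $ 0) * q + betaP P Q $ 0 * p + d' $ 0 * p) = 0"
      "k' * (2 * (gammaP P Q $ 0) * q + betaP P Q $ 0 * p - d' $ 0 * p) = 0"
      using XY(3,4) XY'(3,4) unfolding k(3-6) by (simp_all add: algebra_simps)
    then have e: "2 * (alphaP P Q $ 0) * p + betaP P Q $ 0 * q - d' $ 0 * q = 0"
      "2 * (alphaP P Q $ 0) * p + betaP P Q $ 0 * q + d' $ 0 * q = 0"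
      "2 * (gammaP P Q $ 0) * q + betaP P Q $ 0 * p + d' $ 0 * p = 0"
      "2 * (gammaP P Q $ 0) * q + betaP P Q $ 0 * p - d' $ 0 * p = 0"
      using k(1,2) mult_eq_0_iff by blast+
    have "2 * (d' $ 0 * q) = (2 * (alphaP P Q $ 0) * p + betaP P Q $ 0 * q + d' $ 0 * q) -
        (2 * (alphaP P Q $ 0) * p + betaP P Q $ 0 * q - d' $ 0 * q)"
      "2 * (d' $ 0 * p) = (2 * (gammaP P Q $ 0) * q + betaP P Q $ 0 * p + d' $ 0 * p) -
        (2 * (gammaP P Q $ 0) * q + betaP P Q $ 0 * p - d' $ 0 * p)"
      by (simp_all add: algebra_simps)
    then have "2 * (d' $ 0 * q) = 0" "2 * (d' $ 0 * p) = 0" unfolding e by simp_all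
    then have "p = 0" "q = 0" using d0 two by auto
    then show False using k nz by simp
  qed
  then show ?thesis using XY(1,2) XY'(1,2) unfolding unram_red_def by blast
qed

text \<open>The linear coefficient of \<open>discP\<close> is the polar form of \<open>D\<close>
  between value and first-order term of the point. Where \<open>D\<close> vanishes, the polar
  identity turns its square into the discriminant of \<open>D\<close> times the squared determinant
  from \<open>unram_rep\<close>.\<close>

lemma discP_simple_zero:
  assumes rep: "unram_rep y P Q" and D: "D (P $ 0) (Q $ 0) = 0"
  shows "\<exists>g. discP P Q = fps_X * g \<and> g $ 0 \<noteq> 0"
proof -
  define u v w where uvw: "u = b1\<^sup>2 - 4 * b2 * b0" "v = 4 * a2 * b0 + 4 * a0 * b2 - 2 * a1 * b1"
    "w = a1\<^sup>2 - 4 * a2 * a0"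
  define p q p' q' where d: "p = P $ 0" "q = Q $ 0" "p' = P $ 1" "q' = Q $ 1"
  have c1: "discP P Q $ 1 = 2 * u * p * p' + v * (p * q' + p' * q) + 2 * w * q * q'"
    by (simp add: discP_def alphaP_def betaP_def gammaP_def uvw d power2_eq_square algebra_simps fps_numeral_nth)
  have "(discP P Q $ 1)\<^sup>2 = 4 * qform u v w p q * qform u v w p' q' + (v\<^sup>2 - 4 * u * w) * (p * q' - p' * q)\<^sup>2"
    unfolding c1 by (rule qform_polar_identity)
  moreover have "qform u v w p q = 0" using D D_qform[of p q] by (simp add: uvw d)
  moreover have "v\<^sup>2 - 4 * u * w \<noteq> 0"
    unfolding uvw D_disc using res four
    by (metis (no_types, lifting) mult_eq_0_iff numeral_Bit0 numeral_times_numeral semiring_norm(12) semiring_norm(13) semiring_norm(11))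
  moreover have "p * q' - p' * q \<noteq> 0"
  proof
    assume "p * q' - p' * q = 0"
    then have "p' * q - p * q' = 0" by simp
    then show False using rep by (simp add: unram_rep_def d)
  qed
  ultimately have "(discP P Q $ 1)\<^sup>2 \<noteq> 0" by simp
  then have n1: "discP P Q $ 1 \<noteq> 0" by auto
  have n0: "discP P Q $ 0 = 0" using D by (simp add: discP_0)
  have "discP P Q = fps_X * fps_shift 1 (discP P Q)"
    by (rule fps_ext) (use n0 in \<open>auto\<close>)
  then show ?thesis using n1 by (intro exI[of _ "fps_shift 1 (discP P Q)"]) simp
qed

text \<open>Up to a square factor the discriminant has order one, whereas squares have even
  order.\<close>

lemma disc_not_square:
  assumes rep: "unram_rep y P Q" and D: "D (P $ 0) (Q $ 0) = 0"
  shows "S\<^sup>2 \<noteq> disc y"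
proof
  assume S: "S\<^sup>2 = disc y"
  obtain g where g: "discP P Q = fps_X * g" "g $ 0 \<noteq> 0" using discP_simple_zero[OF rep D] by blast
  define T where "T = S * fps_to_fls Q"
  have T: "T * T = fps_to_fls (fps_X * g)"
    using rep_scaled(4)[OF rep] S g by (simp add: T_def power2_eq_square algebra_simps)
  have "subdegree (fps_X * g) = 1" using g(2) by (intro subdegreeI) (auto simp: numeral_eq_Suc)
  then have "fls_subdegree (T * T) = 1" unfolding T by (simp add: fls_subdegree_fls_to_fps)
  moreover have "T \<noteq> 0" using T g by auto
  ultimately have "2 * fls_subdegree T = 1" by simp
  then show False by presburger
qed

text \<open>Two simple zeros give even order, and the remaining unit has a square root.\<close>

lemma disc_product_square:
  assumes rep: "unram_rep y P Q" "unram_rep y' P' Q'" and D: "D (P $ 0) (Q $ 0) = 0" "D (P' $ 0) (Q' $ 0) = 0"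
  shows "\<exists>S. S\<^sup>2 = disc y * disc y'"
proof -
  obtain g where g: "discP P Q = fps_X * g" "g $ 0 \<noteq> 0" using discP_simple_zero[OF rep(1) D(1)] by blast
  obtain g' where g': "discP P' Q' = fps_X * g'" "g' $ 0 \<noteq> 0" using discP_simple_zero[OF rep(2) D(2)] by blast
  obtain h where h: "h\<^sup>2 = g * g'" using fps_sqrt[of "g * g'"] g g' by auto
  let ?Q = "fps_to_fls Q" and ?Q' = "fps_to_fls Q'"
  have "(fps_to_fls (fps_X * h))\<^sup>2 = fps_to_fls (discP P Q * discP P' Q')"
    unfolding fps_to_fls_power[symmetric] g(1) g'(1) power_mult_distrib h by (simp only: power2_eq_square mult_ac)
  also have "\<dots> = disc y * disc y' * (?Q * ?Q')\<^sup>2"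
    by (simp add: fps_to_fls_mult rep_scaled(4)[OF rep(1)] rep_scaled(4)[OF rep(2)] power_mult_distrib)
  finally have "(fps_to_fls (fps_X * h) / (?Q * ?Q'))\<^sup>2 = disc y * disc y'"
    using unram_rep_Q[OF rep(1)] unram_rep_Q[OF rep(2)] by (simp add: power_divide)
  then show ?thesis by blast
qed

end

end

section \<open>The Galois action on the tree of preimages\<close>

lemma field_hom_const_emb:
  fixes \<iota> :: "'k::field poly fract \<Rightarrow> 'l::field"
  assumes "field_hom \<iota>" shows "field_hom (const_emb \<iota>)"
  unfolding field_hom_def
proof (intro conjI allI)
  have h: "\<iota> 1 = 1" "\<iota> (x + y) = \<iota> x + \<iota> y" "\<iota> (x * y) = \<iota> x * \<iota> y" for x y
    using assms by (auto simp: field_hom_def)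
  show "const_emb \<iota> 1 = 1" using h(1) by (simp add: const_emb_def One_fract_def[symmetric] one_pCons[symmetric])
  show "const_emb \<iota> (x + y) = const_emb \<iota> x + const_emb \<iota> y" for x y
    unfolding const_emb_def h(2)[symmetric] by simp
  show "const_emb \<iota> (x * y) = const_emb \<iota> x * const_emb \<iota> y" for x y
    unfolding const_emb_def h(3)[symmetric] by (simp add: mult.commute)
qed

locale iterated_map = quadratic_map a0 a1 a2 b0 b1 b2
  for a0 a1 a2 b0 b1 b2 :: "'l::field" +
  fixes \<iota> :: "'k::field poly fract \<Rightarrow> 'l" and \<phi> :: "vertex \<Rightarrow> nat \<times> 'l proj_line"
  assumes sc: "is_separable_closure \<iota>"
    and coeffs: "{a0, a1, a2, b0, b1, b2} \<subseteq> range (const_emb \<iota>)"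
    and tree: "tree_identification F (Fin (t_elem \<iota>)) \<phi>"
begin

abbreviation "c \<equiv> const_emb \<iota>"
abbreviation "t \<equiv> t_elem \<iota>"
text \<open>This subfield contains \<open>const_closure\<close>, so automorphisms fixing it and
  \<open>t\<close> are geometric.\<close>

definition "Alg = {x. algebraic_over c x}"

lemma \<iota>_hom: "hom_on UNIV \<iota>"
  using sc by (simp add: is_separable_closure_def field_hom_iff)

lemmas \<iota>_simps = hom_onD[OF \<iota>_hom, simplified] hom_on_0[OF subfield_set_UNIV \<iota>_hom]
  hom_on_eq_0[OF subfield_set_UNIV \<iota>_hom, simplified] hom_on_divide[OF subfield_set_UNIV \<iota>_hom, simplified]

lemma c_hom: "field_hom c"
  using sc by (intro field_hom_const_emb) (simp add: is_separable_closure_def)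

lemma poly_c_t: "poly (map_poly c p) t = \<iota> (Fract p 1)"
proof (induction p)
  case 0
  then show ?case by (simp add: \<iota>_simps Zero_fract_def[symmetric])
next
  case (pCons a p)
  have "\<iota> (Fract (pCons a p) 1) = c a + t * \<iota> (Fract p 1)"
    unfolding const_emb_def t_elem_def \<iota>_simps(2,3)[symmetric] by simp
  then show ?case using pCons by (simp add: map_poly_pCons' field_hom_simps[OF c_hom])
qed

lemma t_notin_Alg: "t \<notin> Alg"
proof
  assume "t \<in> Alg"
  then obtain p where p: "p \<noteq> 0" "poly (map_poly c p) t = 0" by (auto simp: Alg_def algebraic_over_def)
  then have "Fract p 1 = 0" by (simp add: poly_c_t \<iota>_simps)
  then show False using p by (simp add: Zero_fract_def eq_fract)
qed

lemma range_\<iota>_subset: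
  assumes E: "subfield_set E" "range c \<subseteq> E" "t \<in> E" shows "range \<iota> \<subseteq> E"
proof
  fix x assume "x \<in> range \<iota>"
  then obtain z where z: "x = \<iota> z" by blast
  obtain p q where pq: "z = Fract p q" "q \<noteq> 0" by (cases z) auto
  have m: "map_poly c r \<in> polys_over E" for r
    using E by (auto simp: polys_over_def coeff_map_poly field_hom_simps[OF c_hom])
  have "z = Fract p 1 / Fract q 1" using pq by simp
  then have "x = poly (map_poly c p) t / poly (map_poly c q) t"
    unfolding z poly_c_t \<iota>_simps(6)[symmetric] by simp
  then show "x \<in> E" using m E by (simp add: subfield_set_more[OF E(1)] poly_over_mem[OF E(1)])
qed

lemma subfield_Alg: "subfield_set Alg"
  unfolding Alg_def by (rule subfield_set_algebraic[OF c_hom])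

lemma range_c_Alg: "range c \<subseteq> Alg"
  using algebraic_over_const[OF c_hom] by (auto simp: Alg_def)

lemma const_closure_Alg: "const_closure \<iota> \<subseteq> Alg"
proof
  fix x assume "x \<in> const_closure \<iota>"
  then obtain p where p: "separable_poly p" "poly (map_poly c p) x = 0"
    by (auto simp: const_closure_def separable_over_def)
  then have "p \<noteq> 0" by (auto simp: separable_poly_def)
  then show "x \<in> Alg" using p by (auto simp: Alg_def algebraic_over_def)
qed

lemma range_c_const_closure: "range c \<subseteq> const_closure \<iota>"
proof
  fix x assume "x \<in> range c"
  then obtain a where a: "x = c a" by blast
  have "separable_poly [:- a, 1:]"
    unfolding separable_poly_def by (simp add: pderiv_pCons one_pCons[symmetric])
  moreover have "poly (map_poly c [:- a, 1:]) x = 0" by (simp add: a map_poly_pCons' field_hom_simps[OF c_hom])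
  ultimately show "x \<in> const_closure \<iota>" unfolding const_closure_def separable_over_def by blast
qed

definition "Gal = galois_group (range \<iota>)"
definition "GalGeom = galois_group (simple_ext (const_closure \<iota>) t)"

lemma galois_group_antimono: "K \<subseteq> K' \<Longrightarrow> galois_group K' \<subseteq> galois_group K"
  by (auto simp: galois_group_def)

lemma simple_ext_mem: "t \<in> simple_ext (const_closure \<iota>) t" "const_closure \<iota> \<subseteq> simple_ext (const_closure \<iota>) t"
  "range \<iota> \<subseteq> simple_ext (const_closure \<iota>) t"
proof -
  have cc: "c a \<in> const_closure \<iota>" for a using range_c_const_closure by blast
  have 01: "0 \<in> const_closure \<iota>" "1 \<in> const_closure \<iota>" using cc[of 0] cc[of 1] by (simp_all add: field_hom_simps[OF c_hom])
  have r: "range (coeff [:x:]) \<subseteq> const_closure \<iota>" if "x \<in> const_closure \<iota>" for x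
    using that 01 by (auto simp: coeff_pCons split: nat.splits)
  have "range (coeff [:0, 1:]) \<subseteq> const_closure \<iota>" using 01 by (auto simp: coeff_pCons split: nat.splits)
  moreover have "t = poly [:0, 1:] t / poly [:1:] t" by simp
  ultimately show "t \<in> simple_ext (const_closure \<iota>) t" unfolding simple_ext_def using r[OF 01(2)] by blast
  show "const_closure \<iota> \<subseteq> simple_ext (const_closure \<iota>) t"
  proof
    fix x assume "x \<in> const_closure \<iota>"
    moreover have "x = poly [:x:] t / poly [:1:] t" by simp
    ultimately show "x \<in> simple_ext (const_closure \<iota>) t" unfolding simple_ext_def using r 01(2) by blast
  qed
  show "range \<iota> \<subseteq> simple_ext (const_closure \<iota>) t"
  proof
    fix x assume "x \<in> range \<iota>"
    then obtain z where z: "x = \<iota> z" by blast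
    obtain p q where pq: "z = Fract p q" "q \<noteq> 0" by (cases z) auto
    have m: "range (coeff (map_poly c r)) \<subseteq> const_closure \<iota>" for r
      using cc by (auto simp: coeff_map_poly field_hom_simps[OF c_hom])
    have "z = Fract p 1 / Fract q 1" using pq by simp
    then have "x = poly (map_poly c p) t / poly (map_poly c q) t"
      unfolding z poly_c_t \<iota>_simps(6)[symmetric] by simp
    then show "x \<in> simple_ext (const_closure \<iota>) t" unfolding simple_ext_def using m by blast
  qed
qed

lemma GalGeom_sub_Gal: "GalGeom \<subseteq> Gal"
  unfolding GalGeom_def Gal_def by (rule galois_group_antimono[OF simple_ext_mem(3)])

lemma galois_group_sub_GalGeom:
  assumes E: "subfield_set E" "const_closure \<iota> \<subseteq> E" "t \<in> E"
  shows "galois_group E \<subseteq> GalGeom"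
proof -
  have "simple_ext (const_closure \<iota>) t \<subseteq> E"
  proof
    fix x assume "x \<in> simple_ext (const_closure \<iota>) t"
    then obtain p q where pq: "x = poly p t / poly q t" "range (coeff p) \<subseteq> const_closure \<iota>"
      "range (coeff q) \<subseteq> const_closure \<iota>" by (auto simp: simple_ext_def)
    then have "p \<in> polys_over E" "q \<in> polys_over E" using E(2) by (auto simp: polys_over_def)
    then show "x \<in> E" using E by (simp add: pq(1) subfield_set_more[OF E(1)] poly_over_mem[OF E(1)])
  qed
  then show ?thesis unfolding GalGeom_def by (rule galois_group_antimono)
qed

lemma GalD:
  assumes "g \<in> Gal"
  shows "bij g" "hom_on UNIV g" "g (c a) = c a" "g t = t" "g (\<iota> z) = \<iota> z"
  using assms by (auto simp: Gal_def galois_group_def field_hom_iff const_emb_def t_elem_def)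

lemma Gal_simps:
  assumes "g \<in> Gal"
  shows "g 0 = 0" "g 1 = 1" "g (x + y) = g x + g y" "g (x * y) = g x * g y" "g (x - y) = g x - g y"
    "g (- x) = - g x" "g (x / y) = g x / g y" "g (x ^ n) = g x ^ n" "g (numeral k) = numeral k"
    "g x = 0 \<longleftrightarrow> x = 0" "g x = g y \<longleftrightarrow> x = y"
proof -
  note h = GalD(2)[OF assms] and U = subfield_set_UNIV
  show "g 0 = 0" "g 1 = 1" "g (x + y) = g x + g y" "g (x * y) = g x * g y" "g (x - y) = g x - g y"
    "g (- x) = - g x" "g (x / y) = g x / g y" "g (x ^ n) = g x ^ n" "g (numeral k) = numeral k"
    "g x = 0 \<longleftrightarrow> x = 0" "g x = g y \<longleftrightarrow> x = y"
    using hom_on_0[OF U h] hom_onD[OF h] hom_on_diff[OF U h] hom_on_uminus[OF U h] hom_on_divide[OF U h]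
      hom_on_power[OF U h] hom_on_numeral[OF U h] hom_on_eq_0[OF U h] hom_on_inj[OF U h] by simp_all
qed

lemma Gal_coeffs:
  assumes "g \<in> Gal"
  shows "g a0 = a0" "g a1 = a1" "g a2 = a2" "g b0 = b0" "g b1 = b1" "g b2 = b2"
  using coeffs GalD(3)[OF assms] by auto

lemma map_quotient_point:
  "g \<in> Gal \<Longrightarrow> map_proj_line g (quotient_point x y) = quotient_point (g x) (g y)"
  by (simp add: quotient_point_def Gal_simps)

lemma map_proj_line_F:
  assumes g: "g \<in> Gal" shows "map_proj_line g (F p) = F (map_proj_line g p)"
proof -
  have "g (px p) = px (map_proj_line g p)" "g (py p) = py (map_proj_line g p)"
    by (cases p; simp add: Gal_simps[OF g])+
  then show ?thesis
    by (simp add: F_def map_quotient_point[OF g] A_def B_def qform_def Gal_simps[OF g] Gal_coeffs[OF g])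
qed

lemma map_proj_line_F_iter:
  assumes "g \<in> Gal" shows "map_proj_line g ((F ^^ n) p) = (F ^^ n) (map_proj_line g p)"
  by (induction n) (simp_all add: map_proj_line_F[OF assms])

lemma F_proj_points:
  assumes E: "subfield_set E" "range c \<subseteq> E" and p: "p \<in> proj_points E" shows "F p \<in> proj_points E"
proof -
  note cl = subfield_setD[OF E(1)] subfield_set_more[OF E(1)]
  have co: "a0 \<in> E" "a1 \<in> E" "a2 \<in> E" "b0 \<in> E" "b1 \<in> E" "b2 \<in> E" using coeffs E(2) by auto
  have "px p \<in> E" "py p \<in> E" using p cl by (auto simp: proj_points_def)
  then have "A (px p) (py p) \<in> E" "B (px p) (py p) \<in> E"
    unfolding A_def B_def qform_def using co cl by auto
  then show ?thesis using cl by (auto simp: F_def quotient_point_def proj_points_def)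
qed

lemma F_iter_proj_points:
  assumes "subfield_set E" "range c \<subseteq> E" "p \<in> proj_points E" shows "(F ^^ n) p \<in> proj_points E"
  by (induction n) (simp_all add: assms F_proj_points)

subsection \<open>Coordinates of the vertices\<close>

definition "pt v = px (snd (\<phi> v))"

lemma \<phi>_bij: "bij_betw \<phi> UNIV (preimage_vertices F (Fin t))"
  and \<phi>_Nil: "\<phi> [] = (0, Fin t)"
  and \<phi>_child: "tree_child u v \<longleftrightarrow> preimage_child F (\<phi> u) (\<phi> v)"
  using tree by (auto simp: tree_identification_def)

lemma \<phi>_mem: "(F ^^ fst (\<phi> v)) (snd (\<phi> v)) = Fin t"
proof -
  have "\<phi> v \<in> preimage_vertices F (Fin t)" using \<phi>_bij by (auto simp: bij_betw_def)
  then show ?thesis by (auto simp: preimage_vertices_def)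
qed

text \<open>\<open>F\<close> preserves the points over \<open>Alg\<close>, while \<open>t\<close> is
  transcendental. So infinity never occurs in the tree, and each vertex has a transcendental affine
  coordinate.\<close>

lemma not_proj_points: "(F ^^ n) p = Fin t \<Longrightarrow> p \<notin> proj_points Alg"
  using F_iter_proj_points[OF subfield_Alg range_c_Alg, of p n] t_notin_Alg
  by (auto simp: proj_points_def)

lemma snd_\<phi>: "snd (\<phi> v) = Fin (pt v)" and pt_notin_Alg: "pt v \<notin> Alg"
  using not_proj_points[OF \<phi>_mem, of v] by (cases "snd (\<phi> v)"; simp add: pt_def proj_points_def image_iff)+

lemma fst_\<phi>: "fst (\<phi> v) = length v"
proof (induction v rule: rev_induct)
  case Nil
  then show ?case by (simp add: \<phi>_Nil)
next
  case (snoc x v)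
  have "tree_child v (v @ [x])" by (simp add: tree_child_def)
  then show ?case using snoc by (simp add: \<phi>_child preimage_child_def)
qed

lemma \<phi>_eq: "\<phi> v = (length v, Fin (pt v))"
  using fst_\<phi>[of v] snd_\<phi>[of v] by (cases "\<phi> v") simp

lemma pt_Nil: "pt [] = t"
  by (simp add: pt_def \<phi>_Nil)

lemma F_pt: "F (Fin (pt (v @ [x]))) = Fin (pt v)"
proof -
  have "tree_child v (v @ [x])" by (simp add: tree_child_def)
  then show ?thesis by (simp add: \<phi>_child preimage_child_def \<phi>_eq)
qed

lemma pt_inj: "length v = length w \<Longrightarrow> pt v = pt w \<longleftrightarrow> v = w"
  using \<phi>_bij \<phi>_eq by (auto simp: bij_betw_def inj_def)

text \<open>The quadratic equation whose roots are the two preimages of \<open>x\<close>.\<close>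

definition "al x = a2 - b2 * x"
definition "be x = a1 - b1 * x"
definition "ga x = a0 - b0 * x"

lemma coeffs_Alg: "a0 \<in> Alg" "a1 \<in> Alg" "a2 \<in> Alg" "b0 \<in> Alg" "b1 \<in> Alg" "b2 \<in> Alg"
  using coeffs range_c_Alg by auto

lemma al_nonzero: assumes "x \<notin> Alg" shows "al x \<noteq> 0"
proof
  assume "al x = 0"
  then have e: "a2 = b2 * x" by (simp add: al_def)
  have "b2 = 0"
  proof (rule ccontr)
    assume "b2 \<noteq> 0"
    then have "x = a2 / b2" using e by simp
    then show False using assms subfield_set_more(2)[OF subfield_Alg coeffs_Alg(3,6)] by simp
  qed
  then have "b2 = 0" "a2 = 0" using e by simp_all
  then show False using res by simp
qed

lemma fibre_equation: "F (Fin z) = Fin x \<longleftrightarrow> al x * z\<^sup>2 + be x * z + ga x = 0"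
  using F_eq_iff[of x 1 "Fin z"] by (simp add: quotient_point_def qform_def al_def be_def ga_def)

text \<open>The order of the two children of \<open>v\<close> singles out a square root of the discriminant, so that an
  automorphism swaps the children of \<open>v\<close> iff it does not respect these square roots.\<close>

definition "sq v = 2 * al (pt v) * pt (v @ [False]) + be (pt v)"
definition "dis x = (be x)\<^sup>2 - 4 * al x * ga x"

lemma al_pt: "al (pt v) \<noteq> 0"
  by (rule al_nonzero[OF pt_notin_Alg])

lemma pt_equation: "al (pt v) * (pt (v @ [x]))\<^sup>2 + be (pt v) * pt (v @ [x]) + ga (pt v) = 0"
  using F_pt fibre_equation by blast

lemma quadratic_completion: "(2 * al x * z + be x)\<^sup>2 = 4 * al x * (al x * z\<^sup>2 + be x * z + ga x) + dis x"
  by (simp add: dis_def power2_eq_square algebra_simps)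

lemma sq_square: "(sq v)\<^sup>2 = dis (pt v)"
  unfolding sq_def quadratic_completion pt_equation by simp

text \<open>The expression on the left has square \<open>dis (pt v)\<close> for both children and
  takes distinct values, hence opposite ones.\<close>

lemma sq_child: "2 * al (pt v) * pt (v @ [x]) + be (pt v) = (if x then - sq v else sq v)"
proof (cases x)
  case True
  have "(2 * al (pt v) * pt (v @ [True]) + be (pt v))\<^sup>2 = (sq v)\<^sup>2"
    unfolding sq_square quadratic_completion pt_equation by simp
  moreover have "2 * al (pt v) * pt (v @ [True]) + be (pt v) \<noteq> sq v"
    using pt_inj[of "v @ [True]" "v @ [False]"] two al_pt[of v] by (simp add: sq_def)
  ultimately show ?thesis using True by (simp add: power2_eq_iff)
qed (simp add: sq_def)

lemma sq_nonzero: "sq v \<noteq> 0"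
proof
  assume 0: "sq v = 0"
  then have "2 * al (pt v) * pt (v @ [True]) = 2 * al (pt v) * pt (v @ [False])"
    using sq_child[of v True] sq_child[of v False] by (simp add: eq_neg_iff_add_eq_0[symmetric])
  then show False using pt_inj[of "v @ [True]" "v @ [False]"] two al_pt[of v] by simp
qed

lemma pt_child: "pt (v @ [x]) = (- be (pt v) + (if x then - sq v else sq v)) / (2 * al (pt v))"
  using sq_child[of v x] two al_pt[of v] by (simp add: field_simps)

lemma Gal_al: "g \<in> Gal \<Longrightarrow> g (al x) = al (g x)" "g \<in> Gal \<Longrightarrow> g (be x) = be (g x)"
  by (simp_all add: al_def be_def Gal_simps Gal_coeffs)

subsection \<open>Monodromy\<close>

lemma \<phi>_monodromy:
  assumes g: "g \<in> Gal" shows "\<phi> (monodromy \<phi> g v) = (length v, Fin (g (pt v)))"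
proof -
  have "(F ^^ length v) (Fin (g (pt v))) = map_proj_line g ((F ^^ length v) (Fin (pt v)))"
    by (simp add: map_proj_line_F_iter[OF g])
  also have "\<dots> = Fin t" using \<phi>_mem[of v] by (simp add: \<phi>_eq GalD(4)[OF g])
  finally have "(length v, Fin (g (pt v))) \<in> preimage_vertices F (Fin t)"
    by (simp add: preimage_vertices_def)
  then have "(length v, Fin (g (pt v))) \<in> \<phi> ` UNIV" using \<phi>_bij by (simp add: bij_betw_def)
  moreover have "monodromy \<phi> g v = inv_into UNIV \<phi> (length v, Fin (g (pt v)))"
    by (simp add: monodromy_def \<phi>_eq)
  ultimately show ?thesis by (metis f_inv_into_f)
qed

lemma length_monodromy: "g \<in> Gal \<Longrightarrow> length (monodromy \<phi> g v) = length v"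
  and pt_monodromy: "g \<in> Gal \<Longrightarrow> pt (monodromy \<phi> g v) = g (pt v)"
  using \<phi>_monodromy[of g v] \<phi>_eq[of "monodromy \<phi> g v"] by auto

lemma \<phi>_inj: "\<phi> v = \<phi> w \<longleftrightarrow> v = w"
  using \<phi>_bij by (auto simp: bij_betw_def inj_def)

lemma monodromy_eqI: "g \<in> Gal \<Longrightarrow> length w = length v \<Longrightarrow> pt w = g (pt v) \<Longrightarrow> monodromy \<phi> g v = w"
  using \<phi>_monodromy[of g v] \<phi>_eq[of w] \<phi>_inj by metis

lemma galois_group_comp: "g \<in> galois_group K \<Longrightarrow> h \<in> galois_group K \<Longrightarrow> g \<circ> h \<in> galois_group K"
  by (auto simp: galois_group_def bij_comp field_hom_def)

lemma Gal_comp: "g \<in> Gal \<Longrightarrow> h \<in> Gal \<Longrightarrow> g \<circ> h \<in> Gal"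
  unfolding Gal_def by (rule galois_group_comp)

lemma galois_group_inv:
  assumes "g \<in> galois_group K" shows "inv_into UNIV g \<in> galois_group K"
proof -
  have b: "bij g" and h: "field_hom g" and f: "\<And>x. x \<in> K \<Longrightarrow> g x = x"
    using assms by (auto simp: galois_group_def)
  let ?i = "inv_into UNIV g"
  have gi: "g (?i x) = x" and ig: "?i (g x) = x" for x
    using b by (simp_all add: bij_is_surj surj_f_inv_f bij_is_inj)
  have h': "g 1 = 1" "g (x + y) = g x + g y" "g (x * y) = g x * g y" for x y
    using h by (auto simp: field_hom_def)
  have "?i 1 = 1" using ig[of 1] h' by simp
  moreover have "?i (x + y) = ?i x + ?i y" for x y using ig[of "?i x + ?i y"] by (simp add: h' gi)
  moreover have "?i (x * y) = ?i x * ?i y" for x y using ig[of "?i x * ?i y"] by (simp add: h' gi)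
  moreover have "?i x = x" if "x \<in> K" for x using ig[of x] f[OF that] by simp
  ultimately show ?thesis using b by (simp add: galois_group_def field_hom_def bij_imp_bij_inv)
qed

lemma monodromy_comp: assumes "g \<in> Gal" "h \<in> Gal" shows "monodromy \<phi> (g \<circ> h) = monodromy \<phi> g \<circ> monodromy \<phi> h"
  by (rule ext, rule monodromy_eqI) (simp_all add: assms Gal_comp length_monodromy pt_monodromy)

lemma monodromy_id: "monodromy \<phi> id = id"
  by (rule ext, rule monodromy_eqI) (auto simp: Gal_def galois_group_def field_hom_def)

lemma Gal_inv: "g \<in> Gal \<Longrightarrow> inv_into UNIV g \<in> Gal"
  unfolding Gal_def by (rule galois_group_inv)

lemma monodromy_inv: assumes g: "g \<in> Gal"
  shows "monodromy \<phi> g \<circ> monodromy \<phi> (inv_into UNIV g) = id" "monodromy \<phi> (inv_into UNIV g) \<circ> monodromy \<phi> g = id"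
proof -
  have b: "bij g" using GalD(1)[OF g] .
  have "g \<circ> inv_into UNIV g = id" "inv_into UNIV g \<circ> g = id"
    using b by (auto simp: fun_eq_iff bij_is_surj surj_f_inv_f bij_is_inj)
  then show "monodromy \<phi> g \<circ> monodromy \<phi> (inv_into UNIV g) = id" "monodromy \<phi> (inv_into UNIV g) \<circ> monodromy \<phi> g = id"
    using monodromy_comp[OF g Gal_inv[OF g]] monodromy_comp[OF Gal_inv[OF g] g] monodromy_id by simp_all
qed

lemma monodromy_aut: assumes g: "g \<in> Gal" shows "monodromy \<phi> g \<in> tree_auts"
proof (rule tree_autsI)
  show "bij (monodromy \<phi> g)" using monodromy_inv[OF g] by (metis o_bij)
  show "monodromy \<phi> g [] = []" using length_monodromy[OF g, of "[]"] by simp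
  fix u x
  have "map_proj_line g (F (Fin (pt (u @ [x])))) = F (Fin (pt (monodromy \<phi> g (u @ [x]))))"
    by (simp add: map_proj_line_F[OF g] pt_monodromy[OF g])
  then have "F (Fin (pt (monodromy \<phi> g (u @ [x])))) = Fin (pt (monodromy \<phi> g u))" by (simp add: F_pt pt_monodromy[OF g])
  then have "preimage_child F (\<phi> (monodromy \<phi> g u)) (\<phi> (monodromy \<phi> g (u @ [x])))"
    by (simp add: preimage_child_def \<phi>_eq length_monodromy[OF g])
  then show "\<exists>y. monodromy \<phi> g (u @ [x]) = monodromy \<phi> g u @ [y]" by (simp add: \<phi>_child[symmetric] tree_child_def)
qed

lemma monodromy_inv_eq: assumes g: "g \<in> Gal" shows "inv_into UNIV (monodromy \<phi> g) = monodromy \<phi> (inv_into UNIV g)"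
  using monodromy_inv(2)[OF g] tree_aut_inv_cancel(4)[OF monodromy_aut[OF g]] by (metis comp_assoc comp_id id_comp)

lemma G_arith_eq: "G_arith \<iota> \<phi> = monodromy \<phi> ` Gal"
  by (simp add: G_arith_def Gal_def)

lemma G_geom_eq: "G_geom \<iota> \<phi> = monodromy \<phi> ` GalGeom"
  by (simp add: G_geom_def GalGeom_def)

lemma aut_subgroup_G_geom: "aut_subgroup (G_geom \<iota> \<phi>)"
proof -
  have s: "g \<in> Gal" if "g \<in> GalGeom" for g using GalGeom_sub_Gal that by blast
  have "id \<in> GalGeom" by (auto simp: GalGeom_def galois_group_def field_hom_def)
  moreover have "g \<circ> h \<in> GalGeom" if "g \<in> GalGeom" "h \<in> GalGeom" for g h
    using that galois_group_comp unfolding GalGeom_def by blast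
  moreover have "inv_into UNIV g \<in> GalGeom" if "g \<in> GalGeom" for g
    using that galois_group_inv unfolding GalGeom_def by blast
  ultimately show ?thesis
    unfolding aut_subgroup_def G_geom_eq
    by (auto simp: s monodromy_aut monodromy_comp[symmetric] monodromy_inv_eq monodromy_id[symmetric] simp del: o_apply)
qed

lemma Gal_sq:
  assumes g: "g \<in> Gal"
  shows "g (sq v) = (if swaps (monodromy \<phi> g) v then - sq (monodromy \<phi> g v) else sq (monodromy \<phi> g v))"
proof -
  have "g (sq v) = 2 * al (pt (monodromy \<phi> g v)) * pt (monodromy \<phi> g (v @ [False])) + be (pt (monodromy \<phi> g v))"
    by (simp add: sq_def Gal_simps[OF g] Gal_al[OF g] pt_monodromy[OF g])
  also have "monodromy \<phi> g (v @ [False]) = monodromy \<phi> g v @ [swaps (monodromy \<phi> g) v]"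
    using tree_aut_snoc[OF monodromy_aut[OF g], of v False] by simp
  finally show ?thesis using sq_child by simp
qed

text \<open>This replaces compactness of the Galois group. The approximating automorphisms need not
  converge on the whole field, but the elements on which they are eventually constant form a
  subfield containing all vertex coordinates; the limit on it is a homomorphism and extends to an
  automorphism.\<close>

lemma G_geom_closed:
  assumes w: "w \<in> tree_auts" and ap: "\<And>n. \<exists>h\<in>G_geom \<iota> \<phi>. level_agree n w h"
  shows "w \<in> G_geom \<iota> \<phi>"
proof -
  have "\<exists>h. \<forall>n. h n \<in> GalGeom \<and> level_agree n w (monodromy \<phi> (h n))"
    using ap unfolding G_geom_eq by (intro choice) blast
  then obtain h where h: "\<And>n. h n \<in> GalGeom" "\<And>n. level_agree n w (monodromy \<phi> (h n))" by blast
  have hG: "h n \<in> Gal" for n using h(1) GalGeom_sub_Gal by blast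
  define ev where "ev z y \<longleftrightarrow> (\<exists>N. \<forall>n\<ge>N. h n z = y)" for z y
  have evI: "ev z y" if "\<And>n. n \<ge> N \<Longrightarrow> h n z = y" for z y N using that by (auto simp: ev_def)
  have ev2: "\<exists>N. \<forall>n\<ge>N. h n z = y \<and> h n z' = y'" if e: "ev z y" "ev z' y'" for z y z' y'
  proof -
    obtain N N' where "\<forall>n\<ge>N. h n z = y" "\<forall>n\<ge>N'. h n z' = y'"
      using e unfolding ev_def by blast
    then show ?thesis by (intro exI[of _ "max N N'"]) auto
  qed
  have un: "y = y'" if "ev z y" "ev z y'" for z y y' using ev2[OF that] by blast
  define E where "E = {z. \<exists>y. ev z y}"
  define \<psi> where "\<psi> z = (THE y. ev z y)" for z
  have psi: "\<psi> z = y" if "ev z y" for z y unfolding \<psi>_def using that un by blast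
  have ev_add: "ev (z + z') (y + y')" "ev (z * z') (y * y')" if "ev z y" "ev z' y'" for z y z' y'
    using ev2[OF that] unfolding ev_def by (metis Gal_simps(3)[OF hG], metis Gal_simps(4)[OF hG])
  have ev_neg: "ev (- z) (- y)" "ev (inverse z) (inverse y)" if "ev z y" for z y
    using that hom_on_inverse[OF subfield_set_UNIV GalD(2)[OF hG]] unfolding ev_def
    by (metis Gal_simps(6)[OF hG], metis UNIV_I)
  have ev_fix: "ev z z" if "\<And>n. h n z = z" for z using that by (auto simp: ev_def)
  have E: "subfield_set E"
    unfolding subfield_set_def
  proof (intro conjI ballI)
    show "0 \<in> E" "1 \<in> E" unfolding E_def using ev_fix[of 0] ev_fix[of 1] Gal_simps(1,2)[OF hG] by blast+
    fix x assume "x \<in> E"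
    then obtain x' where x: "ev x x'" by (auto simp: E_def)
    show "- x \<in> E" "inverse x \<in> E" unfolding E_def using ev_neg[OF x] by blast+
    fix y assume "y \<in> E"
    then obtain y' where y: "ev y y'" by (auto simp: E_def)
    show "x + y \<in> E" "x * y \<in> E" unfolding E_def using ev_add[OF x y] by blast+
  qed
  have hom: "hom_on E \<psi>"
    unfolding hom_on_def
  proof (intro conjI ballI)
    show "\<psi> 1 = 1" using psi[OF ev_fix[of 1]] Gal_simps(2)[OF hG] by simp
    fix x y assume "x \<in> E" "y \<in> E"
    then obtain x' y' where "ev x x'" "ev y y'" by (auto simp: E_def)
    then show "\<psi> (x + y) = \<psi> x + \<psi> y" "\<psi> (x * y) = \<psi> x * \<psi> y" using psi ev_add by metis+
  qed
  have fixed: "x \<in> E \<and> \<psi> x = x" if "x \<in> simple_ext (const_closure \<iota>) t" for x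
  proof -
    have "h n x = x" for n using h(1) that by (auto simp: GalGeom_def galois_group_def)
    then show ?thesis using ev_fix[of x] psi[of x x] by (auto simp: E_def)
  qed
  have fixK: "range \<iota> \<subseteq> E" "\<And>x. \<psi> (\<iota> x) = \<iota> x" using simple_ext_mem(3) fixed by blast+
  obtain g where g: "g \<in> galois_group (range \<iota>)" "\<forall>x\<in>E. g x = \<psi> x"
    using hom_on_extends_to_automorphism[OF sc E fixK(1) hom fixK(2)] by blast
  then have gG: "g \<in> Gal" by (simp add: Gal_def)
  have "g \<in> GalGeom" using g fixed by (auto simp: GalGeom_def galois_group_def)
  moreover have "monodromy \<phi> g = w"
  proof (rule ext, rule monodromy_eqI[OF gG])
    fix v
    show "length (w v) = length v" by (rule tree_aut_length[OF w])
    have "ev (pt v) (pt (w v))"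
    proof (rule evI)
      fix n assume "n \<ge> length v"
      then show "h n (pt v) = pt (w v)" using h(2)[of n] pt_monodromy[OF hG, of n v] by (simp add: level_agree_def)
    qed
    then have "pt v \<in> E" "\<psi> (pt v) = pt (w v)" using psi by (auto simp: E_def)
    then show "pt (w v) = g (pt v)" using g(2) by simp
  qed
  ultimately show ?thesis unfolding G_geom_eq by blast
qed

end

section \<open>Inertia elements\<close>

lemma poly_fls_shifted:
  "poly (map_poly fls_const p) (fls_const a + fls_X) = fps_to_fls (fps_of_poly (pcompose p [:a, 1:]))"
  for a :: "'a::field"
proof (induction p)
  case (pCons b p)
  have "fps_to_fls (fps_of_poly [:a, 1:]) = fls_const a + fls_X"
    by (simp add: fps_of_poly_pCons)
  moreover have "fps_to_fls (fps_of_poly [:b:]) = fls_const b"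
    by (simp add: fps_of_poly_pCons)
  ultimately have "fps_to_fls (fps_of_poly (pcompose (pCons b p) [:a, 1:])) =
      fls_const b + (fls_const a + fls_X) * poly (map_poly fls_const p) (fls_const a + fls_X)"
    unfolding pcompose_pCons fps_of_poly_add fps_of_poly_mult fps_to_fls_plus fps_to_fls_mult pCons
    by simp
  then show ?case by (simp add: map_poly_pCons')
qed simp

text \<open>Evaluation at \<open>a + X\<close> is composition with a linear polynomial, which loses
  nothing.\<close>

lemma transcendental_shifted:
  fixes p :: "'a::field poly"
  assumes "poly (map_poly fls_const p) (fls_const a + fls_X) = 0" shows "p = 0"
proof -
  have "pcompose p [:a, 1:] = 0" using assms by (simp add: poly_fls_shifted)
  then show ?thesis using pcompose_eq_0 by fastforce
qed

lemma transcendental_inverse: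
  fixes p :: "'a::field poly"
  assumes "poly (map_poly fls_const p) (inverse fls_X) = 0" shows "p = 0"
proof -
  have d: "degree (map_poly fls_const p) = degree p"
  proof (cases "p = 0")
    case False
    then have "fls_const (lead_coeff p) \<noteq> 0" by simp
    then show ?thesis by (simp add: map_poly_degree_eq)
  qed simp
  have "map_poly fls_const (reflect_poly p) = reflect_poly (map_poly fls_const p)"
    by (rule poly_eqI) (simp add: coeff_map_poly coeff_reflect_poly d)
  then have "poly (map_poly fls_const (reflect_poly p)) (fls_const 0 + fls_X) = 0"
    using assms poly_reflect_poly_nz[of fls_X "map_poly fls_const p"] by simp
  then have "reflect_poly p = 0" by (rule transcendental_shifted)
  then show ?thesis by simp
qed

text \<open>As \<open>t\<close> and \<open>T\<close> are both transcendental, a fraction in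
  \<open>t\<close> may be sent to the corresponding fraction in \<open>T\<close>; \<open>R\<close>
  relates an element to the fractions that represent it.\<close>

lemma hom_on_rational_functions:
  fixes A :: "'a::field set" and \<gamma> :: "'a \<Rightarrow> 'b::field"
  assumes A: "subfield_set A" and \<gamma>: "hom_on A \<gamma>"
    and t: "\<And>p. p \<in> polys_over A \<Longrightarrow> poly p t = 0 \<Longrightarrow> p = 0"
    and T: "\<And>p. p \<in> polys_over A \<Longrightarrow> poly (map_poly \<gamma> p) T = 0 \<Longrightarrow> p = 0"
  shows "\<exists>E \<psi>. subfield_set E \<and> A \<subseteq> E \<and> t \<in> E \<and> hom_on E \<psi> \<and> (\<forall>a\<in>A. \<psi> a = \<gamma> a) \<and> \<psi> t = T"
proof -
  note cl = polys_over_closed[OF A]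
  note m = map_poly_hom_on[OF A \<gamma>]
  define R where "R z p q \<longleftrightarrow> p \<in> polys_over A \<and> q \<in> polys_over A \<and> q \<noteq> 0 \<and> z * poly q t = poly p t" for z p q
  define E where "E = {z. \<exists>p q. R z p q}"
  define val where "val p q = poly (map_poly \<gamma> p) T / poly (map_poly \<gamma> q) T" for p q
  have nz: "poly (map_poly \<gamma> q) T \<noteq> 0" "poly q t \<noteq> 0" if "R z p q" for z p q
    using that T t by (auto simp: R_def)
  have un: "val p q = val p' q'" if 1: "R z p q" and 2: "R z p' q'" for z p q p' q'
  proof -
    have "poly (p * q') t = poly (p' * q) t" using 1 2 by (simp add: R_def) (metis mult.assoc mult.commute)
    then have "p * q' - p' * q = 0" using 1 2 by (intro t cl) (auto simp: R_def)
    then have "map_poly \<gamma> p * map_poly \<gamma> q' = map_poly \<gamma> p' * map_poly \<gamma> q"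
      using 1 2 m(2) by (simp add: R_def flip: m(2))
    then have "poly (map_poly \<gamma> p) T * poly (map_poly \<gamma> q') T = poly (map_poly \<gamma> p') T * poly (map_poly \<gamma> q) T"
      by (metis poly_mult)
    then show ?thesis using nz[OF 1] nz[OF 2] by (simp add: val_def field_simps)
  qed
  define \<psi> where "\<psi> z = (THE y. \<exists>p q. R z p q \<and> y = val p q)" for z
  have psi: "\<psi> z = val p q" if "R z p q" for z p q
    unfolding \<psi>_def using that un by (intro the_equality) blast+
  have R_add: "R (z + z') (p * q' + p' * q) (q * q')" and R_mult: "R (z * z') (p * p') (q * q')"
    if "R z p q" "R z' p' q'" for z z' p q p' q'
  proof -
    have e: "z * poly q t = poly p t" "z' * poly q' t = poly p' t" using that by (simp_all add: R_def)
    have "(z + z') * poly (q * q') t = (z * poly q t) * poly q' t + (z' * poly q' t) * poly q t"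
      by (simp add: algebra_simps)
    then have "(z + z') * poly (q * q') t = poly (p * q' + p' * q) t" unfolding e by simp
    then show "R (z + z') (p * q' + p' * q) (q * q')" using that cl unfolding R_def by simp
    have "z * z' * poly (q * q') t = (z * poly q t) * (z' * poly q' t)" by (simp add: algebra_simps)
    then have "z * z' * poly (q * q') t = poly (p * p') t" unfolding e by simp
    then show "R (z * z') (p * p') (q * q')" using that cl unfolding R_def by simp
  qed
  have R_const: "R a [:a:] 1" if "a \<in> A" for a
    using that cl(1,2) by (simp add: R_def)
  have R_t: "R t [:0, 1:] 1" using cl(1,2) subfield_setD[OF A] by (simp add: R_def)
  have R_minus: "R (- z) (- p) q" if "R z p q" for z p q using that cl by (auto simp: R_def)
  have R_inv: "R (inverse z) q p" if "R z p q" "z \<noteq> 0" for z p q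
    using that nz[OF that(1)] by (auto simp: R_def field_simps)
  have E: "subfield_set E"
    unfolding subfield_set_def
  proof (intro conjI ballI)
    show "0 \<in> E" "1 \<in> E" unfolding E_def using R_const[of 0] R_const[of 1] subfield_setD[OF A] by blast+
    fix x assume "x \<in> E"
    then obtain p q where x: "R x p q" by (auto simp: E_def)
    show "- x \<in> E" unfolding E_def using R_minus[OF x] by blast
    show "inverse x \<in> E" using R_inv[OF x] \<open>x \<in> E\<close> by (cases "x = 0") (auto simp: E_def)
    fix y assume "y \<in> E"
    then obtain p' q' where y: "R y p' q'" by (auto simp: E_def)
    show "x + y \<in> E" "x * y \<in> E" unfolding E_def using R_add[OF x y] R_mult[OF x y] by blast+
  qed
  have val1: "val [:a:] 1 = \<gamma> a" for a
    by (simp add: val_def map_poly_pCons' hom_on_0[OF A \<gamma>] map_poly_1 hom_onD(1)[OF \<gamma>])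
  have "hom_on E \<psi>"
    unfolding hom_on_def
  proof (intro conjI ballI)
    have 1: "(1::'a) \<in> A" using subfield_setD[OF A] by simp
    show "\<psi> 1 = 1" using psi[OF R_const[OF 1]] val1[of 1] hom_onD(1)[OF \<gamma>] by simp
    fix x y assume "x \<in> E" "y \<in> E"
    then obtain p q p' q' where x: "R x p q" and y: "R y p' q'" by (auto simp: E_def)
    have pq: "p \<in> polys_over A" "q \<in> polys_over A" "p' \<in> polys_over A" "q' \<in> polys_over A"
      using x y by (auto simp: R_def)
    show "\<psi> (x + y) = \<psi> x + \<psi> y"
      unfolding psi[OF x] psi[OF y] psi[OF R_add[OF x y]] val_def
      using nz[OF x] nz[OF y] pq cl by (simp add: m field_simps)
    show "\<psi> (x * y) = \<psi> x * \<psi> y"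
      unfolding psi[OF x] psi[OF y] psi[OF R_mult[OF x y]] val_def
      using pq by (simp add: m)
  qed
  moreover have "\<psi> t = T"
    using psi[OF R_t] by (simp add: val_def map_poly_pCons' hom_on_0[OF A \<gamma>] map_poly_1 hom_onD(1)[OF \<gamma>])
  moreover have "A \<subseteq> E" "t \<in> E" using R_const R_t by (auto simp: E_def)
  moreover have "\<forall>a\<in>A. \<psi> a = \<gamma> a" using psi[OF R_const] val1 by simp
  ultimately show ?thesis using E by blast
qed

section \<open>Unramified places on the tree and the inertia elements above branch points\<close>

context iterated_map
begin

lemma sqrt_ex: "\<exists>r::'l. r\<^sup>2 = x"
  by (rule sep_closed_sqrt[OF sc two])

text \<open>A place of the field generated by \<open>Alg\<close> and the vertices up to level \<open>m\<close>, above the point \<open>\<pi>\<close> of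
  the \<open>t\<close>-line and unramified there: \<open>\<rho> v\<close> is the reduction of the vertex \<open>v\<close>.\<close>

definition lifted :: "'l proj_line \<Rightarrow> nat \<Rightarrow> 'l set \<Rightarrow> ('l \<Rightarrow> 'l fls) \<Rightarrow> (vertex \<Rightarrow> 'l proj_line) \<Rightarrow> bool" where
  "lifted \<pi> m E \<psi> \<rho> \<longleftrightarrow> subfield_set E \<and> Alg \<subseteq> E \<and> t \<in> E \<and> hom_on E \<psi> \<and>
     (\<forall>a\<in>Alg. \<psi> a = fls_const a) \<and> (\<forall>v. length v \<le> m \<longrightarrow> pt v \<in> E \<and> unram_red (\<psi> (pt v)) (\<rho> v)) \<and>
     \<rho> [] = \<pi> \<and> (\<forall>v. length v < m \<longrightarrow> (\<forall>x. F (\<rho> (v @ [x])) = \<rho> v) \<and> \<rho> (v @ [False]) \<noteq> \<rho> (v @ [True]))"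

lemma liftedD:
  assumes "lifted \<pi> m E \<psi> \<rho>"
  shows "subfield_set E" "Alg \<subseteq> E" "t \<in> E" "hom_on E \<psi>" "a \<in> Alg \<Longrightarrow> \<psi> a = fls_const a"
    "length v \<le> m \<Longrightarrow> pt v \<in> E" "length v \<le> m \<Longrightarrow> unram_red (\<psi> (pt v)) (\<rho> v)" "\<rho> [] = \<pi>"
    "length v < m \<Longrightarrow> F (\<rho> (v @ [x])) = \<rho> v" "length v < m \<Longrightarrow> \<rho> (v @ [False]) \<noteq> \<rho> (v @ [True])"
  using assms by (auto simp: lifted_def)

lemma hom_on_fls_const: "hom_on Alg fls_const"
  by (simp add: hom_on_def fls_plus_const)

text \<open>The series variable becomes the local parameter \<open>t - a\<close>, or
  \<open>1 / t\<close> at infinity.\<close>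

lemma lifted_0: "\<exists>E \<psi>. lifted \<pi> 0 E \<psi> (\<lambda>_. \<pi>)"
proof -
  have "\<exists>T P Q. unram_rep T P Q \<and> quotient_point (P $ 0) (Q $ 0) = \<pi> \<and>
      (\<forall>p :: 'l poly. poly (map_poly fls_const p) T = 0 \<longrightarrow> p = 0)"
  proof (cases \<pi>)
    case (Fin a)
    have "unram_rep (fls_const a + fls_X) (fps_const a + fps_X) 1" by (simp add: unram_rep_def)
    then show ?thesis using transcendental_shifted Fin
      by (intro exI[of _ "fls_const a + fls_X"] exI[of _ "fps_const a + fps_X"] exI[of _ 1])
        (auto simp: quotient_point_def)
  next
    case Infty
    have "unram_rep (inverse fls_X :: 'l fls) 1 fps_X" by (simp add: unram_rep_def)
    then show ?thesis using transcendental_inverse Infty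
      by (intro exI[of _ "inverse fls_X"] exI[of _ 1] exI[of _ fps_X]) (auto simp: quotient_point_def)
  qed
  then obtain T P Q where T: "unram_rep T P Q" "quotient_point (P $ 0) (Q $ 0) = \<pi>"
    "\<And>p :: 'l poly. poly (map_poly fls_const p) T = 0 \<Longrightarrow> p = 0" by blast
  have "\<And>p. p \<in> polys_over Alg \<Longrightarrow> poly p t = 0 \<Longrightarrow> p = 0"
    using transcendental_over_algebraic[OF c_hom, of t] t_notin_Alg by (simp add: Alg_def)
  then obtain E \<psi> where "subfield_set E" "Alg \<subseteq> E" "t \<in> E" "hom_on E \<psi>" "\<forall>a\<in>Alg. \<psi> a = fls_const a" "\<psi> t = T"
    using hom_on_rational_functions[OF subfield_Alg hom_on_fls_const _ T(3), of t] by blast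
  then show ?thesis using T(1,2) by (auto simp: lifted_def pt_Nil unram_red_def)
qed

lemma lifted_disc:
  assumes L: "lifted \<pi> m E \<psi> \<rho>" and v: "length v \<le> m"
  shows "dis (pt v) \<in> E" "\<psi> (dis (pt v)) = disc (\<psi> (pt v))" "\<psi> (al (pt v)) = alpha (\<psi> (pt v))"
    "\<psi> (be (pt v)) = beta (\<psi> (pt v))" "al (pt v) \<in> E" "be (pt v) \<in> E"
proof -
  note E = liftedD(1)[OF L] and h = liftedD(4)[OF L]
  note cl = subfield_setD[OF E] subfield_set_more[OF E]
  have co: "a0 \<in> E" "a1 \<in> E" "a2 \<in> E" "b0 \<in> E" "b1 \<in> E" "b2 \<in> E" "pt v \<in> E"
    using coeffs_Alg liftedD(2)[OF L] liftedD(6)[OF L v] by auto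
  note fc = liftedD(5)[OF L]
  show al: "\<psi> (al (pt v)) = alpha (\<psi> (pt v))" and be: "\<psi> (be (pt v)) = beta (\<psi> (pt v))"
    using co cl coeffs_Alg fc
    by (simp_all add: al_def be_def alpha_def beta_def hom_on_diff[OF E h] hom_onD(3)[OF h])
  have ga: "\<psi> (ga (pt v)) = gamma (\<psi> (pt v))"
    using co cl coeffs_Alg fc by (simp add: ga_def gamma_def hom_on_diff[OF E h] hom_onD(3)[OF h])
  show mem: "al (pt v) \<in> E" "be (pt v) \<in> E" using co cl by (auto simp: al_def be_def)
  have gm: "ga (pt v) \<in> E" using co cl by (auto simp: ga_def)
  show "dis (pt v) \<in> E" using mem gm cl by (auto simp: dis_def)
  show "\<psi> (dis (pt v)) = disc (\<psi> (pt v))"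
    using mem gm cl
    by (simp add: dis_def disc_def hom_on_diff[OF E h] hom_onD(3)[OF h] hom_on_power[OF E h]
        hom_on_numeral[OF E h] al be ga)
qed

abbreviation "branch p \<equiv> D (px p) (py p) = 0"

lemma unram_red_cases:
  assumes "unram_red z p"
  obtains P Q where "unram_rep z P Q" "p = quotient_point (P $ 0) (Q $ 0)" "D (P $ 0) (Q $ 0) = 0 \<longleftrightarrow> branch p"
proof -
  obtain P Q where PQ: "unram_rep z P Q" "p = quotient_point (P $ 0) (Q $ 0)"
    using assms by (auto simp: unram_red_def)
  have "D (P $ 0) (Q $ 0) = 0 \<longleftrightarrow> branch p"
    unfolding PQ(2) using PQ(1) D_quotient_point by (simp add: unram_rep_def)
  then show ?thesis using that PQ by blast
qed

text \<open>If no vertex of level \<open>m\<close> reduces to a branch point, all discriminants on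
  this level are squares of Laurent series. Adjoining the \<open>sq v\<close> then brings in the
  children, and \<open>lift_fibre\<close> provides their distinct reductions.\<close>

lemma lifted_Suc:
  assumes L: "lifted \<pi> m E \<psi> \<rho>" and nb: "\<And>v. length v = m \<Longrightarrow> \<not> branch (\<rho> v)"
  shows "\<exists>E' \<psi>' \<rho>'. lifted \<pi> (Suc m) E' \<psi>' \<rho>'"
proof -
  note E = liftedD(1)[OF L] and h = liftedD(4)[OF L]
  have sqE: "(sq v)\<^sup>2 \<in> E" "\<psi> ((sq v)\<^sup>2) = disc (\<psi> (pt v))" if "length v = m" for v
    using lifted_disc[OF L, of v] that by (simp_all add: sq_square)
  have "\<exists>E' \<psi>'. subfield_set E' \<and> E \<subseteq> E' \<and> sq ` words m \<subseteq> E' \<and> hom_on E' \<psi>' \<and> (\<forall>x\<in>E. \<psi>' x = \<psi> x)"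
  proof (rule hom_on_adjoin_sqrts[OF E h])
    fix s assume "s \<in> sq ` words m"
    then obtain v where v: "s = sq v" "length v = m" by (auto simp: words_def)
    obtain P Q where "unram_rep (\<psi> (pt v)) P Q" "D (P $ 0) (Q $ 0) \<noteq> 0"
      using unram_red_cases[OF liftedD(7)[OF L, of v]] nb[OF v(2)] v(2) by (metis order_refl)
    then have "\<exists>S. S\<^sup>2 = disc (\<psi> (pt v))" by (rule disc_square[OF sqrt_ex])
    then show "s\<^sup>2 \<in> E \<and> (\<exists>m. m\<^sup>2 = \<psi> (s\<^sup>2))" using sqE[OF v(2)] v by simp
  qed simp
  then obtain E' \<psi>' where E': "subfield_set E'" "E \<subseteq> E'" "sq ` words m \<subseteq> E'" "hom_on E' \<psi>'" "\<forall>x\<in>E. \<psi>' x = \<psi> x"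
    by blast
  note cl = subfield_setD[OF E'(1)] subfield_set_more[OF E'(1)]
  have child: "pt (v @ [x]) \<in> E'"
    "2 * alpha (\<psi> (pt v)) * \<psi>' (pt (v @ [x])) = - beta (\<psi> (pt v)) + (if x then - \<psi>' (sq v) else \<psi>' (sq v))"
    if v: "length v = m" for v x
  proof -
    have mem: "al (pt v) \<in> E'" "be (pt v) \<in> E'" "sq v \<in> E'"
      using lifted_disc(5,6)[OF L, of v] v E'(2,3) by (auto simp: words_def)
    show p: "pt (v @ [x]) \<in> E'" unfolding pt_child using mem cl by auto
    have "2 * al (pt v) * pt (v @ [x]) = - be (pt v) + (if x then - sq v else sq v)"
      using sq_child[of v x] by (simp add: algebra_simps eq_diff_eq)
    then have "\<psi>' (2 * al (pt v) * pt (v @ [x])) = \<psi>' (- be (pt v) + (if x then - sq v else sq v))" by simp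
    moreover have "\<psi>' (al (pt v)) = alpha (\<psi> (pt v))" "\<psi>' (be (pt v)) = beta (\<psi> (pt v))"
      using lifted_disc[OF L, of v] E'(5) v by simp_all
    ultimately show "2 * alpha (\<psi> (pt v)) * \<psi>' (pt (v @ [x])) = - beta (\<psi> (pt v)) + (if x then - \<psi>' (sq v) else \<psi>' (sq v))"
      using mem p cl by (cases x) (simp_all add: hom_onD(2,3)[OF E'(4)] hom_on_numeral[OF E'(1,4)]
          hom_on_uminus[OF E'(1,4)] hom_on_diff[OF E'(1,4)])
  qed
  have "\<exists>p0 p1. unram_red (\<psi>' (pt (v @ [False]))) p0 \<and> unram_red (\<psi>' (pt (v @ [True]))) p1 \<and>
      F p0 = \<rho> v \<and> F p1 = \<rho> v \<and> p0 \<noteq> p1" if v: "length v = m" for v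
  proof -
    obtain P Q where PQ: "unram_rep (\<psi> (pt v)) P Q" "\<rho> v = quotient_point (P $ 0) (Q $ 0)" "D (P $ 0) (Q $ 0) \<noteq> 0"
      using unram_red_cases[OF liftedD(7)[OF L, of v]] nb[OF v] v by (metis order_refl)
    have "\<psi>' (sq v) * \<psi>' (sq v) = \<psi>' ((sq v)\<^sup>2)"
      using E'(3) v by (simp add: power2_eq_square hom_onD(3)[OF E'(4)] words_def image_subset_iff)
    also have "\<dots> = disc (\<psi> (pt v))" using E'(5) sqE[OF v] by simp
    finally have S: "(\<psi>' (sq v))\<^sup>2 = disc (\<psi> (pt v))" by (simp add: power2_eq_square)
    have "\<psi> (al (pt v)) \<noteq> 0" using hom_on_eq_0[OF E h] lifted_disc(5)[OF L, of v] v al_pt by simp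
    then have al: "alpha (\<psi> (pt v)) \<noteq> 0" using lifted_disc(3)[OF L, of v] v by simp
    have "2 * alpha (\<psi> (pt v)) * \<psi>' (pt (v @ [False])) = - beta (\<psi> (pt v)) + \<psi>' (sq v)"
      "2 * alpha (\<psi> (pt v)) * \<psi>' (pt (v @ [True])) = - beta (\<psi> (pt v)) - \<psi>' (sq v)"
      using child(2)[OF v, of False] child(2)[OF v, of True] by simp_all
    from lift_fibre[OF sqrt_ex PQ(1,3) S al this] show ?thesis unfolding PQ(2) .
  qed
  then obtain r0 r1 where r: "\<And>v. length v = m \<Longrightarrow> unram_red (\<psi>' (pt (v @ [False]))) (r0 v) \<and>
      unram_red (\<psi>' (pt (v @ [True]))) (r1 v) \<and> F (r0 v) = \<rho> v \<and> F (r1 v) = \<rho> v \<and> r0 v \<noteq> r1 v"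
    by metis
  define \<rho>' where "\<rho>' w = (if length w \<le> m then \<rho> w else if last w then r1 (butlast w) else r0 (butlast w))" for w
  have new: "pt w \<in> E' \<and> unram_red (\<psi>' (pt w)) (\<rho>' w)" if lw: "length w \<le> Suc m" for w
  proof (cases "length w \<le> m")
    case True
    then show ?thesis using liftedD(6,7)[OF L True] E' by (auto simp: \<rho>'_def)
  next
    case False
    then obtain v x where w: "w = v @ [x]" "length v = m" using lw by (cases w rule: rev_cases) auto
    then show ?thesis using child(1)[OF w(2), of x] r[OF w(2)] by (cases x) (simp_all add: \<rho>'_def)
  qed
  have "lifted \<pi> (Suc m) E' \<psi>' \<rho>'"
    unfolding lifted_def
  proof (intro conjI allI impI ballI)
    show "subfield_set E'" "hom_on E' \<psi>'" "Alg \<subseteq> E'" "t \<in> E'" using E' liftedD[OF L] by auto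
    show "\<psi>' a = fls_const a" if "a \<in> Alg" for a using liftedD(2,5)[OF L] E'(5) that by auto
    show "pt v \<in> E'" "unram_red (\<psi>' (pt v)) (\<rho>' v)" if "length v \<le> Suc m" for v using new[OF that] by auto
    show "\<rho>' [] = \<pi>" using liftedD(8)[OF L] by (simp add: \<rho>'_def)
    fix v :: vertex assume v: "length v < Suc m"
    show "F (\<rho>' (v @ [x])) = \<rho>' v" for x
      using v liftedD(9)[OF L, of v x] r[of v] by (cases "length v < m") (auto simp: \<rho>'_def)
    show "\<rho>' (v @ [False]) \<noteq> \<rho>' (v @ [True])"
      using v liftedD(10)[OF L, of v] r[of v] by (cases "length v < m") (auto simp: \<rho>'_def)
  qed
  then show ?thesis by blast
qed

lemma lifted_iter:
  assumes L: "lifted \<pi> m E \<psi> \<rho>"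
  shows "length v + i \<le> m \<Longrightarrow> length u = i \<Longrightarrow> (F ^^ i) (\<rho> (v @ u)) = \<rho> v"
proof (induction i arbitrary: u)
  case (Suc i)
  then obtain u' x where u: "u = u' @ [x]" "length u' = i" by (cases u rule: rev_cases) auto
  have "F (\<rho> ((v @ u') @ [x])) = \<rho> (v @ u')" using Suc u by (intro liftedD(9)[OF L]) simp
  then show ?case using Suc u by (simp add: funpow_swap1)
qed simp

text \<open>A vertex of level \<open>m\<close> reduces to a point that reaches \<open>\<pi>\<close>
  after \<open>m\<close> steps, so the hypothesis keeps branch points away from all levels that have
  to be extended.\<close>

lemma lifted_exists:
  assumes nb: "\<And>m p. m < n \<Longrightarrow> branch p \<Longrightarrow> (F ^^ m) p \<noteq> \<pi>"
  shows "\<exists>E \<psi> \<rho>. lifted \<pi> n E \<psi> \<rho>"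
proof -
  have "m \<le> n \<Longrightarrow> \<exists>E \<psi> \<rho>. lifted \<pi> m E \<psi> \<rho>" for m
  proof (induction m)
    case 0
    then show ?case using lifted_0 by blast
  next
    case (Suc m)
    then obtain E \<psi> \<rho> where L: "lifted \<pi> m E \<psi> \<rho>" by auto
    have "\<not> branch (\<rho> v)" if "length v = m" for v
      using nb[of m "\<rho> v"] lifted_iter[OF L, of "[]" m v] liftedD(8)[OF L] that Suc by auto
    then show ?case using lifted_Suc[OF L] by blast
  qed
  then show ?thesis by blast
qed

lemma lifted_inj:
  assumes L: "lifted \<pi> m E \<psi> \<rho>"
  shows "length v \<le> m \<Longrightarrow> length w = length v \<Longrightarrow> \<rho> v = \<rho> w \<Longrightarrow> v = w"
proof (induction v arbitrary: w rule: rev_induct)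
  case (snoc x v)
  then obtain w' y where w: "w = w' @ [y]" "length w' = length v" by (cases w rule: rev_cases) auto
  have "\<rho> v = \<rho> w'"
    using liftedD(9)[OF L, of v x] liftedD(9)[OF L, of w' y] snoc.prems w by simp
  then have "v = w'" using snoc w by simp
  moreover have "x = y"
  proof (rule ccontr)
    assume "x \<noteq> y"
    then have xy: "x = False \<and> y = True \<or> x = True \<and> y = False" by blast
    have e: "\<rho> (v @ [x]) = \<rho> (v @ [y])" using snoc.prems(3) w(1) \<open>v = w'\<close> by simp
    have "length v < m" using snoc.prems(1) by simp
    then show False using liftedD(10)[OF L] e xy by metis
  qed
  ultimately show ?case using w by simp
qed simp

text \<open>The children of a vertex have two distinct reductions in a fibre of at most two points,
  so they exhaust it.\<close>

lemma lifted_surj: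
  assumes L: "lifted \<pi> m E \<psi> \<rho>"
  shows "j \<le> m \<Longrightarrow> (F ^^ j) p = \<pi> \<Longrightarrow> \<exists>v. length v = j \<and> \<rho> v = p"
proof (induction j arbitrary: p)
  case 0
  then show ?case using liftedD(8)[OF L] by auto
next
  case (Suc j)
  then have "(F ^^ j) (F p) = \<pi>" by (simp add: funpow_swap1)
  then obtain v where v: "length v = j" "\<rho> v = F p" using Suc by auto
  have "F (\<rho> (v @ [False])) = F p" "F (\<rho> (v @ [True])) = F p" "\<rho> (v @ [False]) \<noteq> \<rho> (v @ [True])"
    using liftedD(9,10)[OF L, of v] v Suc by auto
  then have "p = \<rho> (v @ [False]) \<or> p = \<rho> (v @ [True])"
    using fibre_at_most_two[of "\<rho> (v @ [False])" "F p" "\<rho> (v @ [True])" p] by simp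
  then show ?case using v by (metis length_append_singleton)
qed

text \<open>The square roots in \<open>S\<close> exist in the Laurent series field, whereas \<open>sq x\<close> would have half-integral
  order. Hence some automorphism fixes \<open>S\<close> and negates \<open>sq x\<close>.\<close>

lemma inertia_element:
  assumes L: "lifted \<pi> n E \<psi> \<rho>" and x: "length x = n" "branch (\<rho> x)"
  shows "\<exists>g\<in>GalGeom. level_agree n (monodromy \<phi> g) id \<and> swap_set n (monodromy \<phi> g) = {v \<in> words n. branch (\<rho> v)}"
proof -
  define X where "X = {v \<in> words n. branch (\<rho> v)}"
  note E = liftedD(1)[OF L] and h = liftedD(4)[OF L]
  \<comment> \<open>A single \<open>sq v\<close> over a branch point cannot be reached, but its
    product with \<open>sq x\<close> can. Fixing these products forces an automorphism that negates
    \<open>sq x\<close> to negate every such \<open>sq v\<close>.\<close>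
  define S where "S = sq ` (words n - X) \<union> (\<lambda>v. sq x * sq v) ` (X - {x})"
  have fin: "finite S" by (simp add: S_def X_def)
  have sqE: "(sq v)\<^sup>2 \<in> E" "\<psi> ((sq v)\<^sup>2) = disc (\<psi> (pt v))" if "length v = n" for v
    using lifted_disc[OF L, of v] that by (simp_all add: sq_square)
  have "\<exists>E' \<psi>'. subfield_set E' \<and> E \<subseteq> E' \<and> S \<subseteq> E' \<and> hom_on E' \<psi>' \<and> (\<forall>x\<in>E. \<psi>' x = \<psi> x)"
  proof (rule hom_on_adjoin_sqrts[OF E h fin])
    fix s assume "s \<in> S"
    then consider v where "s = sq v" "length v = n" "\<not> branch (\<rho> v)"
      | v where "s = sq x * sq v" "length v = n" "branch (\<rho> v)"
      by (auto simp: S_def X_def words_def)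
    then show "s\<^sup>2 \<in> E \<and> (\<exists>m. m\<^sup>2 = \<psi> (s\<^sup>2))"
    proof cases
      case 1
      obtain P Q where "unram_rep (\<psi> (pt v)) P Q" "D (P $ 0) (Q $ 0) \<noteq> 0"
        using unram_red_cases[OF liftedD(7)[OF L, of v]] 1 by (metis order_refl)
      then show ?thesis using disc_square[OF sqrt_ex] sqE[OF 1(2)] 1(1) by metis
    next
      case 2
      obtain P Q where r: "unram_rep (\<psi> (pt v)) P Q" "D (P $ 0) (Q $ 0) = 0"
        using unram_red_cases[OF liftedD(7)[OF L, of v]] 2 by (metis order_refl)
      obtain P' Q' where r': "unram_rep (\<psi> (pt x)) P' Q'" "D (P' $ 0) (Q' $ 0) = 0"
        using unram_red_cases[OF liftedD(7)[OF L, of x]] x by (metis order_refl)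
      have "s\<^sup>2 = (sq x)\<^sup>2 * (sq v)\<^sup>2" by (simp add: 2(1) power_mult_distrib)
      then have "s\<^sup>2 \<in> E" "\<psi> (s\<^sup>2) = disc (\<psi> (pt x)) * disc (\<psi> (pt v))"
        using sqE[OF 2(2)] sqE[OF x(1)] hom_onD(3)[OF h] subfield_setD(4)[OF E] by simp_all
      then show ?thesis using disc_product_square[OF sqrt_ex r'(1) r(1) r'(2) r(2)] by simp
    qed
  qed
  then obtain E' \<psi>' where E': "subfield_set E'" "E \<subseteq> E'" "S \<subseteq> E'" "hom_on E' \<psi>'" "\<forall>x\<in>E. \<psi>' x = \<psi> x"
    by blast
  have sx: "sq x \<notin> E'"
  proof
    assume s: "sq x \<in> E'"
    obtain P Q where r: "unram_rep (\<psi> (pt x)) P Q" "D (P $ 0) (Q $ 0) = 0"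
      using unram_red_cases[OF liftedD(7)[OF L, of x]] x by (metis order_refl)
    have "(\<psi>' (sq x))\<^sup>2 = \<psi>' ((sq x)\<^sup>2)" using s by (simp add: hom_on_power[OF E'(1,4)])
    also have "\<dots> = disc (\<psi> (pt x))" using E'(5) sqE[OF x(1)] by simp
    finally show False using disc_not_square[OF sqrt_ex r] by simp
  qed
  have AlgE': "Alg \<subseteq> E'" "t \<in> E'" using liftedD(2,3)[OF L] E'(2) by auto
  have K: "range \<iota> \<subseteq> E'" using range_c_Alg AlgE' by (intro range_\<iota>_subset E') auto
  have "(sq x)\<^sup>2 \<in> E'" using sqE[OF x(1)] E'(2) by auto
  then obtain g where g: "g \<in> galois_group E'" "g (sq x) = - sq x"
    using galois_group_negates_sqrt[OF sc E'(1) K _ sx] by blast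
  have gG: "g \<in> GalGeom"
    using g(1) galois_group_sub_GalGeom[OF E'(1)] const_closure_Alg AlgE' by blast
  then have gGal: "g \<in> Gal" using GalGeom_sub_Gal by blast
  have fixE: "g z = z" if "z \<in> E'" for z using g(1) that by (simp add: galois_group_def)
  have triv: "monodromy \<phi> g v = v" if "length v \<le> n" for v
    using that liftedD(6)[OF L, of v] E'(2) fixE by (intro monodromy_eqI[OF gGal]) auto
  have sw: "swaps (monodromy \<phi> g) v \<longleftrightarrow> g (sq v) = - sq v" if "length v = n" for v
  proof -
    have "- sq v \<noteq> sq v" using sq_nonzero[of v] two by (metis add.inverse_unique mult_2 mult_eq_0_iff add_eq_0_iff)
    then show ?thesis using Gal_sq[OF gGal, of v] triv[of v] that by auto
  qed
  have "swaps (monodromy \<phi> g) v \<longleftrightarrow> v \<in> X" if v: "length v = n" for v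
  proof (cases "v \<in> X")
    case False
    then have "sq v \<in> E'" using v E'(3) by (auto simp: S_def words_def)
    then have "g (sq v) = sq v" by (rule fixE)
    moreover have "- sq v \<noteq> sq v" using sq_nonzero[of v] two by (metis add.inverse_unique mult_2 mult_eq_0_iff add_eq_0_iff)
    ultimately show ?thesis using sw[OF v] False by metis
  next
    case True
    have "g (sq v) = - sq v"
    proof (cases "v = x")
      case False
      then have "sq x * sq v \<in> E'" using True E'(3) by (auto simp: S_def)
      then have "g (sq x * sq v) = sq x * sq v" by (rule fixE)
      then have "- sq x * g (sq v) = sq x * sq v" by (simp add: Gal_simps[OF gGal] g(2))
      then have "sq x * (- g (sq v)) = sq x * sq v" by simp
      then have "- g (sq v) = sq v" using sq_nonzero[of x] by (metis mult_left_cancel)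
      then show ?thesis by (metis minus_minus)
    qed (simp add: g(2))
    then show ?thesis using sw[OF v] True by simp
  qed
  then have "swap_set n (monodromy \<phi> g) = X" by (auto simp: swap_set_def words_def X_def)
  moreover have "level_agree n (monodromy \<phi> g) id" using triv by (simp add: level_agree_def)
  ultimately show ?thesis using gG X_def by blast
qed

text \<open>No branch point reaches the \<open>n\<close>-th iterate of \<open>p1\<close> in fewer
  than \<open>n\<close> steps, so the place exists up to level \<open>n\<close>. There
  \<open>new\<close> with \<open>m = n\<close> excludes \<open>q1\<close>, so exactly one vertex
  reduces to a branch point.\<close>

lemma single_swap_exists:
  assumes br: "\<And>p. branch p \<longleftrightarrow> p = p1 \<or> p = q1"
    and new: "\<And>m. m < n \<Longrightarrow> (F ^^ m) p1 \<noteq> (F ^^ n) p1" "\<And>m. m \<le> n \<Longrightarrow> (F ^^ m) q1 \<noteq> (F ^^ n) p1"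
  shows "\<exists>h\<in>G_geom \<iota> \<phi>. single_swap n h"
proof -
  define \<pi> where "\<pi> = (F ^^ n) p1"
  have "(F ^^ m) p \<noteq> \<pi>" if "m < n" "branch p" for m p
    using br[of p] new(1)[of m] new(2)[of m] that by (auto simp: \<pi>_def)
  then obtain E \<psi> \<rho> where L: "lifted \<pi> n E \<psi> \<rho>" using lifted_exists by blast
  obtain x where x: "length x = n" "\<rho> x = p1" using lifted_surj[OF L order_refl, of p1] by (auto simp: \<pi>_def)
  have bx: "branch (\<rho> x)" using br x by simp
  have "{v \<in> words n. branch (\<rho> v)} = {x}"
  proof (intro equalityI subsetI)
    fix v assume "v \<in> {v \<in> words n. branch (\<rho> v)}"
    then have v: "length v = n" "\<rho> v = p1 \<or> \<rho> v = q1" using br by (auto simp: words_def)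
    have "(F ^^ n) (\<rho> v) = \<pi>" using lifted_iter[OF L, of "[]" n v] v liftedD(8)[OF L] by simp
    then have "\<rho> v = p1" using v(2) new(2)[of n] by (auto simp: \<pi>_def)
    then show "v \<in> {x}" using lifted_inj[OF L, of v x] v x by simp
  qed (use x bx in \<open>simp add: words_def\<close>)
  then show ?thesis using inertia_element[OF L x(1) bx] x(1)
    unfolding G_geom_eq single_swap_def by auto
qed

text \<open>The vertices over \<open>p1\<close> and \<open>q1\<close> have reductions that merge
  precisely at step \<open>r\<close>. Reduction is injective on levels, so their ancestors agree on
  level \<open>n - r\<close> and differ one level further down.\<close>

lemma double_swap_exists:
  assumes br: "\<And>p. branch p \<longleftrightarrow> p = p1 \<or> p = q1" and r: "r \<ge> 1" "r \<le> n"
    and new: "\<And>m. m < n \<Longrightarrow> (F ^^ m) p1 \<noteq> (F ^^ n) p1" "\<And>m. m < n \<Longrightarrow> (F ^^ m) q1 \<noteq> (F ^^ n) p1"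
    and coll: "(F ^^ r) p1 = (F ^^ r) q1" "(F ^^ (r - 1)) p1 \<noteq> (F ^^ (r - 1)) q1"
  shows "\<exists>h\<in>G_geom \<iota> \<phi>. double_swap r n h"
proof -
  define \<pi> where "\<pi> = (F ^^ n) p1"
  have split: "(F ^^ n) p = (F ^^ (n - r)) ((F ^^ r) p)" for p
    using r by (simp add: funpow_add[symmetric, THEN fun_cong, unfolded comp_apply])
  have \<pi>q: "(F ^^ n) q1 = \<pi>" unfolding \<pi>_def split coll(1) ..
  have "(F ^^ m) p \<noteq> \<pi>" if "m < n" "branch p" for m p
    using br[of p] new(1)[of m] new(2)[of m] that by (auto simp: \<pi>_def)
  then obtain E \<psi> \<rho> where L: "lifted \<pi> n E \<psi> \<rho>" using lifted_exists by blast
  obtain x where x: "length x = n" "\<rho> x = p1" using lifted_surj[OF L order_refl, of p1] by (auto simp: \<pi>_def)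
  obtain y where y: "length y = n" "\<rho> y = q1" using lifted_surj[OF L order_refl \<pi>q] by blast
  have bx: "branch (\<rho> x)" using br x by simp
  have set: "{v \<in> words n. branch (\<rho> v)} = {x, y}"
  proof (intro equalityI subsetI)
    fix v assume "v \<in> {v \<in> words n. branch (\<rho> v)}"
    then have v: "length v = n" "\<rho> v = p1 \<or> \<rho> v = q1" using br by (auto simp: words_def)
    then show "v \<in> {x, y}" using lifted_inj[OF L, of v x] lifted_inj[OF L, of v y] x y by auto
  next
    fix v assume "v \<in> {x, y}"
    then show "v \<in> {v \<in> words n. branch (\<rho> v)}" using x y br by (auto simp: words_def)
  qed
  have anc: "\<rho> (take (n - j) v) = (F ^^ j) (\<rho> v)" if "length v = n" "j \<le> n" for v j
    using lifted_iter[OF L, of "take (n - j) v" j "drop (n - j) v"] that by simp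
  have "\<rho> (take (n - r) x) = \<rho> (take (n - r) y)" using anc x y r coll(1) by simp
  then have 1: "take (n - r) x = take (n - r) y" using lifted_inj[OF L, of "take (n - r) x" "take (n - r) y"] x y by simp
  have "x ! (n - r) \<noteq> y ! (n - r)"
  proof
    assume "x ! (n - r) = y ! (n - r)"
    then have "take (Suc (n - r)) x = take (Suc (n - r)) y"
      using 1 x y r by (simp add: take_Suc_eq_iff)
    moreover have "Suc (n - r) = n - (r - 1)" using r by simp
    ultimately have "\<rho> (take (n - (r - 1)) x) = \<rho> (take (n - (r - 1)) y)" by simp
    then show False using anc[OF x(1), of "r - 1"] anc[OF y(1), of "r - 1"] x y r coll(2) by simp
  qed
  then have "meet_at (n - r) x y" using 1 x y r by (simp add: meet_at_def)
  then show ?thesis using inertia_element[OF L x(1) bx] x(1) unfolding set G_geom_eq double_swap_def by auto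
qed

end

section \<open>The norm of the discriminant\<close>

context iterated_map
begin

text \<open>Its square is the resultant and at the same time a quarter of the discriminant of
  \<open>J\<close>, so it generates the field of definition of the critical points.\<close>

definition "\<theta> = (SOME r. r\<^sup>2 = (a2 * b0 - a0 * b2)\<^sup>2 - (a2 * b1 - a1 * b2) * (a1 * b0 - a0 * b1))"

lemma \<theta>_square: "\<theta>\<^sup>2 = (a2 * b0 - a0 * b2)\<^sup>2 - (a2 * b1 - a1 * b2) * (a1 * b0 - a0 * b1)"
  unfolding \<theta>_def using sqrt_ex by (rule someI_ex)

lemma \<theta>_nonzero: "\<theta> \<noteq> 0"
  using res \<theta>_square by auto

text \<open>The field generated over the constants by the critical points.\<close>

definition "K0 = {c a + c b * \<theta> | a b. True}"

lemma range_c_subfield: "subfield_set (range c)"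
  using field_hom_simps[OF c_hom] unfolding subfield_set_def by (auto simp: image_iff) metis+

lemma \<theta>_square_const: "\<theta>\<^sup>2 \<in> range c"
  unfolding \<theta>_square using coeffs
  by (intro subfield_set_more[OF range_c_subfield] subfield_setD[OF range_c_subfield]) auto

lemma range_c_K0: "range c \<subseteq> K0"
proof
  fix x assume "x \<in> range c"
  then obtain a where "x = c a + c 0 * \<theta>" using field_hom_simps[OF c_hom] by auto
  then show "x \<in> K0" unfolding K0_def by blast
qed

lemma K0I: "x \<in> range c \<Longrightarrow> y \<in> range c \<Longrightarrow> x + y * \<theta> \<in> K0"
  unfolding K0_def by blast

lemma \<theta>_K0: "\<theta> \<in> K0"
  using K0I[of 0 1] subfield_setD[OF range_c_subfield] by simp

lemma subfield_K0: "subfield_set K0"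
  unfolding subfield_set_def
proof (intro conjI ballI)
  note cl = subfield_setD[OF range_c_subfield] subfield_set_more[OF range_c_subfield]
  show "0 \<in> K0" "1 \<in> K0" using range_c_K0 cl(1,2) by auto
  fix x assume "x \<in> K0"
  then obtain a b where x: "a \<in> range c" "b \<in> range c" "x = a + b * \<theta>" unfolding K0_def by blast
  have "- x = - a + (- b) * \<theta>" by (simp add: x)
  then show "- x \<in> K0" using K0I[OF cl(5)[OF x(1)] cl(5)[OF x(2)]] by simp
  show "inverse x \<in> K0"
  \<comment> \<open>The conjugate of a nonzero element vanishes only if \<open>\<theta>\<close>
    already lies in \<open>range c\<close>; rationalising the denominator then fails, but
    \<open>x\<close> itself lies in the base field.\<close>
  proof (cases "a - b * \<theta> = 0")
    case True
    then have "x = a + a" by (simp add: x)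
    then have "inverse x \<in> range c" using cl(6)[OF cl(3)[OF x(1) x(1)]] by simp
    then show ?thesis using range_c_K0 by blast
  next
    case False
    show ?thesis
    proof (cases "x = 0")
      case True
      then show ?thesis using \<open>x \<in> K0\<close> by simp
    next
      case x0: False
      define n where "n = a\<^sup>2 - b\<^sup>2 * \<theta>\<^sup>2"
      have n: "n = x * (a - b * \<theta>)" by (simp add: n_def x power2_eq_square algebra_simps)
      then have "n \<noteq> 0" using False x0 by simp
      have nc: "n \<in> range c" unfolding n_def by (intro cl x \<theta>_square_const)
      have "inverse x = (a - b * \<theta>) / n" unfolding n using False x0 by (simp add: inverse_eq_divide)
      also have "\<dots> = a / n + (- b / n) * \<theta>" by (simp add: diff_divide_distrib)
      finally show ?thesis using K0I[OF cl(8)[OF x(1) nc] cl(8)[OF cl(5)[OF x(2)] nc]] by simp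
    qed
  qed
  fix y assume "y \<in> K0"
  then obtain a' b' where y: "a' \<in> range c" "b' \<in> range c" "y = a' + b' * \<theta>" unfolding K0_def by blast
  have "x + y = (a + a') + (b + b') * \<theta>" by (simp add: x y algebra_simps)
  then show "x + y \<in> K0" using K0I[OF cl(3)[OF x(1) y(1)] cl(3)[OF x(2) y(2)]] by simp
  have "x * y = (a * a' + b * b' * \<theta>\<^sup>2) + (a * b' + b * a') * \<theta>"
    by (simp add: x y power2_eq_square algebra_simps)
  moreover have "a * a' + b * b' * \<theta>\<^sup>2 \<in> range c"
    by (rule cl(3)[OF cl(4)[OF x(1) y(1)] cl(4)[OF cl(4)[OF x(2) y(2)] \<theta>_square_const]])
  moreover have "a * b' + b * a' \<in> range c"
    by (rule cl(3)[OF cl(4)[OF x(1) y(2)] cl(4)[OF x(2) y(1)]])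
  ultimately show "x * y \<in> K0" using K0I by simp
qed

text \<open>Geometric automorphisms fix separable constants, hence also the square root of the
  constant in the norm of the discriminant.\<close>

lemma sqrt_K0:
  assumes "w \<in> K0" "s\<^sup>2 = w" shows "s \<in> const_closure \<iota>"
proof -
  obtain a b where w: "w = c a + c b * \<theta>" using assms by (auto simp: K0_def)
  obtain \<delta> where d: "\<theta>\<^sup>2 = c \<delta>" using \<theta>_square_const by blast
  have "c 2 = 2" using field_hom_simps(3)[OF c_hom, of 1 1] field_hom_simps(2)[OF c_hom] by simp
  then have "(2::'k) \<noteq> 0" using two field_hom_simps(5)[OF c_hom, of 2] by auto
  then show ?thesis
    using separable_sqrt_of_quadratic[OF c_hom _ d w assms(2)] by (simp add: const_closure_def)
qed

lemma K0_const_closure: "K0 \<subseteq> const_closure \<iota>"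
proof
  fix w assume "w \<in> K0"
  then have "w\<^sup>2 \<in> K0" by (rule subfield_set_more(3)[OF subfield_K0])
  then show "w \<in> const_closure \<iota>" using sqrt_K0 by blast
qed

lemma coeffs_K0: "a0 \<in> K0" "a1 \<in> K0" "a2 \<in> K0" "b0 \<in> K0" "b1 \<in> K0" "b2 \<in> K0"
  using coeffs range_c_K0 by auto

lemma px_py_mem: "subfield_set E \<Longrightarrow> p \<in> proj_points E \<Longrightarrow> px p \<in> E \<and> py p \<in> E"
  by (auto simp: proj_points_def subfield_setD)

text \<open>If the leading coefficient \<open>\<alpha>\<close> of \<open>J\<close> vanishes,
  infinity is critical; otherwise completing the square expresses both zeros through
  \<open>\<theta>\<close>.\<close>

lemma critical_points_exist:
  "\<exists>p q. p \<noteq> q \<and> p \<in> proj_points K0 \<and> q \<in> proj_points K0 \<and>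
    (\<forall>z. J (px z) (py z) = 0 \<longleftrightarrow> z = p \<or> z = q)"
proof -
  define \<alpha> \<beta> \<gamma> where "\<alpha> = a2 * b1 - a1 * b2" and "\<beta> = a2 * b0 - a0 * b2" and "\<gamma> = a1 * b0 - a0 * b1"
  note cl = subfield_setD[OF subfield_K0] subfield_set_more[OF subfield_K0]
  have mem: "\<alpha> \<in> K0" "\<beta> \<in> K0" "\<gamma> \<in> K0" using coeffs_K0 cl by (auto simp: \<alpha>_def \<beta>_def \<gamma>_def)
  have th: "\<theta>\<^sup>2 = \<beta>\<^sup>2 - \<alpha> * \<gamma>" unfolding \<theta>_square by (simp add: \<alpha>_def \<beta>_def \<gamma>_def)
  have Jx: "J x y = \<alpha> * x\<^sup>2 + 2 * \<beta> * x * y + \<gamma> * y\<^sup>2" for x y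
    by (simp add: J_def qform_def \<alpha>_def \<beta>_def \<gamma>_def)
  show ?thesis
  proof (cases "\<alpha> = 0")
    case True
    then have b: "\<beta> \<noteq> 0" using th \<theta>_nonzero by auto
    have "J (px z) (py z) = 0 \<longleftrightarrow> z = Infty \<or> z = Fin (- \<gamma> / (2 * \<beta>))" for z
      using True b two by (cases z) (auto simp: Jx field_simps eq_neg_iff_add_eq_0)
    moreover have "Fin (- \<gamma> / (2 * \<beta>)) \<in> proj_points K0"
      unfolding proj_points_def using mem by (intro insertI2 imageI cl)
    ultimately show ?thesis by (intro exI[of _ Infty] exI[of _ "Fin (- \<gamma> / (2 * \<beta>))"]) (auto simp: proj_points_def)
  next
    case False
    have "\<alpha> * J x 1 = (\<alpha> * x + \<beta>)\<^sup>2 - \<theta>\<^sup>2" for x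
      unfolding Jx th by (simp add: power2_eq_square algebra_simps)
    then have "J x 1 = 0 \<longleftrightarrow> (\<alpha> * x + \<beta>)\<^sup>2 = \<theta>\<^sup>2" for x
      using False by (metis eq_iff_diff_eq_0 mult_eq_0_iff)
    then have "J x 1 = 0 \<longleftrightarrow> \<alpha> * x + \<beta> = \<theta> \<or> \<alpha> * x + \<beta> = - \<theta>" for x by (simp add: power2_eq_iff)
    moreover have "\<alpha> * x + \<beta> = y \<longleftrightarrow> x = (- \<beta> + y) / \<alpha>" for x y using False by (auto simp: field_simps)
    moreover have "J 1 0 \<noteq> 0" using False by (simp add: Jx)
    ultimately have "J (px z) (py z) = 0 \<longleftrightarrow> z = Fin ((- \<beta> + \<theta>) / \<alpha>) \<or> z = Fin ((- \<beta> + (- \<theta>)) / \<alpha>)" for z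
      by (cases z) auto
    moreover have "Fin ((- \<beta> + \<theta>) / \<alpha>) \<in> proj_points K0"
      unfolding proj_points_def by (rule insertI2, rule imageI, rule cl(8)[OF cl(3)[OF cl(5)[OF mem(2)] \<theta>_K0] mem(1)])
    moreover have "Fin ((- \<beta> + (- \<theta>)) / \<alpha>) \<in> proj_points K0"
      unfolding proj_points_def
      by (rule insertI2, rule imageI, rule cl(8)[OF cl(3)[OF cl(5)[OF mem(2)] cl(5)[OF \<theta>_K0]] mem(1)])
    moreover have "(- \<beta> + \<theta>) / \<alpha> \<noteq> (- \<beta> + (- \<theta>)) / \<alpha>"
    proof
      assume "(- \<beta> + \<theta>) / \<alpha> = (- \<beta> + (- \<theta>)) / \<alpha>"
      then have "- \<beta> + \<theta> = - \<beta> + (- \<theta>)" using False by (metis divide_cancel_right)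
      then have "\<theta> = - \<theta>" by (rule add_left_imp_eq)
      then have "2 * \<theta> = 0" by (simp only: mult_2 eq_neg_iff_add_eq_0)
      then show False using two \<theta>_nonzero by simp
    qed
    ultimately show ?thesis by blast
  qed
qed

text \<open>The linear form vanishing at \<open>p\<close>, which for \<open>p = \<infinity>\<close> is the constant \<open>- 1\<close>.\<close>

definition "ell p x = py p * x - px p"

lemma dis_eq_D: "dis x = D x 1"
  by (simp add: dis_def D_def al_def be_def ga_def)

text \<open>A quadratic form is determined up to a factor by two distinct zeros; the factor is a
  coefficient of \<open>D\<close> up to sign, hence in \<open>K0\<close>.\<close>

lemma dis_factor:
  assumes pq: "p \<noteq> q" "branch p" "branch q" and K: "p \<in> proj_points K0" "q \<in> proj_points K0"
  shows "\<exists>C\<in>K0. \<forall>x. dis x = C * ell p x * ell q x"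
proof -
  define u v w where uvw: "u = b1\<^sup>2 - 4 * b2 * b0" "v = 4 * a2 * b0 + 4 * a0 * b2 - 2 * a1 * b1"
    "w = a1\<^sup>2 - 4 * a2 * a0"
  have Dq: "D x y = u * x\<^sup>2 + v * x * y + w * y\<^sup>2" for x y by (simp add: D_qform qform_def uvw)
  note cl = subfield_setD[OF subfield_K0] subfield_set_more[OF subfield_K0]
  have mem: "u \<in> K0" "v \<in> K0" using coeffs_K0 cl by (auto simp: uvw)
  have inf: "\<exists>C\<in>K0. \<forall>x. dis x = C * ell Infty x * ell (Fin z) x" if "branch Infty" "branch (Fin z)" for z
  proof -
    have "u = 0" "w = - v * z" using that by (auto simp: Dq eq_neg_iff_add_eq_0 add.commute)
    then have "dis x = (- v) * ell Infty x * ell (Fin z) x" for x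
      by (simp add: dis_eq_D Dq ell_def algebra_simps)
    then show ?thesis using cl(5)[OF mem(2)] by blast
  qed
  show ?thesis
  proof (cases p)
    case Infty
    then show ?thesis using inf pq by (cases q) auto
  next
    case (Fin y)
    show ?thesis
    proof (cases q)
      case Infty
      then show ?thesis using inf[of y] pq Fin by (simp add: mult.commute mult.left_commute)
    next
      case q: (Fin z)
      have e: "u * y\<^sup>2 + v * y + w = 0" "u * z\<^sup>2 + v * z + w = 0" using pq Fin q by (simp_all add: Dq)
      have "(y - z) * (u * (y + z) + v) = (u * y\<^sup>2 + v * y + w) - (u * z\<^sup>2 + v * z + w)"
        by (simp add: power2_eq_square algebra_simps)
      moreover have "y \<noteq> z" using pq(1) Fin q by simp
      ultimately have "u * (y + z) + v = 0" using e by simp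
      then have v: "v = - u * (y + z)" by (simp add: eq_neg_iff_add_eq_0 add.commute)
      have "w + (u * y\<^sup>2 + v * y) = 0" using e(1) by (simp add: algebra_simps)
      then have "w = - (u * y\<^sup>2 + v * y)" by (rule eq_neg_iff_add_eq_0[THEN iffD2])
      then have w: "w = u * y * z" by (simp add: v power2_eq_square algebra_simps)
      have "dis x = u * ell p x * ell q x" for x
        by (simp add: dis_eq_D Dq ell_def Fin q v w power2_eq_square algebra_simps)
      then show ?thesis using mem(1) by blast
    qed
  qed
qed

section \<open>Norms along the tree and the parity of blocks\<close>

lemma vieta: "al (pt v) * (pt (v @ [False]) + pt (v @ [True])) = - be (pt v)"
  "ga (pt v) = al (pt v) * (pt (v @ [False]) * pt (v @ [True]))"
proof -
  have "2 * (al (pt v) * (pt (v @ [False]) + pt (v @ [True])) + be (pt v)) =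
      (2 * al (pt v) * pt (v @ [False]) + be (pt v)) + (2 * al (pt v) * pt (v @ [True]) + be (pt v))"
    by (simp add: algebra_simps)
  also have "\<dots> = 0" unfolding sq_child by simp
  finally have "al (pt v) * (pt (v @ [False]) + pt (v @ [True])) + be (pt v) = 0"
    using two mult_eq_0_iff by blast
  then show 1: "al (pt v) * (pt (v @ [False]) + pt (v @ [True])) = - be (pt v)"
    by (rule eq_neg_iff_add_eq_0[THEN iffD2])
  have "ga (pt v) = - (al (pt v) * (pt (v @ [False]))\<^sup>2) + (- be (pt v)) * pt (v @ [False])"
    using pt_equation[of v False] by (simp add: algebra_simps eq_neg_iff_add_eq_0)
  then show "ga (pt v) = al (pt v) * (pt (v @ [False]) * pt (v @ [True]))"
    unfolding 1[symmetric] by (simp add: power2_eq_square algebra_simps)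
qed

text \<open>By Vieta, \<open>al (pt v)\<close> times the product is \<open>A - pt v * B\<close> at
  the coordinates of \<open>p\<close>, which is proportional to the linear form belonging to
  \<open>F p\<close>.\<close>

lemma norm_ell:
  assumes p: "p \<in> proj_points K0"
  shows "\<exists>k\<in>K0. \<forall>v. ell p (pt (v @ [False])) * ell p (pt (v @ [True])) = k * ell (F p) (pt v) / al (pt v)"
proof -
  note cl = subfield_setD[OF subfield_K0] subfield_set_more[OF subfield_K0]
  have m: "px p \<in> K0" "py p \<in> K0" using px_py_mem[OF subfield_K0 p] by auto
  have AB: "A (px p) (py p) \<in> K0" "B (px p) (py p) \<in> K0"
    unfolding A_def B_def qform_def using coeffs_K0 m cl by auto
  obtain k where k: "k \<noteq> 0" "A (px p) (py p) = k * px (F p)" "B (px p) (py p) = k * py (F p)"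
    using quotient_point_scale[OF AB_nonzero[OF px_py_nonzero, of p]] unfolding F_def by metis
  have "k \<in> K0"
  proof (cases "F p")
    case (Fin x)
    then show ?thesis using k(3) AB by simp
  next
    case Infty
    then show ?thesis using k(2) AB by simp
  qed
  then have "- k \<in> K0" by (rule cl)
  moreover have "ell p (pt (v @ [False])) * ell p (pt (v @ [True])) = (- k) * ell (F p) (pt v) / al (pt v)" for v
  proof -
    let ?a = "al (pt v)" and ?z = "pt (v @ [False])" and ?z' = "pt (v @ [True])"
    have "?a * (ell p ?z * ell p ?z') = (?a * (?z * ?z')) * (py p)\<^sup>2 - (?a * (?z + ?z')) * px p * py p + ?a * (px p)\<^sup>2"
      by (simp add: ell_def power2_eq_square algebra_simps)
    also have "\<dots> = A (px p) (py p) - pt v * B (px p) (py p)"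
      unfolding vieta(1) vieta(2)[symmetric]
      by (simp add: A_def B_def qform_def al_def be_def ga_def power2_eq_square algebra_simps)
    also have "\<dots> = (- k) * ell (F p) (pt v)" unfolding k(2,3) by (simp add: ell_def algebra_simps)
    finally show ?thesis using al_pt[of v] by (simp add: field_simps)
  qed
  ultimately show ?thesis by blast
qed

text \<open>Collects the leading coefficients in the denominators of the norms. The linear forms of
  \<open>p\<close> and \<open>q\<close> contribute the same factor each, so only its square enters
  \<open>norm_dis\<close>.\<close>

fun norm_factor :: "nat \<Rightarrow> vertex \<Rightarrow> 'l" where
  "norm_factor 0 v = 1"
| "norm_factor (Suc r) v = norm_factor r (v @ [False]) * norm_factor r (v @ [True]) / al (pt v)"

lemma norm_dis:
  assumes K: "p \<in> proj_points K0" "q \<in> proj_points K0" and C: "C \<in> K0" "\<And>x. dis x = C * ell p x * ell q x"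
  shows "\<exists>C\<in>K0. \<forall>v. (\<Prod>u\<in>words r. dis (pt (v @ u))) = C * ell ((F ^^ r) p) (pt v) * ell ((F ^^ r) q) (pt v) * (norm_factor r v)\<^sup>2"
proof (induction r)
  case 0
  then show ?case using C by auto
next
  case (Suc r)
  then obtain C where C: "C \<in> K0" "\<And>v. (\<Prod>u\<in>words r. dis (pt (v @ u))) =
      C * ell ((F ^^ r) p) (pt v) * ell ((F ^^ r) q) (pt v) * (norm_factor r v)\<^sup>2" by blast
  have Fr: "(F ^^ r) p \<in> proj_points K0" "(F ^^ r) q \<in> proj_points K0"
    using F_iter_proj_points[OF subfield_K0 range_c_K0] K by auto
  obtain k where k: "k \<in> K0" "\<And>v. ell ((F ^^ r) p) (pt (v @ [False])) * ell ((F ^^ r) p) (pt (v @ [True])) =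
      k * ell (F ((F ^^ r) p)) (pt v) / al (pt v)" using norm_ell[OF Fr(1)] by blast
  obtain l where l: "l \<in> K0" "\<And>v. ell ((F ^^ r) q) (pt (v @ [False])) * ell ((F ^^ r) q) (pt (v @ [True])) =
      l * ell (F ((F ^^ r) q)) (pt v) / al (pt v)" using norm_ell[OF Fr(2)] by blast
  have alg: "C\<^sup>2 * (k * e / a) * (l * e' / a) * z\<^sup>2 = C\<^sup>2 * k * l * e * e' * (z / a)\<^sup>2" for a e e' z :: 'l
    by (simp add: power_divide power2_eq_square)
  have "(\<Prod>u\<in>words (Suc r). dis (pt (v @ u))) =
     C\<^sup>2 * k * l * ell ((F ^^ Suc r) p) (pt v) * ell ((F ^^ Suc r) q) (pt v) * (norm_factor (Suc r) v)\<^sup>2" for v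
  proof -
    have "(\<Prod>u\<in>words (Suc r). dis (pt (v @ u))) =
        (\<Prod>u\<in>words r. dis (pt ((v @ [False]) @ u))) * (\<Prod>u\<in>words r. dis (pt ((v @ [True]) @ u)))"
      unfolding prod_words_Suc by simp
    also have "\<dots> = C\<^sup>2 * (ell ((F ^^ r) p) (pt (v @ [False])) * ell ((F ^^ r) p) (pt (v @ [True]))) *
        (ell ((F ^^ r) q) (pt (v @ [False])) * ell ((F ^^ r) q) (pt (v @ [True]))) *
        (norm_factor r (v @ [False]) * norm_factor r (v @ [True]))\<^sup>2"
      unfolding C(2) by (simp only: power2_eq_square mult_ac)
    also have "\<dots> = C\<^sup>2 * k * l * ell ((F ^^ Suc r) p) (pt v) * ell ((F ^^ Suc r) q) (pt v) * (norm_factor (Suc r) v)\<^sup>2"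
      unfolding k(2) l(2) norm_factor.simps funpow.simps comp_apply by (rule alg)
    finally show ?thesis .
  qed
  moreover have "C\<^sup>2 * k * l \<in> K0"
    by (intro subfield_setD(4)[OF subfield_K0] subfield_set_more(3)[OF subfield_K0] C(1) k(1) l(1))
  ultimately show ?case by blast
qed

text \<open>The recursion is symmetric in the two children, so it does not notice whether they are
  swapped.\<close>

lemma Gal_norm_factor:
  assumes g: "g \<in> Gal" shows "g (norm_factor r v) = norm_factor r (monodromy \<phi> g v)"
proof (induction r arbitrary: v)
  case 0
  then show ?case by (simp add: Gal_simps[OF g])
next
  case (Suc r)
  have "monodromy \<phi> g (v @ [x]) = monodromy \<phi> g v @ [x \<noteq> swaps (monodromy \<phi> g) v]" for x by (rule tree_aut_snoc[OF monodromy_aut[OF g]])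
  then show ?case
    by (cases "swaps (monodromy \<phi> g) v") (simp_all add: Gal_simps[OF g] Suc Gal_al[OF g] pt_monodromy[OF g] mult.commute)
qed

lemma GalGeom_fix: "g \<in> GalGeom \<Longrightarrow> x \<in> const_closure \<iota> \<Longrightarrow> g x = x"
  using simple_ext_mem(2) by (auto simp: GalGeom_def galois_group_def)

lemma GalGeom_ell:
  assumes g: "g \<in> GalGeom" and p: "p \<in> proj_points K0" shows "g (ell p x) = ell p (g x)"
proof -
  have gG: "g \<in> Gal" using g GalGeom_sub_Gal by blast
  have "g (px p) = px p" "g (py p) = py p"
    using px_py_mem[OF subfield_K0 p] K0_const_closure GalGeom_fix[OF g] by auto
  then show ?thesis by (simp add: ell_def Gal_simps[OF gG])
qed

text \<open>As \<open>p\<close> and \<open>q\<close> collide after \<open>r\<close> steps, the norm of the discriminant is the square of a Galois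
  equivariant function \<open>H\<close> of the vertex; \<open>\<eta>\<close> is the sign relating \<open>H\<close> to the product of the chosen
  square roots.\<close>

theorem block_sgn_G_geom:
  assumes pq: "p \<noteq> q" "branch p" "branch q" and K: "p \<in> proj_points K0" "q \<in> proj_points K0"
    and coll: "(F ^^ r) p = (F ^^ r) q"
  shows "\<exists>\<eta>. (\<forall>v. \<eta> v = 1 \<or> \<eta> v = - 1) \<and> (\<forall>h\<in>G_geom \<iota> \<phi>. \<forall>v. block_sgn r h v = \<eta> v * \<eta> (h v))"
proof -
  obtain C0 where C0: "C0 \<in> K0" "\<And>x. dis x = C0 * ell p x * ell q x" using dis_factor[OF pq K] by blast
  obtain C where C: "C \<in> K0" "\<And>v. (\<Prod>u\<in>words r. dis (pt (v @ u))) =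
      C * ell ((F ^^ r) p) (pt v) * ell ((F ^^ r) q) (pt v) * (norm_factor r v)\<^sup>2"
    using norm_dis[OF K C0] by blast
  obtain \<sigma> where \<sigma>: "\<sigma>\<^sup>2 = C" using sqrt_ex by blast
  have \<sigma>c: "\<sigma> \<in> const_closure \<iota>" by (rule sqrt_K0[OF C(1) \<sigma>])
  define \<pi> where "\<pi> = (F ^^ r) p"
  have \<pi>: "\<pi> \<in> proj_points K0" unfolding \<pi>_def by (rule F_iter_proj_points[OF subfield_K0 range_c_K0 K(1)])
  define H where "H v = \<sigma> * ell \<pi> (pt v) * norm_factor r v" for v
  define P where "P v = (\<Prod>u\<in>words r. sq (v @ u))" for v
  have "(P v)\<^sup>2 = (H v)\<^sup>2" for v
  proof -
    have "(P v)\<^sup>2 = (\<Prod>u\<in>words r. dis (pt (v @ u)))" by (simp add: P_def prod_power_distrib sq_square)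
    also have "\<dots> = (H v)\<^sup>2" unfolding C(2) coll[symmetric] \<pi>_def[symmetric] H_def \<sigma>[symmetric]
      by (simp add: power2_eq_square)
    finally show ?thesis .
  qed
  then have PH: "P v = H v \<or> P v = - H v" for v by (simp add: power2_eq_iff)
  have Pn: "P v \<noteq> 0" for v by (simp add: P_def sq_nonzero)
  have Hn: "H v \<noteq> 0" for v using PH[of v] Pn[of v] by auto
  define \<eta> :: "vertex \<Rightarrow> int" where "\<eta> v = (if P v = H v then 1 else - 1)" for v
  have P_eta: "P v = of_int (\<eta> v) * H v" for v using PH[of v] by (auto simp: \<eta>_def)
  have "block_sgn r (monodromy \<phi> g) v = \<eta> v * \<eta> (monodromy \<phi> g v)" if g: "g \<in> GalGeom" for g v
  proof -
    have gG: "g \<in> Gal" using g GalGeom_sub_Gal by blast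
    let ?m = "monodromy \<phi> g"
    have m: "?m \<in> tree_auts" by (rule monodromy_aut[OF gG])
    have gH: "g (H v) = H (?m v)"
      by (simp add: H_def Gal_simps[OF gG] GalGeom_fix[OF g \<sigma>c] GalGeom_ell[OF g \<pi>] Gal_norm_factor[OF gG] pt_monodromy[OF gG])
    have gi: "g (of_int k) = of_int k" if "k = 1 \<or> k = - 1" for k using that by (auto simp: Gal_simps[OF gG])
    have "g (P v) = of_int (\<eta> v) * H (?m v)"
      unfolding P_eta Gal_simps(4)[OF gG] gH by (subst gi) (auto simp: \<eta>_def)
    moreover have "g (P v) = of_int (block_sgn r ?m v) * P (?m v)"
    proof -
      have "g (P v) = (\<Prod>u\<in>words r. g (sq (v @ u)))"
        unfolding P_def by (rule hom_on_prod[OF subfield_set_UNIV GalD(2)[OF gG]]) simp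
      also have "\<dots> = (\<Prod>u\<in>words r. of_int (bsgn (swaps ?m (v @ u))) * sq (?m (v @ u)))"
        by (rule prod.cong) (simp_all add: Gal_sq[OF gG] bsgn_def)
      also have "\<dots> = of_int (block_sgn r ?m v) * (\<Prod>u\<in>words r. sq (?m (v @ u)))"
        by (simp add: prod.distrib block_sgn_def)
      also have "(\<Prod>u\<in>words r. sq (?m (v @ u))) = (\<Prod>u\<in>words r. sq (?m v @ drop (length v) (?m (v @ u))))"
        using block_reindex(2)[OF m] by simp
      also have "\<dots> = P (?m v)" unfolding P_def
        by (rule prod.reindex_bij_betw) (rule block_reindex(1)[OF m])
      finally show ?thesis .
    qed
    ultimately have "of_int (\<eta> v) * H (?m v) = of_int (block_sgn r ?m v) * P (?m v)" by simp
    then have "of_int (\<eta> v) * H (?m v) = of_int (block_sgn r ?m v) * (of_int (\<eta> (?m v)) * H (?m v))"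
      unfolding P_eta[of "?m v"] .
    then have e: "(of_int (\<eta> v) :: 'l) = of_int (block_sgn r ?m v * \<eta> (?m v))"
      using Hn[of "?m v"] by (metis mult.assoc mult_right_cancel of_int_mult)
    \<comment> \<open>The equation \<open>e\<close> holds in the field; since the characteristic is
      not 2 it determines the integer signs.\<close>
    have "(1::'l) \<noteq> - 1"
    proof
      assume "(1::'l) = - 1"
      then have "(1::'l) + 1 = 0" by (simp add: eq_neg_iff_add_eq_0)
      then show False using two by simp
    qed
    then have inj: "a = b" if "(of_int a :: 'l) = of_int b" "a = 1 \<or> a = - 1" "b = 1 \<or> b = - 1" for a b :: int
      using that by (elim disjE) simp_all
    have pm: "\<eta> v = 1 \<or> \<eta> v = - 1" "\<eta> (?m v) = 1 \<or> \<eta> (?m v) = - 1" by (auto simp: \<eta>_def)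
    have "\<eta> v = block_sgn r ?m v * \<eta> (?m v)"
      by (rule inj[OF e]) (use pm block_sgn_values[of r ?m v] in auto)
    then show ?thesis using pm(2) by auto
  qed
  moreover have "\<forall>v. \<eta> v = 1 \<or> \<eta> v = - 1" by (simp add: \<eta>_def)
  ultimately show ?thesis unfolding G_geom_eq by (intro exI[of _ \<eta>]) auto
qed

end

section \<open>Orbits\<close>

lemma finite_orbit_if_repeat:
  fixes f :: "'a \<Rightarrow> 'a"
  assumes "(f ^^ i) x = (f ^^ j) x" "i < j"
  shows "finite (range (\<lambda>n. (f ^^ n) x))"
proof -
  have "(f ^^ n) x \<in> (\<lambda>k. (f ^^ k) x) ` {..<j}" for n
  proof (induction n)
    case 0
    then show ?case using assms(2) by (intro image_eqI[of _ _ 0]) auto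
  next
    case (Suc n)
    then obtain k where k: "k < j" "(f ^^ n) x = (f ^^ k) x" by auto
    show ?case
    proof (cases "Suc k < j")
      case True
      then show ?thesis using k by (intro image_eqI[of _ _ "Suc k"]) auto
    next
      case False
      then have "Suc k = j" using k by simp
      then have "(f ^^ Suc n) x = (f ^^ i) x" using k(2) assms(1) by auto
      then show ?thesis using assms(2) by (intro image_eqI[of _ _ i]) auto
    qed
  qed
  then have "range (\<lambda>n. (f ^^ n) x) \<subseteq> (\<lambda>k. (f ^^ k) x) ` {..<j}" by blast
  then show ?thesis by (rule finite_subset) simp
qed

lemma finite_orbit_trans:
  fixes f :: "'a \<Rightarrow> 'a"
  assumes "(f ^^ i) x = (f ^^ j) y" "finite (range (\<lambda>n. (f ^^ n) y))"
  shows "finite (range (\<lambda>n. (f ^^ n) x))"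
proof -
  have "(f ^^ n) x \<in> (\<lambda>n. (f ^^ n) x) ` {..<i} \<union> range (\<lambda>n. (f ^^ n) y)" for n
  proof (cases "n < i")
    case False
    then have "(f ^^ n) x = (f ^^ (n - i)) ((f ^^ i) x)" by (simp add: funpow_add[symmetric, THEN fun_cong, unfolded comp_apply])
    also have "\<dots> = (f ^^ (n - i + j)) y" unfolding assms(1) by (simp add: funpow_add)
    finally show ?thesis by blast
  qed auto
  then have "range (\<lambda>n. (f ^^ n) x) \<subseteq> (\<lambda>n. (f ^^ n) x) ` {..<i} \<union> range (\<lambda>n. (f ^^ n) y)" by blast
  then show ?thesis by (rule finite_subset) (use assms(2) in simp)
qed

text \<open>At every step \<open>n\<close> one of the two orbits reaches a point that neither has
  visited before, but which one may depend on \<open>n\<close>. If both points were old, each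
  combination of reasons would make both orbits finite.\<close>

lemma new_orbit_point:
  fixes f :: "'a \<Rightarrow> 'a"
  assumes inf: "\<not> (finite (range (\<lambda>n. (f ^^ n) x)) \<and> finite (range (\<lambda>n. (f ^^ n) y)))"
  shows "(\<forall>m<n. (f ^^ m) x \<noteq> (f ^^ n) x \<and> (f ^^ m) y \<noteq> (f ^^ n) x) \<or>
    (\<forall>m<n. (f ^^ m) y \<noteq> (f ^^ n) y \<and> (f ^^ m) x \<noteq> (f ^^ n) y)"
proof (rule ccontr)
  let ?fin = "\<lambda>z. finite (range (\<lambda>n. (f ^^ n) z))"
  assume "\<not> ?thesis"
  then obtain m m' where m: "m < n" "(f ^^ m) x = (f ^^ n) x \<or> (f ^^ m) y = (f ^^ n) x"
    and m': "m' < n" "(f ^^ m') y = (f ^^ n) y \<or> (f ^^ m') x = (f ^^ n) y" by blast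
  have xy: "?fin x \<Longrightarrow> ?fin y" if "(f ^^ i) x = (f ^^ j) y" for i j
    using finite_orbit_trans[OF that[symmetric]] .
  have yx: "?fin y \<Longrightarrow> ?fin x" if "(f ^^ i) x = (f ^^ j) y" for i j
    using finite_orbit_trans[OF that] .
  consider "(f ^^ m) x = (f ^^ n) x" "(f ^^ m') y = (f ^^ n) y"
    | "(f ^^ m) x = (f ^^ n) x" "(f ^^ m') x = (f ^^ n) y"
    | "(f ^^ n) x = (f ^^ m) y" "(f ^^ m') y = (f ^^ n) y"
    | "(f ^^ n) x = (f ^^ m) y" "(f ^^ m') x = (f ^^ n) y" using m m' by metis
  then have "?fin x \<and> ?fin y"
  proof cases
    case 1
    then show ?thesis using finite_orbit_if_repeat[of m f x n] finite_orbit_if_repeat[of m' f y n] m m' by blast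
  next
    case 2
    then show ?thesis using finite_orbit_if_repeat[of m f x n] xy m by blast
  next
    case 3
    then show ?thesis using finite_orbit_if_repeat[of m' f y n] yx m' by blast
  next
    case 4
    \<comment> \<open>Both points were visited by the other orbit. Following \<open>x\<close> to
      \<open>y\<close> and back produces a repetition in the orbit of \<open>x\<close>, since
      \<open>m' < n\<close>.\<close>
    have "(f ^^ (n - m + n)) x = (f ^^ (n - m)) ((f ^^ m) y)" by (simp add: funpow_add 4(1))
    also have "\<dots> = (f ^^ (n - m + m)) y" by (simp only: funpow_add comp_apply)
    also have "\<dots> = (f ^^ m') x" using m(1) 4(2) by simp
    finally have "(f ^^ m') x = (f ^^ (n - m + n)) x" ..
    then have "?fin x" using m'(1) by (intro finite_orbit_if_repeat[of m' f x "n - m + n"]) auto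
    then show ?thesis using xy 4(1) by blast
  qed
  then show False using inf by blast
qed

text \<open>The orbits share a tail, so both are infinite. An equality with different indices,
  pushed forward by \<open>r\<close> steps, would be a repetition in the orbit of
  \<open>x\<close>.\<close>

lemma orbit_collision:
  fixes f :: "'a \<Rightarrow> 'a"
  assumes inf: "\<not> (finite (range (\<lambda>n. (f ^^ n) x)) \<and> finite (range (\<lambda>n. (f ^^ n) y)))"
    and coll: "(f ^^ r) x = (f ^^ r) y" and m: "m < n"
  shows "(f ^^ m) x \<noteq> (f ^^ n) x" "(f ^^ m) y \<noteq> (f ^^ n) x"
proof -
  have inj: "(f ^^ i) x \<noteq> (f ^^ j) x" if "i < j" for i j
  proof
    assume "(f ^^ i) x = (f ^^ j) x"
    then have "finite (range (\<lambda>n. (f ^^ n) x))" using that by (rule finite_orbit_if_repeat)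
    then show False using inf finite_orbit_trans[OF coll[symmetric]] by blast
  qed
  then show "(f ^^ m) x \<noteq> (f ^^ n) x" using m by blast
  show "(f ^^ m) y \<noteq> (f ^^ n) x"
  proof
    assume "(f ^^ m) y = (f ^^ n) x"
    then have "(f ^^ r) ((f ^^ m) y) = (f ^^ r) ((f ^^ n) x)" by simp
    then have "(f ^^ (m + r)) y = (f ^^ (n + r)) x"
      by (metis add.commute comp_apply funpow_add)
    moreover have "(f ^^ (m + r)) y = (f ^^ (m + r)) x" using coll by (simp add: funpow_add)
    ultimately show False using inj[of "m + r" "n + r"] m by simp
  qed
qed

context iterated_map
begin

lemma branch_points:
  assumes crit: "\<And>z. J (px z) (py z) = 0 \<longleftrightarrow> z = p \<or> z = q" and pq: "p \<noteq> q"
  shows "branch z \<longleftrightarrow> z = F p \<or> z = F q" "F p \<noteq> F q"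
proof -
  show "branch z \<longleftrightarrow> z = F p \<or> z = F q"
    using F_surj_on_branch[of z] D_F crit by metis
  show "F p \<noteq> F q" using fibre_of_branch_point[of p q] D_F[of p] crit[of p] pq by auto
qed

text \<open>The critical value that supplies the single swap is chosen afresh for every
  level.\<close>

theorem G_geom_full:
  assumes br: "\<And>z. branch z \<longleftrightarrow> z = p \<or> z = q" "p \<noteq> q"
    and inf: "\<not> (finite (range (\<lambda>n. (F ^^ n) p)) \<and> finite (range (\<lambda>n. (F ^^ n) q)))"
    and ne: "\<And>r. r \<ge> 1 \<Longrightarrow> (F ^^ r) p \<noteq> (F ^^ r) q"
  shows "G_geom \<iota> \<phi> = tree_auts" "G_arith \<iota> \<phi> = tree_auts"
proof -
  have ne': "(F ^^ n) p \<noteq> (F ^^ n) q" for n using ne[of n] br(2) by (cases "n = 0") auto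
  have br': "branch z \<longleftrightarrow> z = q \<or> z = p" for z using br(1) by blast
  have "\<exists>h\<in>G_geom \<iota> \<phi>. single_swap n h" for n
  proof -
    have le: "m \<le> n \<longleftrightarrow> m < n \<or> m = n" for m by auto
    from new_orbit_point[OF inf, of n] show ?thesis
    proof
      assume "\<forall>m<n. (F ^^ m) p \<noteq> (F ^^ n) p \<and> (F ^^ m) q \<noteq> (F ^^ n) p"
      then show ?thesis using ne'[of n] le by (intro single_swap_exists[OF br(1)]) auto
    next
      assume "\<forall>m<n. (F ^^ m) q \<noteq> (F ^^ n) q \<and> (F ^^ m) p \<noteq> (F ^^ n) q"
      then show ?thesis using ne'[of n] le by (intro single_swap_exists[OF br']) auto
    qed
  qed
  then show 1: "G_geom \<iota> \<phi> = tree_auts"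
    by (intro closed_subgroup_eq_tree_auts[OF aut_subgroup_G_geom G_geom_closed])
  show "G_arith \<iota> \<phi> = tree_auts"
    using 1 GalGeom_sub_Gal monodromy_aut unfolding G_geom_eq G_arith_eq by blast
qed

theorem G_geom_conj:
  assumes br: "\<And>z. branch z \<longleftrightarrow> z = p \<or> z = q" "p \<noteq> q"
    and K: "p \<in> proj_points K0" "q \<in> proj_points K0"
    and inf: "\<not> (finite (range (\<lambda>n. (F ^^ n) p)) \<and> finite (range (\<lambda>n. (F ^^ n) q)))"
    and r: "r \<ge> 1" "(F ^^ r) p = (F ^^ r) q" "\<And>s. 1 \<le> s \<Longrightarrow> s < r \<Longrightarrow> (F ^^ s) p \<noteq> (F ^^ s) q"
  shows "\<exists>w\<in>tree_auts. G_geom \<iota> \<phi> = (\<lambda>g. w \<circ> (g \<circ> inv_into UNIV w)) ` G r"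
proof -
  have ne: "(F ^^ s) p \<noteq> (F ^^ s) q" if "s < r" for s using that r(3)[of s] br(2) by (cases "s = 0") auto
  note new = orbit_collision[OF inf r(2)]
  have "branch p" "branch q" using br(1) by simp_all
  then obtain \<eta> where eta: "\<And>v. \<eta> v = 1 \<or> \<eta> v = - 1"
    "\<And>h v. h \<in> G_geom \<iota> \<phi> \<Longrightarrow> block_sgn r h v = \<eta> v * \<eta> (h v)"
    using block_sgn_G_geom[OF br(2) _ _ K r(2)] by metis
  show ?thesis
  proof (rule closed_subgroup_conj_G[OF aut_subgroup_G_geom r(1) G_geom_closed eta])
    fix n assume n: "n < r"
    have "(F ^^ m) q \<noteq> (F ^^ n) p" if "m \<le> n" for m
      using new(2)[of m n] ne[OF n] that by (cases "m = n") auto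
    then show "\<exists>h\<in>G_geom \<iota> \<phi>. single_swap n h"
      by (intro single_swap_exists[OF br(1) new(1)])
  next
    fix n assume "r \<le> n"
    then show "\<exists>h\<in>G_geom \<iota> \<phi>. double_swap r n h"
      using ne[of "r - 1"] r by (intro double_swap_exists[OF br(1) r(1) _ new r(2)]) auto
  qed
qed

end

section \<open>Rational functions of degree two\<close>

lemma poly_degree_le_2:
  fixes p :: "'a::comm_ring_1 poly"
  assumes "degree p \<le> 2"
  shows "p = [:coeff p 0, coeff p 1, coeff p 2:]"
    "poly p x = coeff p 2 * x\<^sup>2 + coeff p 1 * x + coeff p 0"
proof -
  show p: "p = [:coeff p 0, coeff p 1, coeff p 2:]"
  proof (rule poly_eqI)
    fix n :: nat
    consider "n = 0" | "n = 1" | "n = 2" | "n > 2" by linarith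
    then show "coeff p n = coeff [:coeff p 0, coeff p 1, coeff p 2:] n"
    proof cases
      case 4
      then have "coeff p n = 0" using assms by (intro coeff_eq_0) simp
      moreover have "coeff [:coeff p 0, coeff p 1, coeff p 2:] n = 0"
        using 4 by (intro coeff_eq_0 le_less_trans[OF degree_pCons_le]) (auto intro!: le_less_trans[OF degree_pCons_le])
      ultimately show ?thesis by simp
    qed (simp_all add: numeral_2_eq_2)
  qed
  show "poly p x = coeff p 2 * x\<^sup>2 + coeff p 1 * x + coeff p 0"
    by (subst p) (simp add: power2_eq_square algebra_simps)
qed

lemma proportional_not_coprime:
  fixes A B :: "'a::field poly"
  assumes "coprime A B" "max (degree A) (degree B) = 2"
  shows "A \<noteq> smult k B" "B \<noteq> smult k A"
proof -
  have u: "is_unit B" if "A = smult k B" using assms(1) that by (metis coprime_def dvd_refl dvd_smult)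
  have "is_unit A" if "B = smult k A" using assms(1) that by (metis coprime_def dvd_refl dvd_smult)
  then show "B \<noteq> smult k A" using assms(2) by (auto simp: is_unit_iff_degree max_def split: if_splits)
      (metis degree_smult_le is_unit_iff_degree le_zero_eq not_is_unit_0 zero_neq_numeral)+
  show "A \<noteq> smult k B" using u assms(2) by (auto simp: is_unit_iff_degree max_def split: if_splits)
      (metis degree_smult_le is_unit_iff_degree le_zero_eq not_is_unit_0 zero_neq_numeral)+
qed

text \<open>If the resultant vanishes, the coefficient vectors are proportional: with factors
  \<open>a2\<close>, \<open>b2\<close> if \<open>\<alpha> = 0\<close>, and otherwise with factors
  \<open>poly A x\<close>, \<open>poly B x\<close> at \<open>x = - \<beta> / \<alpha>\<close>, which
  by coprimality are not both zero.\<close>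

lemma resultant_nonzero:
  fixes A B :: "'a::field poly"
  assumes co: "coprime A B" and deg: "max (degree A) (degree B) = 2"
  shows "(coeff A 2 * coeff B 0 - coeff A 0 * coeff B 2)\<^sup>2 -
     (coeff A 2 * coeff B 1 - coeff A 1 * coeff B 2) * (coeff A 1 * coeff B 0 - coeff A 0 * coeff B 1) \<noteq> 0"
proof
  define a0 a1 a2 b0 b1 b2 where ab: "a0 = coeff A 0" "a1 = coeff A 1" "a2 = coeff A 2"
    "b0 = coeff B 0" "b1 = coeff B 1" "b2 = coeff B 2"
  define \<alpha> \<beta> \<gamma> where abc: "\<alpha> = a2 * b1 - a1 * b2" "\<beta> = a2 * b0 - a0 * b2" "\<gamma> = a1 * b0 - a0 * b1"
  assume "(coeff A 2 * coeff B 0 - coeff A 0 * coeff B 2)\<^sup>2 -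
     (coeff A 2 * coeff B 1 - coeff A 1 * coeff B 2) * (coeff A 1 * coeff B 0 - coeff A 0 * coeff B 1) = 0"
  then have z: "\<beta>\<^sup>2 = \<alpha> * \<gamma>" by (simp add: abc ab)
  have dA: "degree A \<le> 2" and dB: "degree B \<le> 2" using deg by auto
  note A = poly_degree_le_2[OF dA, folded ab] and B = poly_degree_le_2[OF dB, folded ab]
  have proportional: False if *: "\<And>i. i \<in> {0, 1, 2} \<Longrightarrow> coeff B i * x = coeff A i * y" and "x \<noteq> 0 \<or> y \<noteq> 0" for x y
  proof -
    have e: "b0 * x = a0 * y" "b1 * x = a1 * y" "b2 * x = a2 * y" using * by (simp_all add: ab)
    show False
    proof (cases "x = 0")
      case True
      then have "A = smult 0 B" using e that(2) A(1) by simp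
      then show False using proportional_not_coprime[OF co deg] by blast
    next
      case False
      then have "B = smult (y / x) A" using e by (subst A(1), subst B(1)) (simp add: field_simps)
      then show False using proportional_not_coprime[OF co deg] by blast
    qed
  qed
  show False
  proof (cases "\<alpha> = 0")
    case True
    then have "\<beta> = 0" using z by simp
    have "a2 \<noteq> 0 \<or> b2 \<noteq> 0"
    proof -
      have "degree A = 2 \<or> degree B = 2" using deg by (auto simp: max_def split: if_splits)
      then show ?thesis using ab by (metis degree_0 leading_coeff_0_iff zero_neq_numeral)
    qed
    moreover have "b0 * a2 = a0 * b2" "b1 * a2 = a1 * b2" "b2 * a2 = a2 * b2"
      using True \<open>\<beta> = 0\<close> by (simp_all add: abc mult.commute)
    then have "coeff B i * a2 = coeff A i * b2" if "i \<in> {0, 1, 2}" for i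
      using that by (auto simp only: ab insert_iff empty_iff)
    ultimately show False using proportional by blast
  next
    case False
    define x where "x = - \<beta> / \<alpha>"
    have 1: "\<alpha> * x + \<beta> = 0" using False by (simp add: x_def)
    have "\<alpha> * (\<beta> * x + \<gamma>) = \<beta> * (\<alpha> * x + \<beta>) + (\<alpha> * \<gamma> - \<beta>\<^sup>2)" by (simp add: power2_eq_square algebra_simps)
    then have 2: "\<beta> * x + \<gamma> = 0" using 1 z False by simp
    have "\<alpha> * x\<^sup>2 - \<gamma> = x * (\<alpha> * x + \<beta>) - (\<beta> * x + \<gamma>)" by (simp add: power2_eq_square algebra_simps)
    then have 3: "\<alpha> * x\<^sup>2 - \<gamma> = 0" using 1 2 by simp
    have "b2 * poly A x - a2 * poly B x = - (\<alpha> * x + \<beta>)" "b0 * poly A x - a0 * poly B x = x * (\<beta> * x + \<gamma>)"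
      "b1 * poly A x - a1 * poly B x = \<alpha> * x\<^sup>2 - \<gamma>"
      by (simp_all add: A(2) B(2) abc power2_eq_square algebra_simps)
    then have "coeff B i * poly A x = coeff A i * poly B x" if "i \<in> {0, 1, 2}" for i
      using that 1 2 3 by (auto simp: ab)
    moreover have "poly A x \<noteq> 0 \<or> poly B x \<noteq> 0"
    proof -
      obtain u v where "u * A + v * B = 1" using coprime_poly_bezout[OF co] by blast
      then have "poly u x * poly A x + poly v x * poly B x = 1" by (metis poly_1 poly_add poly_mult)
      then show ?thesis by auto
    qed
    ultimately show False using proportional by blast
  qed
qed

lemma order_ge_2_iff:
  fixes Q :: "'a::field poly"
  assumes Q: "Q = [:q0, q1, q2:]" "Q \<noteq> 0" "poly Q x = 0"
  shows "Polynomial.order x Q \<ge> 2 \<longleftrightarrow> 2 * q2 * x + q1 = 0"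
proof -
  have "Polynomial.order x Q \<ge> 2 \<longleftrightarrow> [:- x, 1:] ^ 2 dvd Q" using Q(2) by (simp add: order_divides)
  also have "\<dots> \<longleftrightarrow> 2 * q2 * x + q1 = 0"
  proof
    assume "[:- x, 1:] ^ 2 dvd Q"
    then obtain R where "Q = [:- x, 1:] ^ 2 * R" by (elim dvdE)
    then have R: "Q = [:- x, 1:] * ([:- x, 1:] * R)" by (simp only: power2_eq_square mult.assoc)
    have "poly (pderiv Q) x = 0" unfolding R pderiv_mult poly_add poly_mult by simp
    then show "2 * q2 * x + q1 = 0" by (simp add: Q(1) pderiv_pCons algebra_simps)
  next
    assume "2 * q2 * x + q1 = 0"
    then have q1: "q1 = - (2 * q2 * x)" by (simp add: eq_neg_iff_add_eq_0 add.commute)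
    have "q0 = - (x * (q1 + x * q2))" using Q(3) by (simp add: Q(1) eq_neg_iff_add_eq_0)
    then have "Q = [:- x, 1:] ^ 2 * [:q2:]" by (simp add: Q(1) q1 power2_eq_square algebra_simps)
    then show "[:- x, 1:] ^ 2 dvd Q" by (metis dvd_triv_left)
  qed
  finally show ?thesis .
qed

context quadratic_map
begin

lemma rat_map_eq_F:
  assumes A: "A' = [:a0, a1, a2:]" and B: "B' = [:b0, b1, b2:]" and deg: "max (degree A') (degree B') = 2"
  shows "rat_map (A', B') = F"
proof
  fix p
  show "rat_map (A', B') p = F p"
  proof (cases p)
    case (Fin x)
    then show ?thesis
      by (simp add: F_def A_def B_def qform_def A B power2_eq_square algebra_simps)
  next
    case Infty
    then show ?thesis using deg by (simp add: F_def A_def B_def qform_def A B numeral_2_eq_2)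
  qed
qed

text \<open>At a finite point the derivative of the fibre polynomial equals \<open>J\<close>. At
  infinity the quadratic coefficient of this polynomial cancels automatically, and index two means
  that the linear one vanishes as well.\<close>

lemma critical_points_eq:
  assumes A: "A' = [:a0, a1, a2:]" and B: "B' = [:b0, b1, b2:]" and deg: "max (degree A') (degree B') = 2"
  shows "critical_points (A', B') = {z. J (px z) (py z) = 0}"
  unfolding set_eq_iff
proof (rule allI)
  fix z
  show "z \<in> critical_points (A', B') \<longleftrightarrow> z \<in> {z. J (px z) (py z) = 0}"
  proof (cases z)
    case (Fin x)
    define u v where "u = poly A' x" and "v = poly B' x"
    have uv: "u = a2 * x\<^sup>2 + a1 * x + a0" "v = b2 * x\<^sup>2 + b1 * x + b0"
      by (simp_all add: u_def v_def A B power2_eq_square algebra_simps)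
    define Q where "Q = smult v A' - smult u B'"
    have Q: "Q = [:v * a0 - u * b0, v * a1 - u * b1, v * a2 - u * b2:]" by (simp add: Q_def A B)
    have nz: "u \<noteq> 0 \<or> v \<noteq> 0" using AB_nonzero[of x 1] by (simp add: uv A_def B_def qform_def)
    have "Q \<noteq> 0" using fibre_form_nonzero[OF nz] by (auto simp: Q mult.commute)
    moreover have "poly Q x = 0" by (simp add: Q_def u_def v_def)
    ultimately have "Polynomial.order x Q \<ge> 2 \<longleftrightarrow> 2 * (v * a2 - u * b2) * x + (v * a1 - u * b1) = 0"
      by (intro order_ge_2_iff[OF Q])
    also have "2 * (v * a2 - u * b2) * x + (v * a1 - u * b1) = J x 1"
      by (simp add: uv J_def qform_def power2_eq_square algebra_simps)
    finally show ?thesis using Fin by (simp add: critical_points_def Q_def u_def v_def)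
  next
    case Infty
    have "degree (smult b2 A' - smult a2 B') = 0 \<longleftrightarrow> b2 * a1 - a2 * b1 = 0"
      by (simp add: A B)
    moreover have cA: "coeff A' 2 = a2" "coeff B' 2 = b2" by (simp_all add: A B numeral_2_eq_2)
    have "ramification_index (A', B') Infty = 2 - degree (smult b2 A' - smult a2 B')"
      unfolding ramification_index.simps Let_def deg cA ..
    then have "2 \<le> ramification_index (A', B') Infty \<longleftrightarrow> degree (smult b2 A' - smult a2 B') = 0"
      by (simp only:) arith
    moreover have "J 1 0 = - (b2 * a1 - a2 * b1)" by (simp add: J_def qform_def mult.commute)
    ultimately have "2 \<le> ramification_index (A', B') Infty \<longleftrightarrow> J 1 0 = 0"
      by (simp only: neg_equal_0_iff_equal)
    then show ?thesis using Infty by (simp add: critical_points_def)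
  qed
qed

end

theorem theorem4p8p1:
  fixes \<iota> :: "'k::field poly fract \<Rightarrow> 'l::field"
    and f :: "'k poly fract"
    and F :: "'l proj_line \<Rightarrow> 'l proj_line"
    and p\<^sub>0 q\<^sub>0 :: "'l proj_line"
    and \<phi> :: "vertex \<Rightarrow> nat \<times> 'l proj_line"
  assumes char: "CHAR('k) \<noteq> 2"
    and sep_closure: "is_separable_closure \<iota>"
    and deg: "rat_degree f = 2"
    and F_def: "F = rat_map (base_change (const_emb \<iota>) f)"
    and crit: "critical_points (base_change (const_emb \<iota>) f) \<inter> proj_points (const_closure \<iota>) = {p\<^sub>0, q\<^sub>0}"
    and inf_orbit: "infinite (\<Union>n\<in>{1..}. (F ^^ n) ` {p\<^sub>0, q\<^sub>0})"
    and tree: "tree_identification F (Fin (t_elem \<iota>)) \<phi>"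
  shows "((\<forall>r\<ge>1. (F ^^ (r + 1)) p\<^sub>0 \<noteq> (F ^^ (r + 1)) q\<^sub>0) \<longrightarrow>
            G_geom \<iota> \<phi> = carrier W \<and> G_arith \<iota> \<phi> = carrier W) \<and>
         (\<forall>r\<ge>1. (F ^^ (r + 1)) p\<^sub>0 = (F ^^ (r + 1)) q\<^sub>0 \<and>
                  (\<forall>s. 1 \<le> s \<and> s < r \<longrightarrow> (F ^^ (s + 1)) p\<^sub>0 \<noteq> (F ^^ (s + 1)) q\<^sub>0) \<longrightarrow>
            (\<exists>w\<in>carrier W. G_geom \<iota> \<phi> = (\<lambda>g. w \<otimes>\<^bsub>W\<^esub> g \<otimes>\<^bsub>W\<^esub> inv\<^bsub>W\<^esub> w) ` G r))"
proof -
  define c where "c = const_emb \<iota>"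
  have c: "field_hom c"
    unfolding c_def using sep_closure by (intro field_hom_const_emb) (simp add: is_separable_closure_def)
  note cs = field_hom_simps[OF c]
  obtain A0 B0 where lt: "lowest_terms f = (A0, B0)" by (cases "lowest_terms f")
  have "case lowest_terms f of (A, B) \<Rightarrow> f = Fract A B \<and> coprime A B \<and> lead_coeff B = 1"
    unfolding lowest_terms_def by (rule theI'[OF lowest_terms_ex1])
  then have co: "coprime A0 B0" by (simp add: lt)
  have d0: "max (degree A0) (degree B0) = 2" using deg by (simp add: rat_degree_def lt)
  have "(2::'k) \<noteq> 0"
  proof
    assume "(2::'k) = 0"
    then have "of_nat 2 = (0::'k)" by simp
    then have "CHAR('k) dvd 2" by (simp only: of_nat_eq_0_iff_char_dvd)
    moreover have "CHAR('k) \<noteq> 1" by simp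
    ultimately show False using char by (metis One_nat_def Suc_1 dvd_imp_le le_SucE le_zero_eq not_numeral_le_zero dvd_0_left_iff numeral_2_eq_2 zero_less_Suc)
  qed
  moreover have "c 2 = 2" using cs(3)[of 1 1] cs(2) by simp
  ultimately have two: "(2::'l) \<noteq> 0" using cs(5)[of 2] by auto
  define a0 a1 a2 b0 b1 b2 where ab: "a0 = c (coeff A0 0)" "a1 = c (coeff A0 1)" "a2 = c (coeff A0 2)"
    "b0 = c (coeff B0 0)" "b1 = c (coeff B0 1)" "b2 = c (coeff B0 2)"
  have res: "(a2 * b0 - a0 * b2)\<^sup>2 - (a2 * b1 - a1 * b2) * (a1 * b0 - a0 * b1) \<noteq> 0"
  proof -
    have "(a2 * b0 - a0 * b2)\<^sup>2 - (a2 * b1 - a1 * b2) * (a1 * b0 - a0 * b1) =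
      c ((coeff A0 2 * coeff B0 0 - coeff A0 0 * coeff B0 2)\<^sup>2 -
       (coeff A0 2 * coeff B0 1 - coeff A0 1 * coeff B0 2) * (coeff A0 1 * coeff B0 0 - coeff A0 0 * coeff B0 1))"
      by (simp add: ab cs power2_eq_square)
    then show ?thesis using cs(5) resultant_nonzero[OF co d0] by simp
  qed
  interpret Q: quadratic_map a0 a1 a2 b0 b1 b2 using two res by unfold_locales
  define A B where AB: "A = map_poly c A0" "B = map_poly c B0"
  have bc: "base_change (const_emb \<iota>) f = (A, B)" by (simp add: base_change_def lt AB c_def)
  have dm: "degree (map_poly c p) = degree p" for p
    using degree_map_poly_hom_on[of UNIV c p] c by (simp add: field_hom_iff)
  have dAB: "max (degree A) (degree B) = 2" using d0 by (simp add: AB dm)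
  then have "degree A \<le> 2" "degree B \<le> 2" by auto
  then have A: "A = [:a0, a1, a2:]" and B: "B = [:b0, b1, b2:]"
    using poly_degree_le_2(1)[of A] poly_degree_le_2(1)[of B] by (simp_all add: AB ab coeff_map_poly cs)
  have F: "F = Q.F" unfolding F_def bc by (rule Q.rat_map_eq_F[OF A B dAB])
  interpret iterated_map a0 a1 a2 b0 b1 b2 \<iota> \<phi>
    using sep_closure tree by unfold_locales (auto simp: ab c_def F)
  have "critical_points (A, B) = {z. Q.J (px z) (py z) = 0}" by (rule Q.critical_points_eq[OF A B dAB])
  then have cr: "{z. Q.J (px z) (py z) = 0} \<inter> proj_points (const_closure \<iota>) = {p\<^sub>0, q\<^sub>0}"
    using crit by (simp add: bc)
  obtain p q where pq: "p \<noteq> q" "p \<in> proj_points K0" "q \<in> proj_points K0"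
    "\<And>z. Q.J (px z) (py z) = 0 \<longleftrightarrow> z = p \<or> z = q" using critical_points_exist by blast
  \<comment> \<open>All critical points are defined over \<open>K0\<close>, so restricting to
    separable constants loses none of them, and the two given points are distinct.\<close>
  have "proj_points K0 \<subseteq> proj_points (const_closure \<iota>)" using K0_const_closure by (auto simp: proj_points_def)
  then have "{p, q} = {p\<^sub>0, q\<^sub>0}" using cr pq by auto
  then have crit0: "\<And>z. Q.J (px z) (py z) = 0 \<longleftrightarrow> z = p\<^sub>0 \<or> z = q\<^sub>0" and ne0: "p\<^sub>0 \<noteq> q\<^sub>0"
    and K: "p\<^sub>0 \<in> proj_points K0" "q\<^sub>0 \<in> proj_points K0"
    using pq by (auto simp: doubleton_eq_iff)
  note br = branch_points[OF crit0 ne0]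
  have KF: "F p\<^sub>0 \<in> proj_points K0" "F q\<^sub>0 \<in> proj_points K0"
    unfolding F using K F_proj_points[OF subfield_K0 range_c_K0] by auto
  \<comment> \<open>The preceding results start from the critical values, one step after the
    critical points; this accounts for the exponents \<open>r + 1\<close>.\<close>
  have Fr: "(F ^^ (n + 1)) x = (F ^^ n) (F x)" for n x by (simp add: funpow_swap1)
  have inf: "\<not> (finite (range (\<lambda>n. (F ^^ n) (F p\<^sub>0))) \<and> finite (range (\<lambda>n. (F ^^ n) (F q\<^sub>0))))"
  proof
    assume fin: "finite (range (\<lambda>n. (F ^^ n) (F p\<^sub>0))) \<and> finite (range (\<lambda>n. (F ^^ n) (F q\<^sub>0)))"
    have "(\<Union>n\<in>{1..}. (F ^^ n) ` {p\<^sub>0, q\<^sub>0}) \<subseteq> range (\<lambda>n. (F ^^ n) (F p\<^sub>0)) \<union> range (\<lambda>n. (F ^^ n) (F q\<^sub>0))"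
    proof
      fix z assume "z \<in> (\<Union>n\<in>{1..}. (F ^^ n) ` {p\<^sub>0, q\<^sub>0})"
      then obtain n x where "n \<ge> 1" "x \<in> {p\<^sub>0, q\<^sub>0}" "z = (F ^^ n) x" by blast
      then show "z \<in> range (\<lambda>n. (F ^^ n) (F p\<^sub>0)) \<union> range (\<lambda>n. (F ^^ n) (F q\<^sub>0))"
        using Fr[of "n - 1" x] by auto
    qed
    then show False using inf_orbit fin finite_subset by blast
  qed
  show ?thesis
  proof (intro conjI impI allI)
    assume "\<forall>r\<ge>1. (F ^^ (r + 1)) p\<^sub>0 \<noteq> (F ^^ (r + 1)) q\<^sub>0"
    then have ne: "(F ^^ r) (F p\<^sub>0) \<noteq> (F ^^ r) (F q\<^sub>0)" if "r \<ge> 1" for r using Fr that by metis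
    show "G_geom \<iota> \<phi> = carrier W" "G_arith \<iota> \<phi> = carrier W"
      using G_geom_full[OF br inf[unfolded F] ne[unfolded F]] by simp_all
  next
    fix r :: nat
    assume r: "1 \<le> r" and *: "(F ^^ (r + 1)) p\<^sub>0 = (F ^^ (r + 1)) q\<^sub>0 \<and>
      (\<forall>s. 1 \<le> s \<and> s < r \<longrightarrow> (F ^^ (s + 1)) p\<^sub>0 \<noteq> (F ^^ (s + 1)) q\<^sub>0)"
    then have e: "(F ^^ r) (F p\<^sub>0) = (F ^^ r) (F q\<^sub>0)"
      and m: "\<And>s. 1 \<le> s \<Longrightarrow> s < r \<Longrightarrow> (F ^^ s) (F p\<^sub>0) \<noteq> (F ^^ s) (F q\<^sub>0)"
      unfolding Fr by blast+
    obtain w where w: "w \<in> tree_auts" "G_geom \<iota> \<phi> = (\<lambda>g. w \<circ> (g \<circ> inv_into UNIV w)) ` G r"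
      using G_geom_conj[OF br KF[unfolded F] inf[unfolded F] r e[unfolded F] m[unfolded F]] by blast
    then show "\<exists>w\<in>carrier W. G_geom \<iota> \<phi> = (\<lambda>g. w \<otimes>\<^bsub>W\<^esub> g \<otimes>\<^bsub>W\<^esub> inv\<^bsub>W\<^esub> w) ` G r"
      by (intro bexI[of _ w]) (simp_all add: W_inv comp_assoc)
  qed
qed

end
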